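(* Let $n\ge2$, $\lambda=(\lambda_1,\lambda_2)\in\mathbb R^2$, $\mu\in\mathbb R$ and $\delta=\mu-\lambda_1-\lambda_2$. Assume that $\delta$ is resonant but not critical. For $P\in\mathcal S_{(i,p)}$, let $Q(P)$ be the unique eigenvector of $\mathcal C^{op}$ admitting $P$ as its principal symbol and whose polynomial form belongs to $\widetilde{\mathcal S_{(i,p)}}$. Then the map $Q$, linearly extended to $\mathcal S^{(2)}_\delta$, is $sl_{n+1}$-equivariant: $Q(L_XP)=L_X(Q(P))$ for all $X\in sl_{n+1}$ and $P\in\mathcal S^{(2)}_\delta$.
   Context: Everything is smooth; $x^1,\dots,x^n$ are the coordinates of $\mathbb R^n$, $\partial_i=\partial/\partial x^i$. For $\lambda\in\mathbb R$, densities of weight $\lambda$ are sections of the trivial line bundle $\Delta^\lambda(\mathbb R^n)$, identified with functions $\phi$ with $L_X\phi=\sum_iX^i\partial_i\phi+\lambda(\sum_i\partial_iX^i)\phi$. Bidifferential operators: $\mathcal M^2_{\mathit{diff}}(\lambda,\mu)$ is the space of bidifferential operators $T:(f,g)\mapsto\sum A_{a,b}D^afD^bg$ (finite sums, $a,b$ multi-indices) from densities of weights $\lambda_1$, $\lambda_2$ to densities of weight $\mu$; the coefficients are $\delta$-densities. Module structure: $(L_XT)(f,g)=L_X(T(f,g))-T(L_Xf,g)-T(f,L_Xg)$. The total order of $T$ is the largest $|a|+|b|$ with $A_{a,b}\neq0$. Symbols: $\mathcal S^{(2)}_\delta=\bigoplus_{k,l\ge0}\Gamma(\vee^kT\mathbb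 R^n\otimes\vee^lT\mathbb R^n\otimes\Delta^\delta(\mathbb R^n))$, viewed as polynomials in $\alpha,\beta\in\mathbb R^{n*}$ with $\delta$-densities as coefficients, with $L_XP=\sum_iX^i\partial_iP-\sum_{i,j}(\partial_jX^i)(\alpha_iD_{\alpha_j}+\beta_iD_{\beta_j})P+\delta(\sum_i\partial_iX^i)P$. The polynomial form of $T$ is $\sum A_{a,b}\alpha^a\beta^b\in\mathcal S^{(2)}_\delta$; its principal symbol is the homogeneous component of highest total degree of its polynomial form. $sl_{n+1}$ is the Lie algebra of vector fields spanned by $\partial_i$, $x^j\partial_i$, $x^j\sum_ix^i\partial_i$. The Casimir operator $\mathcal C^{op}$ on $\mathcal M^2_{\mathit{diff}}(\lambda,\mu)$ is $\sum_{i\ne j}L_{e_{ij}}L_{e_{ij}^*}+\sum_i(L_{e_{ii}}L_{e_{ii}^*}+L_{e_i}L_{e_i^*}+L_{\epsilon^i}L_{\epsilon^{i*}})$, where $e_{ij}=-x^j\partial_i$, $e_{ij}^*=e_{ji}$ ($i\neq j$), $e_{ii}=-x^i\partial_i-\sum_kx^k\partial_k$, $e_{ii}^*=-x^i\partial_i$, $e_i=-\partial_i$, $\epsilon^i=x^i\sum_kx^k\partial_k$, $e_i^*=\epsilon^i$, $\epsilon^{i*}=e_i$. $\vee^k\mathbb R^n\otimes\vee^l\mathbb R^n=\bigoplus_{q=0}^{\min(k,l)}V_{k,l,q}$, with $V_{k,l,q}$ the irreducible $gl(n,\mathbb R)$-submodule with two-line Young tableau of line lengths $k+l-q$ and $q$;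 $\mathcal S_{k,l,q}=\Gamma(V_{k,l,q}\otimes\Delta^\delta(\mathbb R^n))$; for $0\le p\le\lfloor i/2\rfloor$, $\mathcal S_{(i,p)}=\bigoplus_{k=p}^{i-p}\mathcal S_{k,i-k,p}$, so that $\mathcal S^{(2)}_\delta=\bigoplus_{i\ge0}\bigoplus_{0\le p\le\lfloor i/2\rfloor}\mathcal S_{(i,p)}$. Put $\widetilde{\mathcal S_{(i,p)}}=\bigoplus_{j,q\,:\,0\le p-q\le i-j}\mathcal S_{(j,q)}$ (over $j,q\in\mathbb N$ with $q\le\lfloor j/2\rfloor$). For $i,p\in\mathbb N$ put $\gamma_{i,p}=n(n+1)\delta(\delta-1)-2((n+1)\delta-n+p)i+2i^2+2p(p-1)$. The shift $\delta$ is resonant if there exist $i,p,j,q\in\mathbb N$ with $p\le\lfloor i/2\rfloor$, $q\le\lfloor j/2\rfloor$, $i>j$ and $\gamma_{i,p}=\gamma_{j,q}$; it is critical if such $i,p,j,q$ exist satisfying in addition $0\le p-q\le i-j$. *)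

theory Defs
  imports "HOL-Analysis.Analysis"
begin

text \<open>
  The index type has class \<open>{finite, linorder}\<close>: its elements are the labels 1, ..., n of the
  coordinates, in their order. The order is used to fix the order of the iterated partial
  derivatives (irrelevant on smooth functions) and to speak of highest weights.
\<close>

type_synonym 'n fn = "real^'n \<Rightarrow> real"
type_synonym 'n vfield = "real^'n \<Rightarrow> real^'n"
type_synonym 'n mindex = "'n \<Rightarrow> nat"

definition pderiv_at :: "'n \<Rightarrow> 'n::{finite,linorder} fn \<Rightarrow> 'n fn" where
  "pderiv_at i f = (\<lambda>x. frechet_derivative f (at x) (axis i 1))"

text \<open>All iterated partial derivatives are differentiable everywhere (hence continuous).\<close>

definition smooth :: "'n::{finite,linorder} fn \<Rightarrow> bool" where
  "smooth f \<longleftrightarrow> (\<forall>is. \<forall>x. foldr pderiv_at is f differentiable (at x))"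

definition multi_deriv :: "'n::{finite,linorder} mindex \<Rightarrow> 'n fn \<Rightarrow> 'n fn" where
  "multi_deriv a f = foldr (\<lambda>i. pderiv_at i ^^ a i) (sorted_list_of_set UNIV) f"

definition msize :: "'n::{finite,linorder} mindex \<Rightarrow> nat" where
  "msize a = (\<Sum>i\<in>UNIV. a i)"

definition diverg :: "'n::{finite,linorder} vfield \<Rightarrow> 'n fn" where
  "diverg X = (\<lambda>x. \<Sum>i\<in>UNIV. pderiv_at i (\<lambda>y. X y $ i) x)"

definition lie_dens :: "real \<Rightarrow> 'n::{finite,linorder} vfield \<Rightarrow> 'n fn \<Rightarrow> 'n fn" where
  "lie_dens w X f = (\<lambda>x. (\<Sum>i\<in>UNIV. X x $ i * pderiv_at i f x) + w * diverg X x * f x)"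

text \<open>
  A polynomial in \<open>\<alpha>\<close>, \<open>\<beta>\<close> is given by its coefficients: \<open>p a b\<close> is the coefficient of
  the monomial \<open>\<alpha>\<^sup>a \<beta>\<^sup>b\<close>.
\<close>

type_synonym 'n bipoly = "'n mindex \<Rightarrow> 'n mindex \<Rightarrow> real"

definition mult_alpha :: "'n \<Rightarrow> 'n::{finite,linorder} bipoly \<Rightarrow> 'n bipoly" where
  "mult_alpha i p = (\<lambda>a b. if a i = 0 then 0 else p (a(i := a i - 1)) b)"

definition mult_beta :: "'n \<Rightarrow> 'n::{finite,linorder} bipoly \<Rightarrow> 'n bipoly" where
  "mult_beta i p = (\<lambda>a b. if b i = 0 then 0 else p a (b(i := b i - 1)))"

definition D_alpha :: "'n \<Rightarrow> 'n::{finite,linorder} bipoly \<Rightarrow> 'n bipoly" where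
  "D_alpha j p = (\<lambda>a b. real (a j + 1) * p (a(j := a j + 1)) b)"

definition D_beta :: "'n \<Rightarrow> 'n::{finite,linorder} bipoly \<Rightarrow> 'n bipoly" where
  "D_beta j p = (\<lambda>a b. real (b j + 1) * p a (b(j := b j + 1)))"

text \<open>
  The operator \<open>\<alpha>\<^sub>i D\<^bsub>\<alpha>\<^sub>j\<^esub> + \<beta>\<^sub>i D\<^bsub>\<beta>\<^sub>j\<^esub>\<close>. It is the action of the elementary matrix mapping the
  j-th basis vector to the i-th one on the algebra of symmetric tensors, in which
  \<open>\<alpha>\<^sub>i\<close> and \<open>\<beta>\<^sub>i\<close> stand for the i-th basis vector.
\<close>

definition gl_unit :: "'n \<Rightarrow> 'n \<Rightarrow> 'n::{finite,linorder} bipoly \<Rightarrow> 'n bipoly" where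
  "gl_unit i j p =
     (\<lambda>a b. mult_alpha i (D_alpha j p) a b + mult_beta i (D_beta j p) a b)"

definition gl_act :: "real^'n::{finite,linorder}^'n::{finite,linorder} \<Rightarrow> 'n bipoly \<Rightarrow> 'n bipoly" where
  "gl_act A p = (\<lambda>a b. \<Sum>i\<in>UNIV. \<Sum>j\<in>UNIV. A $ i $ j * gl_unit i j p a b)"

definition bihomogeneous :: "nat \<Rightarrow> nat \<Rightarrow> 'n::{finite,linorder} bipoly set" where
  "bihomogeneous k l = {p. \<forall>a b. p a b \<noteq> 0 \<longrightarrow> msize a = k \<and> msize b = l}"

definition gl_submodule :: "'n::{finite,linorder} bipoly set \<Rightarrow> bool" where
  "gl_submodule W \<longleftrightarrow>
     (\<lambda>a b. 0) \<in> W \<and>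
     (\<forall>p\<in>W. \<forall>q\<in>W. (\<lambda>a b. p a b + q a b) \<in> W) \<and>
     (\<forall>c. \<forall>p\<in>W. (\<lambda>a b. c * p a b) \<in> W) \<and>
     (\<forall>A. \<forall>p\<in>W. gl_act A p \<in> W)"

definition gl_irreducible :: "'n::{finite,linorder} bipoly set \<Rightarrow> bool" where
  "gl_irreducible W \<longleftrightarrow>
     gl_submodule W \<and> W \<noteq> {\<lambda>a b. 0} \<and>
     (\<forall>U. gl_submodule U \<and> U \<subseteq> W \<longrightarrow> U = {\<lambda>a b. 0} \<or> U = W)"

text \<open>
  Length of the row of a Young diagram (list of line lengths) that belongs to the coordinate
  \<open>i\<close>: the first line for the first coordinate, and so on, 0 below the diagram.
\<close>

definition line_length :: "nat list \<Rightarrow> 'n::{finite,linorder} \<Rightarrow> nat" where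
  "line_length Y i = (let r = card {j. j < i} in if r < length Y then Y ! r else 0)"

text \<open>
  As usual, the irreducible representation of gl(n) attached to a Young diagram \<open>Y\<close> is the
  one whose highest weight is given by the line lengths of \<open>Y\<close>.
\<close>

definition highest_weight_vector :: "nat list \<Rightarrow> 'n::{finite,linorder} bipoly \<Rightarrow> bool" where
  "highest_weight_vector Y p \<longleftrightarrow>
     p \<noteq> (\<lambda>a b. 0) \<and>
     (\<forall>i. gl_unit i i p = (\<lambda>a b. real (line_length Y i) * p a b)) \<and>
     (\<forall>i j. i < j \<longrightarrow> gl_unit i j p = (\<lambda>a b. 0))"

definition has_young_diagram :: "nat list \<Rightarrow> 'n::{finite,linorder} bipoly set \<Rightarrow> bool" where
  "has_young_diagram Y W \<longleftrightarrow> gl_irreducible W \<and> (\<exists>p\<in>W. highest_weight_vector Y p)"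

text \<open>Used for \<open>q \<le> min k l\<close> only.\<close>

definition V :: "nat \<Rightarrow> nat \<Rightarrow> nat \<Rightarrow> 'n::{finite,linorder} bipoly set" where
  "V k l q = (THE W. W \<subseteq> bihomogeneous k l \<and> has_young_diagram [k + l - q, q] W)"

text \<open>\<open>P a b\<close> is the coefficient, a density, of the monomial \<open>\<alpha>\<^sup>a \<beta>\<^sup>b\<close>.\<close>

type_synonym 'n symbol = "'n mindex \<Rightarrow> 'n mindex \<Rightarrow> 'n fn"

definition symbols :: "'n::{finite,linorder} symbol set" where
  "symbols = {P. (\<forall>a b. smooth (P a b)) \<and> finite {(a, b). P a b \<noteq> (\<lambda>x. 0)}}"

definition lie_symbol ::
  "real \<Rightarrow> 'n::{finite,linorder} vfield \<Rightarrow> 'n symbol \<Rightarrow> 'n symbol" where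
  "lie_symbol \<delta> X P = (\<lambda>a b x.
     (\<Sum>i\<in>UNIV. X x $ i * pderiv_at i (P a b) x)
     - (\<Sum>i\<in>UNIV. \<Sum>j\<in>UNIV.
          pderiv_at j (\<lambda>y. X y $ i) x * gl_unit i j (\<lambda>a b. P a b x) a b)
     + \<delta> * diverg X x * P a b x)"

definition S_klq :: "nat \<Rightarrow> nat \<Rightarrow> nat \<Rightarrow> 'n::{finite,linorder} symbol set" where
  "S_klq k l q = {P \<in> symbols. \<forall>x. (\<lambda>a b. P a b x) \<in> V k l q}"

definition S_ip :: "nat \<Rightarrow> nat \<Rightarrow> 'n::{finite,linorder} symbol set" where
  "S_ip i p = {P. \<exists>R. (\<forall>k\<in>{p..i-p}. R k \<in> S_klq k (i - k) p) \<and>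
                      P = (\<lambda>a b x. \<Sum>k\<in>{p..i-p}. R k a b x)}"

definition tilde_index :: "nat \<Rightarrow> nat \<Rightarrow> (nat \<times> nat) set" where
  "tilde_index i p = {(j, q). q \<le> j div 2 \<and>
     0 \<le> int p - int q \<and> int p - int q \<le> int i - int j}"

definition S_tilde :: "nat \<Rightarrow> nat \<Rightarrow> 'n::{finite,linorder} symbol set" where
  "S_tilde i p = {P. \<exists>R. (\<forall>(j, q)\<in>tilde_index i p. R j q \<in> S_ip j q) \<and>
                         P = (\<lambda>a b x. \<Sum>(j, q)\<in>tilde_index i p. R j q a b x)}"

text \<open>
  The components of a symbol along the direct sum of the \<open>S_ip i p\<close>, \<open>p \<le> i div 2\<close>.
\<close>

definition components ::
  "'n::{finite,linorder} symbol \<Rightarrow> nat \<Rightarrow> nat \<Rightarrow> 'n symbol" where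
  "components P = (THE R.
     (\<forall>i p. if p \<le> i div 2 then R i p \<in> S_ip i p else R i p = (\<lambda>a b x. 0)) \<and>
     finite {(i, p). R i p \<noteq> (\<lambda>a b x. 0)} \<and>
     P = (\<lambda>a b x. \<Sum>(i, p) | R i p \<noteq> (\<lambda>a b x. 0). R i p a b x))"

text \<open>
  Operators act on pairs of smooth functions. They are made total by the value 0 on all other
  pairs, so that two operators are equal iff they agree on smooth functions.
\<close>

type_synonym 'n biop = "'n fn \<Rightarrow> 'n fn \<Rightarrow> 'n fn"

definition bidiff :: "'n::{finite,linorder} symbol \<Rightarrow> 'n biop" where
  "bidiff A = (\<lambda>f g. if smooth f \<and> smooth g
     then (\<lambda>x. \<Sum>(a, b) | A a b \<noteq> (\<lambda>x. 0). A a b x * multi_deriv a f x * multi_deriv b g x)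
     else (\<lambda>x. 0))"

definition bidiff_ops :: "'n::{finite,linorder} biop set" where
  "bidiff_ops = bidiff ` symbols"

definition polynomial_form :: "'n::{finite,linorder} biop \<Rightarrow> 'n symbol" where
  "polynomial_form T = (THE A. A \<in> symbols \<and> bidiff A = T)"

text \<open>The total order of the zero operator is unspecified; its principal symbol is 0.\<close>

definition total_order :: "'n::{finite,linorder} biop \<Rightarrow> nat" where
  "total_order T =
     Max {msize a + msize b | a b. polynomial_form T a b \<noteq> (\<lambda>x. 0)}"

definition principal_symbol :: "'n::{finite,linorder} biop \<Rightarrow> 'n symbol" where
  "principal_symbol T = (\<lambda>a b. if msize a + msize b = total_order T
     then polynomial_form T a b else (\<lambda>x. 0))"

text \<open>\<open>w1\<close>, \<open>w2\<close> are the weights of the arguments, \<open>\<mu>\<close> is the weight of the values.\<close>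

definition lie_op ::
  "real \<Rightarrow> real \<Rightarrow> real \<Rightarrow> 'n::{finite,linorder} vfield \<Rightarrow> 'n biop \<Rightarrow> 'n biop" where
  "lie_op w1 w2 \<mu> X T = (\<lambda>f g. if smooth f \<and> smooth g
     then (\<lambda>x. lie_dens \<mu> X (T f g) x - T (lie_dens w1 X f) g x - T f (lie_dens w2 X g) x)
     else (\<lambda>x. 0))"

definition sl_proj :: "'n::{finite,linorder} vfield set" where
  "sl_proj = {X. \<exists>u A v. X = (\<lambda>x.
     (\<Sum>i\<in>UNIV. u $ i *\<^sub>R axis i 1)
     + (\<Sum>i\<in>UNIV. \<Sum>j\<in>UNIV. A $ i $ j *\<^sub>R (x $ j *\<^sub>R axis i 1))
     + (\<Sum>j\<in>UNIV. v $ j *\<^sub>R (x $ j *\<^sub>R (\<Sum>i\<in>UNIV. x $ i *\<^sub>R axis i 1))))}"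

definition e_mat :: "'n \<Rightarrow> 'n \<Rightarrow> 'n::{finite,linorder} vfield" where
  "e_mat i j = (\<lambda>x. if i = j
     then - (x $ i *\<^sub>R axis i 1) - (\<Sum>k\<in>UNIV. x $ k *\<^sub>R axis k 1)
     else - (x $ j *\<^sub>R axis i 1))"

definition e_mat_dual :: "'n \<Rightarrow> 'n \<Rightarrow> 'n::{finite,linorder} vfield" where
  "e_mat_dual i j = (if i = j then (\<lambda>x. - (x $ i *\<^sub>R axis i 1)) else e_mat j i)"

definition e_vec :: "'n \<Rightarrow> 'n::{finite,linorder} vfield" where
  "e_vec i = (\<lambda>x. - axis i 1)"

definition eps :: "'n \<Rightarrow> 'n::{finite,linorder} vfield" where
  "eps i = (\<lambda>x. x $ i *\<^sub>R (\<Sum>k\<in>UNIV. x $ k *\<^sub>R axis k 1))"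

definition casimir_op ::
  "real \<Rightarrow> real \<Rightarrow> real \<Rightarrow> 'n::{finite,linorder} biop \<Rightarrow> 'n biop" where
  "casimir_op w1 w2 \<mu> T = (let L = lie_op w1 w2 \<mu> in (\<lambda>f g x.
     (\<Sum>(i, j) | i \<noteq> j. L (e_mat i j) (L (e_mat_dual i j) T) f g x)
     + (\<Sum>i\<in>UNIV. L (e_mat i i) (L (e_mat_dual i i) T) f g x
                 + L (e_vec i) (L (eps i) T) f g x
                 + L (eps i) (L (e_vec i) T) f g x)))"

definition gamma_ip :: "nat \<Rightarrow> real \<Rightarrow> nat \<Rightarrow> nat \<Rightarrow> real" where
  "gamma_ip n \<delta> i p =
     real n * (real n + 1) * \<delta> * (\<delta> - 1)
     - 2 * ((real n + 1) * \<delta> - real n + real p) * real i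
     + 2 * (real i)\<^sup>2 + 2 * real p * (real p - 1)"

definition resonant :: "nat \<Rightarrow> real \<Rightarrow> bool" where
  "resonant n \<delta> \<longleftrightarrow> (\<exists>i p j q. p \<le> i div 2 \<and> q \<le> j div 2 \<and> i > j \<and>
     gamma_ip n \<delta> i p = gamma_ip n \<delta> j q)"

definition critical :: "nat \<Rightarrow> real \<Rightarrow> bool" where
  "critical n \<delta> \<longleftrightarrow> (\<exists>i p j q. p \<le> i div 2 \<and> q \<le> j div 2 \<and> i > j \<and>
     gamma_ip n \<delta> i p = gamma_ip n \<delta> j q \<and>
     0 \<le> int p - int q \<and> int p - int q \<le> int i - int j)"

text \<open>
  \<open>T\<close> is an eigenvector of the Casimir operator with principal symbol \<open>P\<close> and polynomial form in
  \<open>S_tilde i p\<close>. The zero operator is admitted; by the condition on the principal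
  symbol it is excluded as soon as \<open>P\<close> is nonzero, and it is the only choice for \<open>P = 0\<close>.
\<close>

definition is_eigen_lift ::
  "real \<Rightarrow> real \<Rightarrow> real \<Rightarrow> nat \<Rightarrow> nat \<Rightarrow> 'n::{finite,linorder} symbol \<Rightarrow> 'n biop \<Rightarrow> bool" where
  "is_eigen_lift w1 w2 \<mu> i p P T \<longleftrightarrow>
     T \<in> bidiff_ops \<and>
     (\<exists>c. casimir_op w1 w2 \<mu> T = (\<lambda>f g x. c * T f g x)) \<and>
     principal_symbol T = P \<and>
     polynomial_form T \<in> S_tilde i p"

definition eigen_lift ::
  "real \<Rightarrow> real \<Rightarrow> real \<Rightarrow> nat \<Rightarrow> nat \<Rightarrow> 'n::{finite,linorder} symbol \<Rightarrow> 'n biop" where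
  "eigen_lift w1 w2 \<mu> i p P = (THE T. is_eigen_lift w1 w2 \<mu> i p P T)"

definition Q_map ::
  "real \<Rightarrow> real \<Rightarrow> real \<Rightarrow> 'n::{finite,linorder} symbol \<Rightarrow> 'n biop" where
  "Q_map w1 w2 \<mu> P = (\<lambda>f g x. \<Sum>(i, p) | components P i p \<noteq> (\<lambda>a b x. 0).
     eigen_lift w1 w2 \<mu> i p (components P i p) f g x)"

end

theory Submission
  imports Defs "HOL-Library.Function_Algebras"
begin

text \<open>
  An operator is determined by its polynomial form, so everything can be computed on
  symbols. Under this identification the Lie derivative along a field \<open>X\<close> with quadratic
  part \<open>\<Sum> v\<^sub>j x\<^sup>j x\<^sup>i \<partial>\<^sub>i\<close> becomes \<open>L\<^sub>X + \<Sum> v\<^sub>j N\<^sub>j\<close>, where \<open>L\<^sub>X\<close> is the Lie derivative of symbols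
  and \<open>N\<^sub>j\<close> (\<open>corr\<close>) is an operator with constant coefficients that lowers the degree by one
  (\<open>lie_op_bidiff\<close>). Consequently the Casimir operator becomes \<open>C - 2 \<Sum> N\<^sub>k \<partial>\<^sub>k\<close>, where \<open>C\<close>
  acts pointwise on the values of a symbol (\<open>casimir_op_bidiff\<close>).

  The operator \<open>C\<close> is a polynomial in the Euler operator and in one more gl(n)-invariant,
  the Capelli operator \<open>K = \<Sum> \<alpha>\<^sub>i \<beta>\<^sub>j (D\<^bsub>\<alpha>\<^sub>i\<^esub> D\<^bsub>\<beta>\<^sub>j\<^esub> - D\<^bsub>\<alpha>\<^sub>j\<^esub> D\<^bsub>\<beta>\<^sub>i\<^esub>)\<close>. The irreducible submodule with
  diagram \<open>(k + l - q, q)\<close> is the eigenspace of \<open>K\<close> for \<open>q (k + l + 1 - q)\<close> among the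
  bihomogeneous polynomials of bidegree \<open>(k, l)\<close> (\<open>V_eq_isotypic\<close>), so the symbols of type
  \<open>(i, p)\<close> are a joint eigenspace of two explicit operators (\<open>S_ip_eq_Sym\<close>), and \<open>C\<close>
  multiplies them by \<open>\<gamma>\<^bsub>i,p\<^esub>\<close>. A quadratic equation satisfied by \<open>K\<close> on \<open>D\<^bsub>\<alpha>\<^sub>j\<^esub> P\<close> and \<open>D\<^bsub>\<beta>\<^sub>j\<^esub> P\<close>
  shows that \<open>N\<^sub>j\<close> maps type \<open>(i, p)\<close> into the sum of the types \<open>(i - 1, p)\<close> and
  \<open>(i - 1, p - 1)\<close> (\<open>Sym_corr\<close>). The index set of \<open>S_tilde i p\<close> is closed under these two
  moves; hence that space is preserved by the Casimir operator and by all Lie derivatives.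

  On \<open>S_tilde i p\<close> the Casimir operator is therefore triangular with respect to the degree,
  with diagonal entries \<open>\<gamma>\<^bsub>j,q\<^esub>\<close>. If \<open>\<delta>\<close> is not critical, none of the entries below the top
  one equals \<open>\<gamma>\<^bsub>i,p\<^esub>\<close>; by induction on the degree the eigenvector with principal symbol \<open>P\<close>
  exists (\<open>casimir_form_solvable\<close>) and is unique (\<open>casimir_form_unique\<close>).

  Equivariance is a consequence of uniqueness. The Casimir operator commutes with the Lie
  derivatives (\<open>casimir_form_lie_form\<close>), so the Lie derivative of \<open>Q(P)\<close> is an eigenvector
  for the same eigenvalue; it lies in \<open>S_tilde i p\<close> again, and its top component is \<open>L\<^sub>X P\<close>
  because \<open>N\<^sub>j\<close> lowers the degree. So it is \<open>Q(L\<^sub>X P)\<close>.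
\<close>

section \<open>Polynomials in two covectors and their invariant differential operators\<close>

text \<open>
  Polynomials, symbols and operators are all functions with values in the reals. The
  pointwise vector space structure makes linear maps, subspaces and spans available for
  them.
\<close>

instantiation "fun" :: (type, scaleR) scaleR
begin
definition scaleR_fun_def: "c *\<^sub>R f = (\<lambda>x. c *\<^sub>R f x)"
instance ..
end

lemma scaleR_fun_apply [simp]: "(c *\<^sub>R f) x = c *\<^sub>R f x"
  by (simp add: scaleR_fun_def)

instance "fun" :: (type, real_vector) real_vector
  by standard (simp_all add: fun_eq_iff scaleR_add_right scaleR_add_left)

lemma sum_fun_apply [simp]: "(\<Sum>i\<in>S. f i) x = (\<Sum>i\<in>S. f i x)"
  by (induction S rule: infinite_finite_induct) auto

lemma zero_fun_eq: "(\<lambda>x. 0) = 0"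
  by (simp add: fun_eq_iff)

lemma linear_mult_alpha: "linear (mult_alpha i)"
  and linear_mult_beta: "linear (mult_beta i)"
  and linear_D_alpha: "linear (D_alpha i)"
  and linear_D_beta: "linear (D_beta i)"
  by (auto intro!: linearI simp: fun_eq_iff mult_alpha_def mult_beta_def D_alpha_def D_beta_def
      algebra_simps)

lemmas linear_weyl = linear_mult_alpha linear_mult_beta linear_D_alpha linear_D_beta

lemmas weyl_linear =
  linear_weyl[THEN linear_add] linear_weyl[THEN linear_diff] linear_weyl[THEN linear_0]
  linear_weyl[THEN linear_scale] linear_weyl[THEN linear_sum] linear_weyl[THEN linear_neg]

lemma D_alpha_mult_alpha:
  "D_alpha j (mult_alpha i p) = mult_alpha i (D_alpha j p) + of_bool (i = j) *\<^sub>R p"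
  by (cases "i = j")
    (auto simp: fun_eq_iff mult_alpha_def D_alpha_def fun_upd_twist algebra_simps)

lemma D_beta_mult_beta:
  "D_beta j (mult_beta i p) = mult_beta i (D_beta j p) + of_bool (i = j) *\<^sub>R p"
  by (cases "i = j")
    (auto simp: fun_eq_iff mult_beta_def D_beta_def fun_upd_twist algebra_simps)

lemma D_alpha_mult_beta: "D_alpha j (mult_beta i p) = mult_beta i (D_alpha j p)"
  and D_beta_mult_alpha: "D_beta j (mult_alpha i p) = mult_alpha i (D_beta j p)"
  and mult_beta_mult_alpha: "mult_beta j (mult_alpha i p) = mult_alpha i (mult_beta j p)"
  and D_beta_D_alpha: "D_beta j (D_alpha i p) = D_alpha i (D_beta j p)"
  by (simp_all add: fun_eq_iff mult_beta_def D_beta_def mult_alpha_def D_alpha_def)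

lemma mult_alpha_commute: "mult_alpha i (mult_alpha j p) = mult_alpha j (mult_alpha i p)"
  and mult_beta_commute: "mult_beta i (mult_beta j p) = mult_beta j (mult_beta i p)"
  by (cases "i = j"; auto simp add: fun_eq_iff mult_beta_def mult_alpha_def fun_upd_twist)+

lemma D_alpha_commute: "D_alpha i (D_alpha j p) = D_alpha j (D_alpha i p)"
  and D_beta_commute: "D_beta i (D_beta j p) = D_beta j (D_beta i p)"
  by (cases "i = j"; auto simp add: fun_eq_iff D_beta_def D_alpha_def fun_upd_twist)+

lemmas weyl_relations =
  D_alpha_mult_alpha D_beta_mult_beta D_alpha_mult_beta D_beta_mult_alpha
  mult_beta_mult_alpha D_beta_D_alpha
  mult_alpha_commute mult_beta_commute D_alpha_commute D_beta_commute

text \<open>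
  Exchanging \<open>\<alpha>\<close> and \<open>\<beta>\<close> turns each statement about the first argument into the one about
  the second, so that only one of the two has to be computed.
\<close>

definition swap_args :: "'n::{finite,linorder} bipoly \<Rightarrow> 'n bipoly" where
  "swap_args p = (\<lambda>a b. p b a)"

lemma swap_args_swap_args: "swap_args (swap_args p) = p"
  by (simp add: swap_args_def)

lemma linear_swap_args: "linear swap_args"
  by (auto intro!: linearI simp: swap_args_def fun_eq_iff)

lemmas swap_args_linear =
  linear_swap_args[THEN linear_add] linear_swap_args[THEN linear_diff]
  linear_swap_args[THEN linear_scale] linear_swap_args[THEN linear_sum]

lemma swap_args_weyl:
  "swap_args (mult_beta i p) = mult_alpha i (swap_args p)"
  "swap_args (D_beta i p) = D_alpha i (swap_args p)"
  "mult_beta i p = swap_args (mult_alpha i (swap_args p))"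
  "D_beta i p = swap_args (D_alpha i (swap_args p))"
  by (simp_all add: swap_args_def mult_beta_def mult_alpha_def D_alpha_def D_beta_def)

lemma swap_args_weyl_alpha:
  "swap_args (mult_alpha i p) = mult_beta i (swap_args p)"
  "swap_args (D_alpha i p) = D_beta i (swap_args p)"
  by (simp_all add: swap_args_weyl(3,4) swap_args_swap_args)

lemma sum_delta_scaleR [simp]:
  fixes f :: "'i::finite \<Rightarrow> 'v::real_vector"
  shows "(\<Sum>i\<in>UNIV. of_bool (i = j) *\<^sub>R f i) = f j"
      "(\<Sum>i\<in>UNIV. of_bool (j = i) *\<^sub>R f i) = f j"
  by (simp_all add: of_bool_def if_distrib[of "\<lambda>c. c *\<^sub>R _"] cong: if_cong)

lemma sum_sum_delta_scaleR [simp]: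
  fixes f :: "'i::finite \<Rightarrow> 'k::finite \<Rightarrow> 'v::real_vector"
  shows "(\<Sum>i\<in>UNIV. \<Sum>k\<in>UNIV. of_bool (i = j) *\<^sub>R f i k) = (\<Sum>k\<in>UNIV. f j k)"
    "(\<Sum>i\<in>UNIV. \<Sum>k\<in>UNIV. of_bool (j = i) *\<^sub>R f i k) = (\<Sum>k\<in>UNIV. f j k)"
  by (subst sum.swap, simp)+

lemma gl_unit_eq: "gl_unit i j p = mult_alpha i (D_alpha j p) + mult_beta i (D_beta j p)"
  by (simp add: gl_unit_def fun_eq_iff)

definition euler_alpha :: "'n::{finite,linorder} bipoly \<Rightarrow> 'n bipoly" where
  "euler_alpha p = (\<Sum>i\<in>UNIV. mult_alpha i (D_alpha i p))"

definition euler_beta :: "'n::{finite,linorder} bipoly \<Rightarrow> 'n bipoly" where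
  "euler_beta p = (\<Sum>i\<in>UNIV. mult_beta i (D_beta i p))"

text \<open>
  The polarization operators \<open>\<alpha> \<cdot> D\<^sub>\<beta>\<close> and \<open>\<beta> \<cdot> D\<^sub>\<alpha>\<close>. Together with the two Euler operators
  they span the gl(2) that mixes the two arguments and commutes with gl(n); the first raises
  the degree in \<open>\<alpha>\<close>, the second lowers it.
\<close>

definition polar_up :: "'n::{finite,linorder} bipoly \<Rightarrow> 'n bipoly" where
  "polar_up p = (\<Sum>i\<in>UNIV. mult_alpha i (D_beta i p))"

definition polar_down :: "'n::{finite,linorder} bipoly \<Rightarrow> 'n bipoly" where
  "polar_down p = (\<Sum>i\<in>UNIV. mult_beta i (D_alpha i p))"

text \<open>
  The generator, besides the Euler operator, of the centre of the enveloping algebra of the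
  gl(2) that mixes the two arguments. Its eigenvalues tell the gl(n)-types of a given degree
  apart, which replaces the decomposition into irreducible modules by explicit algebra.
\<close>

definition capelli :: "'n::{finite,linorder} bipoly \<Rightarrow> 'n bipoly" where
  "capelli p = (\<Sum>i\<in>UNIV. \<Sum>j\<in>UNIV. mult_alpha i (mult_beta j (D_alpha i (D_beta j p)))
     - mult_alpha i (mult_beta j (D_alpha j (D_beta i p))))"

lemma linear_gl_unit: "linear (gl_unit i j)"
  and linear_euler_alpha: "linear euler_alpha"
  and linear_euler_beta: "linear euler_beta"
  and linear_polar_up: "linear polar_up"
  and linear_polar_down: "linear polar_down"
  and linear_capelli: "linear capelli"
  by (auto intro!: linearI simp: gl_unit_eq euler_alpha_def euler_beta_def polar_up_def
      polar_down_def capelli_def weyl_linear sum.distrib sum_subtractf scaleR_sum_right algebra_simps)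

lemmas linear_gl = linear_gl_unit linear_euler_alpha linear_euler_beta linear_polar_up
  linear_polar_down linear_capelli

lemmas gl_linear =
  linear_gl[THEN linear_add] linear_gl[THEN linear_diff] linear_gl[THEN linear_0]
  linear_gl[THEN linear_scale] linear_gl[THEN linear_sum] linear_gl[THEN linear_neg]

lemmas weyl_sum = sum.distrib sum_subtractf scaleR_sum_right algebra_simps

lemma euler_alpha_apply: "euler_alpha p a b = real (msize a) * p a b"
  and euler_beta_apply: "euler_beta p a b = real (msize b) * p a b"
  by (auto simp: euler_alpha_def euler_beta_def mult_alpha_def mult_beta_def D_alpha_def
      D_beta_def msize_def sum_distrib_right intro!: sum.cong)

lemma gl_unit_diag_apply: "gl_unit i i p a b = real (a i + b i) * p a b"
  by (auto simp: gl_unit_def mult_alpha_def mult_beta_def D_alpha_def D_beta_def algebra_simps)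

lemma euler_commute_weyl:
  "D_alpha j (euler_alpha p) = euler_alpha (D_alpha j p) + D_alpha j p"
  "D_beta j (euler_beta p) = euler_beta (D_beta j p) + D_beta j p"
  "D_beta j (euler_alpha p) = euler_alpha (D_beta j p)"
  "D_alpha j (euler_beta p) = euler_beta (D_alpha j p)"
  by (simp_all add: euler_alpha_def euler_beta_def weyl_linear weyl_relations weyl_sum)

lemma gl_unit_commute_euler:
  "gl_unit i j (euler_alpha p) = euler_alpha (gl_unit i j p)"
  "gl_unit i j (euler_beta p) = euler_beta (gl_unit i j p)"
  by (simp_all add: euler_alpha_def euler_beta_def gl_unit_eq weyl_linear weyl_relations weyl_sum)

lemma gl_unit_commute_polar:
  "gl_unit i j (polar_up p) = polar_up (gl_unit i j p)"
  "gl_unit i j (polar_down p) = polar_down (gl_unit i j p)"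
  by (simp_all add: polar_up_def polar_down_def gl_unit_eq weyl_linear weyl_relations weyl_sum)

lemma capelli_polar_up_down:
  "capelli p = euler_alpha (euler_beta p) + euler_alpha p - polar_up (polar_down p)"
  by (simp add: capelli_def euler_alpha_def euler_beta_def polar_up_def polar_down_def weyl_linear
      weyl_relations weyl_sum)

lemma capelli_polar_down_up:
  "capelli p = euler_alpha (euler_beta p) + euler_beta p - polar_down (polar_up p)"
  by (simp add: capelli_def euler_alpha_def euler_beta_def polar_up_def polar_down_def weyl_linear
      weyl_relations weyl_sum; subst sum.swap; simp add: weyl_relations)

lemma gl_unit_commute_capelli: "gl_unit i j (capelli p) = capelli (gl_unit i j p)"
  by (simp add: capelli_polar_up_down gl_linear gl_unit_commute_euler gl_unit_commute_polar)

lemma polar_euler: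
  "polar_up (euler_alpha p) = euler_alpha (polar_up p) - polar_up p"
  "polar_up (euler_beta p) = euler_beta (polar_up p) + polar_up p"
  "polar_down (euler_alpha p) = euler_alpha (polar_down p) + polar_down p"
  "polar_down (euler_beta p) = euler_beta (polar_down p) - polar_down p"
  by (simp_all add: euler_alpha_def euler_beta_def polar_up_def polar_down_def weyl_linear
      weyl_relations weyl_sum;
      subst sum.swap; simp add: weyl_relations)+

lemma euler_commute: "euler_beta (euler_alpha p) = euler_alpha (euler_beta p)"
  by (simp add: fun_eq_iff euler_alpha_apply euler_beta_apply)

lemma polar_down_capelli: "polar_down (capelli p) = capelli (polar_down p)"
  by (subst capelli_polar_up_down, subst capelli_polar_down_up)
     (simp add: gl_linear polar_euler)

lemma D_alpha_polar_up: "D_alpha j (polar_up p) = polar_up (D_alpha j p) + D_beta j p"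
  and D_alpha_polar_down: "D_alpha j (polar_down p) = polar_down (D_alpha j p)"
  by (simp_all add: polar_up_def polar_down_def weyl_linear weyl_relations weyl_sum)

text \<open>
  The commutator of the Capelli operator with a derivative involves only the other
  derivative, polarized, and a degree: this is what confines the types of \<open>D\<^bsub>\<alpha>\<^sub>j\<^esub> p\<close> to two.
\<close>

lemma capelli_D_alpha:
  "capelli (D_alpha j p) = D_alpha j (capelli p) + polar_down (D_beta j p) - euler_beta (D_alpha j p)"
  by (simp add: capelli_polar_down_up weyl_linear gl_linear euler_commute_weyl D_alpha_polar_up
     D_alpha_polar_down)

lemma swap_args_euler_polar:
  "swap_args (euler_alpha p) = euler_beta (swap_args p)"
  "swap_args (euler_beta p) = euler_alpha (swap_args p)"
  "swap_args (polar_up p) = polar_down (swap_args p)"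
  "swap_args (polar_down p) = polar_up (swap_args p)"
  by (simp_all add: euler_alpha_def euler_beta_def polar_up_def polar_down_def swap_args_linear
      swap_args_weyl(1,2) swap_args_weyl_alpha)

lemma capelli_swap_args: "capelli (swap_args p) = swap_args (capelli p)"
  by (subst capelli_polar_up_down, subst capelli_polar_down_up)
    (simp add: swap_args_linear swap_args_euler_polar euler_commute)

lemma capelli_D_beta:
  "capelli (D_beta j p) = D_beta j (capelli p) + polar_up (D_alpha j p) - euler_alpha (D_beta j p)"
  unfolding swap_args_weyl(4) capelli_swap_args capelli_D_alpha
  by (simp add: swap_args_linear swap_args_euler_polar swap_args_weyl_alpha swap_args_weyl(2)
      swap_args_swap_args)

section \<open>The Casimir operator on constant symbols\<close>

lemma of_nat_mult_bipoly: "of_nat m * p = real m *\<^sub>R (p :: 'n::{finite,linorder} bipoly)"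
    "p * of_nat m = real m *\<^sub>R (p :: 'n::{finite,linorder} bipoly)"
  and numeral_mult_bipoly: "numeral m' * p = numeral m' *\<^sub>R (p :: 'n::{finite,linorder} bipoly)"
    "p * numeral m' = numeral m' *\<^sub>R (p :: 'n::{finite,linorder} bipoly)"
  by (simp_all add: fun_eq_iff mult.commute)

lemmas bipoly_mult = of_nat_mult_bipoly numeral_mult_bipoly

definition euler_total :: "'n::{finite,linorder} bipoly \<Rightarrow> 'n bipoly" where
  "euler_total p = euler_alpha p + euler_beta p"

lemma linear_euler_total: "linear euler_total"
  by (auto intro!: linearI simp: euler_total_def gl_linear algebra_simps)

lemmas euler_total_linear =
  linear_euler_total[THEN linear_add] linear_euler_total[THEN linear_diff]
  linear_euler_total[THEN linear_0] linear_euler_total[THEN linear_scale]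
  linear_euler_total[THEN linear_sum] linear_euler_total[THEN linear_neg]

lemma euler_total_apply: "euler_total p a b = real (msize a + msize b) * p a b"
  by (simp add: euler_total_def euler_alpha_apply euler_beta_apply algebra_simps)

lemma sum_gl_unit_diag: "(\<Sum>i\<in>UNIV. gl_unit i i p) = euler_total p"
  by (simp add: euler_total_def gl_unit_eq euler_alpha_def euler_beta_def sum.distrib)

lemma gl_unit_commute_euler_total: "gl_unit i j (euler_total p) = euler_total (gl_unit i j p)"
  by (simp add: euler_total_def gl_linear gl_unit_commute_euler)

lemma capelli_commute_euler:
  "capelli (euler_alpha p) = euler_alpha (capelli p)"
  "capelli (euler_beta p) = euler_beta (capelli p)"
  by (simp_all add: capelli_polar_up_down polar_euler gl_linear euler_commute)

lemma capelli_commute_euler_total: "capelli (euler_total p) = euler_total (capelli p)"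
  by (simp add: euler_total_def gl_linear capelli_commute_euler)

text \<open>
  The quadratic Casimir element of gl(n) acts as a polynomial in the Euler and Capelli
  operators, a manifestation of the duality between gl(n) and gl(2).
\<close>

lemma sum_gl_unit_gl_unit:
  fixes p :: "'n::{finite,linorder} bipoly"
  shows "(\<Sum>i\<in>UNIV. \<Sum>j\<in>UNIV. gl_unit i j (gl_unit j i p)) =
    euler_total (euler_total p) + (real CARD('n) - 1) *\<^sub>R euler_total p - 2 *\<^sub>R capelli p"
proof -
  have swap: "(\<Sum>i\<in>UNIV. \<Sum>j\<in>UNIV. mult_alpha j (mult_beta i (D_alpha i (D_beta j p)))) =
      (\<Sum>i\<in>UNIV. \<Sum>j\<in>UNIV. mult_alpha i (mult_beta j (D_alpha j (D_beta i p))))"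
    "(\<Sum>i\<in>UNIV. \<Sum>j\<in>UNIV. mult_alpha j (mult_beta i (D_alpha j (D_beta i p)))) =
      (\<Sum>i\<in>UNIV. \<Sum>j\<in>UNIV. mult_alpha i (mult_beta j (D_alpha i (D_beta j p))))"
    by (rule sum.swap)+
  show ?thesis
    by (simp add: euler_total_def gl_unit_eq euler_alpha_def euler_beta_def capelli_def weyl_linear
        weyl_relations weyl_sum bipoly_mult swap)
qed

text \<open>
  The operator \<open>N\<^sub>j\<close> by which the Lie derivatives of a bidifferential operator and of its
  polynomial form differ for the field \<open>x\<^sup>j \<Sum> x\<^sup>i \<partial>\<^sub>i\<close>. Its second order part arises when two
  derivatives hit the quadratic coefficients \<open>x\<^sup>j x\<^sup>i\<close>, its first order part when one
  derivative hits the divergence \<open>(n + 1) x\<^sup>j\<close>.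
\<close>

definition corr :: "real \<Rightarrow> real \<Rightarrow> 'n \<Rightarrow> 'n::{finite,linorder} bipoly
    \<Rightarrow> 'n bipoly" where
  "corr w1 w2 j p =
     - (euler_alpha (D_alpha j p) + ((real CARD('n) + 1) * w1) *\<^sub>R D_alpha j p)
     - (euler_beta (D_beta j p) + ((real CARD('n) + 1) * w2) *\<^sub>R D_beta j p)"

lemma linear_corr: "linear (corr w1 w2 j)"
  by (auto intro!: linearI simp: corr_def gl_linear weyl_linear algebra_simps)

lemmas corr_linear =
  linear_corr[THEN linear_add] linear_corr[THEN linear_diff]
  linear_corr[THEN linear_0] linear_corr[THEN linear_scale]
  linear_corr[THEN linear_sum] linear_corr[THEN linear_neg]

lemma D_gl_unit:
  "D_alpha k (gl_unit i j p) = gl_unit i j (D_alpha k p) + of_bool (i = k) *\<^sub>R D_alpha j p"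
  "D_beta k (gl_unit i j p) = gl_unit i j (D_beta k p) + of_bool (i = k) *\<^sub>R D_beta j p"
  by (simp_all add: gl_unit_eq weyl_linear weyl_relations algebra_simps)

text \<open>
  The family \<open>N\<^sub>j\<close> transforms under gl(n) like the family of derivatives \<open>D\<^bsub>\<alpha>\<^sub>j\<^esub>\<close>; with
  \<open>corr_commute\<close> this reflects that the quadratic fields form an abelian ideal in the
  isotropy subalgebra.
\<close>

lemma corr_gl_unit:
  "corr w1 w2 k (gl_unit i j p) = gl_unit i j (corr w1 w2 k p) + of_bool (i = k) *\<^sub>R corr w1 w2 j p"
  by (simp add: corr_def D_gl_unit gl_linear gl_unit_commute_euler algebra_simps)

lemma corr_commute: "corr w1 w2 i (corr w1 w2 j p) = corr w1 w2 j (corr w1 w2 i p)"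
proof -
  have *: "D_alpha j (D_alpha i p) = D_alpha i (D_alpha j p)"
    "D_beta j (D_beta i p) = D_beta i (D_beta j p)" for p :: "'a bipoly"
    by (simp_all add: D_alpha_commute D_beta_commute)
  show ?thesis
    by (simp add: corr_def weyl_linear gl_linear euler_commute_weyl D_beta_D_alpha euler_commute *
       algebra_simps)
qed

lemma euler_total_corr: "corr w1 w2 j (euler_total p) = euler_total (corr w1 w2 j p) + corr w1 w2 j p"
  by (simp add: corr_def weyl_linear gl_linear euler_total_def euler_commute_weyl euler_commute
      algebra_simps)

lemma sum_D_gl_unit:
  fixes p :: "'n::{finite,linorder} bipoly"
  shows "(\<Sum>k\<in>UNIV. D_alpha k (gl_unit k j p)) =
    D_alpha j (euler_total p) + (real CARD('n) - 1) *\<^sub>R D_alpha j p + polar_down (D_beta j p)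
        - euler_beta (D_alpha j p)"
   "(\<Sum>k\<in>UNIV. D_beta k (gl_unit k j p)) =
    D_beta j (euler_total p) + (real CARD('n) - 1) *\<^sub>R D_beta j p + polar_up (D_alpha j p)
        - euler_alpha (D_beta j p)"
  by (simp_all add: euler_total_def gl_unit_eq euler_alpha_def euler_beta_def polar_up_def
      polar_down_def weyl_linear
      weyl_relations weyl_sum bipoly_mult)

lemma capelli_corr:
  fixes p :: "'n::{finite,linorder} bipoly"
  shows "capelli (corr w1 w2 j p) = corr w1 w2 j (capelli p)
    + (\<Sum>k\<in>UNIV. corr w1 w2 k (gl_unit k j p)) - corr w1 w2 j (euler_total p)
    - (real CARD('n) - 1) *\<^sub>R corr w1 w2 j p"
proof -
  have "(\<Sum>k\<in>UNIV. corr w1 w2 k (gl_unit k j p)) =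
     - (euler_alpha (\<Sum>k\<in>UNIV. D_alpha k (gl_unit k j p))
         + ((real CARD('n) + 1) * w1) *\<^sub>R (\<Sum>k\<in>UNIV. D_alpha k (gl_unit k j p)))
     - (euler_beta (\<Sum>k\<in>UNIV. D_beta k (gl_unit k j p))
         + ((real CARD('n) + 1) * w2) *\<^sub>R (\<Sum>k\<in>UNIV. D_beta k (gl_unit k j p)))"
    by (simp only: corr_def sum.distrib sum_subtractf sum_negf gl_linear scaleR_sum_right)
  then show ?thesis unfolding sum_D_gl_unit
    by (simp add: corr_def gl_linear weyl_linear capelli_D_alpha capelli_D_beta capelli_commute_euler
       euler_total_def euler_commute_weyl euler_commute algebra_simps)
qed

text \<open>
  The part of the Casimir operator that does not differentiate the coefficients of a symbol;
  see \<open>casimir_op_bidiff\<close>.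
\<close>

definition casimir_symbol :: "real \<Rightarrow> 'n::{finite,linorder} bipoly \<Rightarrow> 'n bipoly" where
  "casimir_symbol \<delta> p = (let n = real CARD('n) in
     (n * (n + 1) * \<delta> * (\<delta> - 1)) *\<^sub>R p
         - (2 * ((n + 1) * \<delta> - n)) *\<^sub>R euler_total p
     + 2 *\<^sub>R euler_total (euler_total p) - 2 *\<^sub>R capelli p)"

lemma linear_casimir_symbol: "linear (casimir_symbol \<delta>)"
  by (auto intro!: linearI simp: casimir_symbol_def Let_def euler_total_linear gl_linear algebra_simps)

lemma gl_unit_commute_casimir:
  "gl_unit i j (casimir_symbol \<delta> p) = casimir_symbol \<delta> (gl_unit i j p)"
  by (simp add: casimir_symbol_def Let_def gl_linear gl_unit_commute_euler_total gl_unit_commute_capelli)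

text \<open>
  The infinitesimal condition at the origin for the Casimir operator to commute with the Lie
  derivatives along quadratic fields: the last three terms cancel those that \<open>- 2 \<Sum> N\<^sub>k \<partial>\<^sub>k\<close>
  produces when \<open>\<partial>\<^sub>k\<close> falls on the coefficients of the Lie derivative of symbols along such a
  field.
\<close>

lemma casimir_symbol_corr:
  fixes p :: "'n::{finite,linorder} bipoly"
  shows "casimir_symbol \<delta> (corr w1 w2 j p) = corr w1 w2 j (casimir_symbol \<delta> p)
    - 2 *\<^sub>R (\<Sum>k\<in>UNIV. corr w1 w2 k (gl_unit k j p))
        - 2 *\<^sub>R corr w1 w2 j (euler_total p)
    + (2 * \<delta> * (real CARD('n) + 1)) *\<^sub>R corr w1 w2 j p"
proof -
  have E: "euler_total (corr w1 w2 j p) = corr w1 w2 j (euler_total p) - corr w1 w2 j p" for p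
    by (simp add: euler_total_corr)
  show ?thesis
    unfolding casimir_symbol_def Let_def E capelli_corr corr_linear
      euler_total_linear
    by (simp add: algebra_simps scaleR_2)
qed

lemma casimir_symbol_eigen:
  assumes "euler_total p = real i *\<^sub>R p" "capelli p = (real q * (real i + 1 - real q)) *\<^sub>R p"
  shows "casimir_symbol \<delta> (p :: 'n::{finite,linorder} bipoly)
      = gamma_ip CARD('n) \<delta> i q *\<^sub>R p"
  by (simp add: casimir_symbol_def Let_def assms euler_total_linear gamma_ip_def
     algebra_simps power2_eq_square)

text \<open>
  The span of \<open>D\<^bsub>\<alpha>\<^sub>j\<^esub> p\<close> and \<open>(\<beta> \<cdot> D\<^sub>\<alpha>) D\<^bsub>\<beta>\<^sub>j\<^esub> p\<close> is invariant under the Capelli operator, which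
  acts on it by a 2 by 2 matrix with eigenvalues \<open>c1\<close>, \<open>c2\<close>; the conclusion is the theorem
  of Cayley and Hamilton. The numbers \<open>c1\<close> and \<open>c2\<close> are the eigenvalues of the Capelli
  operator in degree \<open>k + l - 1\<close> that belong to the lower lines \<open>q\<close> and \<open>q - 1\<close>.
\<close>

lemma capelli_D_alpha_quadratic:
  fixes k l q :: real
  assumes a: "euler_alpha p = k *\<^sub>R p" and b: "euler_beta p = l *\<^sub>R p"
    and c: "capelli p = (q * (k + l + 1 - q)) *\<^sub>R p"
  defines "c1 \<equiv> q * (k + l - q)" and "c2 \<equiv> (q - 1) * (k + l + 1 - q)"
  shows "capelli (capelli (D_alpha j p)) = (c1 + c2) *\<^sub>R capelli (D_alpha j p)
      - (c1 * c2) *\<^sub>R D_alpha j p"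
proof -
  define \<kappa> where "\<kappa> = q * (k + l + 1 - q)"
  define v1 where "v1 = D_alpha j p"
  define v2 where "v2 = polar_down (D_beta j p)"
  have ea: "euler_alpha (D_beta j p) = k *\<^sub>R D_beta j p" "euler_beta v1 = l *\<^sub>R v1"
    "euler_alpha v1 = (k - 1) *\<^sub>R v1"
    using euler_commute_weyl[of j p] by (simp_all add: a b weyl_linear v1_def algebra_simps)
  have K1: "capelli v1 = (\<kappa> - l) *\<^sub>R v1 + v2"
    using capelli_D_alpha[of j p] ea c by (simp add: v1_def v2_def weyl_linear \<kappa>_def algebra_simps)
  have DU: "polar_down (polar_up v1) = (k * l + l - \<kappa>) *\<^sub>R v1 - v2"
    using capelli_polar_down_up[of v1] K1 by (simp add: ea gl_linear algebra_simps)

  have K2: "capelli v2 = (\<kappa> - k - 1) *\<^sub>R v2 + (k * l + l - \<kappa>) *\<^sub>R v1"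
    using polar_down_capelli[of "D_beta j p"] DU
    by (simp add: capelli_D_beta c weyl_linear gl_linear ea flip: v1_def v2_def \<kappa>_def)
       (simp add: algebra_simps)
  show "capelli (capelli (D_alpha j p)) = (c1 + c2) *\<^sub>R capelli (D_alpha j p)
      - (c1 * c2) *\<^sub>R D_alpha j p"
    unfolding v1_def[symmetric] K1 gl_linear K2
    by (simp add: fun_eq_iff \<kappa>_def c1_def c2_def algebra_simps)
qed

lemma capelli_D_beta_quadratic:
  fixes k l q :: real
  assumes "euler_alpha p = k *\<^sub>R p" "euler_beta p = l *\<^sub>R p"
    and "capelli p = (q * (k + l + 1 - q)) *\<^sub>R p"
  defines "c1 \<equiv> q * (k + l - q)" and "c2 \<equiv> (q - 1) * (k + l + 1 - q)"
  shows "capelli (capelli (D_beta j p)) = (c1 + c2) *\<^sub>R capelli (D_beta j p)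
      - (c1 * c2) *\<^sub>R D_beta j p"
proof -
  have "euler_alpha (swap_args p) = l *\<^sub>R swap_args p" "euler_beta (swap_args p)
      = k *\<^sub>R swap_args p"
    "capelli (swap_args p) = (q * (l + k + 1 - q)) *\<^sub>R swap_args p"
    using assms(1-3)
    by (simp_all add: swap_args_euler_polar[symmetric] capelli_swap_args swap_args_linear add.commute)
  from capelli_D_alpha_quadratic[OF this, of j]
  show ?thesis unfolding swap_args_weyl(4) capelli_swap_args c1_def c2_def
    by (simp add: swap_args_linear add.commute)
qed

text \<open>
  Multiplication by the minor \<open>\<alpha>\<^sub>i \<beta>\<^sub>j - \<alpha>\<^sub>j \<beta>\<^sub>i\<close>. It commutes with both polarizations, hence
  shifts the Capelli operator by a function of the degree; its powers produce highest weight
  vectors.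
\<close>

definition plucker :: "'n \<Rightarrow> 'n \<Rightarrow> 'n::{finite,linorder} bipoly \<Rightarrow> 'n
    bipoly" where
  "plucker i j p = mult_alpha i (mult_beta j p) - mult_alpha j (mult_beta i p)"

lemma polar_plucker:
  "polar_up (plucker i j p) = plucker i j (polar_up p)"
  "polar_down (plucker i j p) = plucker i j (polar_down p)"
  by (simp_all add: plucker_def polar_up_def polar_down_def weyl_linear weyl_relations weyl_sum)

lemma euler_plucker:
  "euler_alpha (plucker i j p) = plucker i j (euler_alpha p) + plucker i j p"
  "euler_beta (plucker i j p) = plucker i j (euler_beta p) + plucker i j p"
  by (simp_all add: plucker_def euler_alpha_def euler_beta_def weyl_linear weyl_relations weyl_sum)

lemma linear_plucker: "linear (plucker i j)"
  by (auto intro!: linearI simp: plucker_def weyl_linear algebra_simps)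

lemma capelli_plucker:
  "capelli (plucker i j p) = plucker i j (capelli p + euler_total p + 2 *\<^sub>R p)"
  unfolding capelli_polar_up_down euler_total_def
  by (simp add: polar_plucker euler_plucker gl_linear linear_add[OF linear_plucker]
      linear_diff[OF linear_plucker] linear_scale[OF linear_plucker] bipoly_mult algebra_simps)

section \<open>The irreducible modules as eigenspaces of the Capelli operator\<close>

lemma sum_mindex_upd:
  fixes r :: "'n::finite \<Rightarrow> nat"
  shows "(\<Sum>i\<in>UNIV. r i * (a(j := m)) i) + r j * a j = (\<Sum>i\<in>UNIV. r i * a i) + r j * m"
  by (simp add: sum.remove[of UNIV j])

lemma msize_upd: "msize (a(j := m)) + a j = msize a + m"
  using sum_mindex_upd[of "\<lambda>_. 1" a j m] by (simp add: msize_def)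

lemma finite_msize_eq: "finite {a :: 'n::{finite,linorder} mindex. msize a = k}"
proof (rule finite_subset)
  show "{a :: 'n mindex. msize a = k} \<subseteq> PiE UNIV (\<lambda>_. {..k})"
    by (auto simp: msize_def intro: member_le_sum)
  show "finite (PiE (UNIV :: 'n set) (\<lambda>_. {..k}))"
    by (intro finite_PiE) auto
qed

lemma bihomogeneous_iff:
  "p \<in> bihomogeneous k l \<longleftrightarrow> euler_alpha p = real k *\<^sub>R p
      \<and> euler_beta p = real l *\<^sub>R p"
  by (auto simp: bihomogeneous_def fun_eq_iff euler_alpha_apply euler_beta_apply)

lemma bihomogeneous_zero: "p \<in> bihomogeneous k l
    \<Longrightarrow> msize a \<noteq> k \<or> msize b \<noteq> l \<Longrightarrow> p a b = 0"
  by (auto simp: bihomogeneous_def)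

lemma gl_submodule_iff:
  "gl_submodule W \<longleftrightarrow> subspace W
      \<and> (\<forall>i j. \<forall>p\<in>W. gl_unit i j p \<in> W)"
proof -
  have act: "gl_act A p = (\<Sum>i\<in>UNIV. \<Sum>j\<in>UNIV. (A $ i $ j) *\<^sub>R gl_unit i j p)"
      for A and p :: "'a bipoly"
    by (simp add: gl_act_def fun_eq_iff)
  have fw: "gl_unit i j p \<in> W" if "\<forall>A. \<forall>p\<in>W. gl_act A p \<in> W" "p
      \<in> W" for i j p
  proof -
    have "gl_act (\<chi> i'. \<chi> j'. of_bool (i' = i) * of_bool (j' = j)) p = gl_unit i j p"
      unfolding act by (simp flip: scaleR_scaleR scaleR_sum_right)
    then show ?thesis using that by metis
  qed
  have bw: "gl_act A p \<in> W" if "subspace W" "\<forall>i j. \<forall>p\<in>W. gl_unit i j p \<in> W"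
      "p \<in> W" for A p
    unfolding act using that by (intro subspace_sum subspace_scale) auto
  have sp: "subspace W \<longleftrightarrow> (\<lambda>a b. 0) \<in> W \<and>
     (\<forall>p\<in>W. \<forall>q\<in>W. (\<lambda>a b. p a b + q a b) \<in> W)
         \<and> (\<forall>c. \<forall>p\<in>W. (\<lambda>a b. c * p a b) \<in> W)"
    unfolding subspace_def zero_fun_def plus_fun_def scaleR_fun_def real_scaleR_def by auto
  show ?thesis unfolding gl_submodule_def sp[symmetric] using fw bw sp by blast
qed

text \<open>
  The eigenvalue \<open>q (k + l + 1 - q)\<close> is the value of the Capelli operator on
  \<open>\<alpha>\<^sub>1\<^bsup>k-q\<^esup> \<beta>\<^sub>1\<^bsup>l-q\<^esup> (\<alpha>\<^sub>1 \<beta>\<^sub>2 - \<alpha>\<^sub>2 \<beta>\<^sub>1)\<^sup>q\<close>, a highest weight vector for the diagram \<open>(k + l - q, q)\<close>.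
\<close>

definition isotypic :: "nat \<Rightarrow> nat \<Rightarrow> nat \<Rightarrow> 'n::{finite,linorder}
    bipoly set" where
  "isotypic k l q = {p \<in> bihomogeneous k l. capelli p
      = (real q * (real (k + l) + 1 - real q)) *\<^sub>R p}"

lemma gl_submodule_isotypic: "gl_submodule (isotypic k l q)"
  unfolding gl_submodule_iff
proof safe
  show "subspace (isotypic k l q)"
    by (auto simp: subspace_def isotypic_def bihomogeneous_iff gl_linear scaleR_add_right)
  show "gl_unit i j p \<in> isotypic k l q" if "p \<in> isotypic k l q" for i j p
    using that by (auto simp: isotypic_def bihomogeneous_iff gl_linear
       simp flip: gl_unit_commute_euler gl_unit_commute_capelli)
qed

lemma gl_unit_apply:
  "i \<noteq> j \<Longrightarrow> gl_unit i j p a b =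
    (if a i = 0 then 0 else real (a j + 1) * p (a(i := a i - 1, j := a j + 1)) b) +
    (if b i = 0 then 0 else real (b j + 1) * p a (b(i := b i - 1, j := b j + 1)))"
  by (auto simp: gl_unit_def mult_alpha_def mult_beta_def D_alpha_def D_beta_def)

definition raising_null :: "'n::{finite,linorder} bipoly \<Rightarrow> bool" where
  "raising_null p \<longleftrightarrow> (\<forall>i j. i < j \<longrightarrow> gl_unit i j p = 0)"

text \<open>
  Give the variables with index \<open>i\<close> a height that increases with \<open>i\<close>. Raising operators
  replace a variable by one of smaller index and so strictly lower the largest height of a
  monomial; a nonzero element for which that largest height is as small as possible is
  annihilated by all of them.
\<close>

lemma raising_null_exists:
  fixes A :: "'n::{finite,linorder} bipoly set"
  assumes sub: "gl_submodule A" and hom: "A \<subseteq> bihomogeneous k l" and ne: "A \<noteq> {0}"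
  obtains p where "p \<in> A" "p \<noteq> 0" "raising_null p"
proof -
  define rank where "rank i = card {..<i}" for i :: 'n
  define ht where "ht a = (\<Sum>i\<in>UNIV. rank i * a i)" for a
  define bounded where "bounded M p \<longleftrightarrow>
      (\<forall>a b. p a b \<noteq> 0 \<longrightarrow> ht a + ht b \<le> M)" for M and p :: "'n bipoly"
  have rank: "rank i < rank j" if "i < j" for i j
    unfolding rank_def using that by (intro psubset_card_mono) auto
  have ht_shift: "ht a < ht (a(i := a i - 1, j := a j + 1))" if "i < j" "a i \<noteq> 0" for a i j
  proof -
    have upd: "(a(i := a i - 1)) j = a j" using that by auto
    have *: "ht (a(i := a i - 1)) + rank i * a i = ht a + rank i * (a i - 1)"
      "ht (a(i := a i - 1, j := a j + 1)) + rank j * a j = ht (a(i := a i - 1)) + rank j * (a j + 1)"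
      using sum_mindex_upd[of rank a i "a i - 1"] sum_mindex_upd[of rank "a(i := a i - 1)" j "a j + 1"]
      unfolding ht_def upd by (simp_all only:)
    obtain m where "a i = Suc m" using \<open>a i \<noteq> 0\<close> not0_implies_Suc by blast
    then show ?thesis using * rank[OF that(1)] by (simp add: algebra_simps)
  qed
  from sub have "0 \<in> A" by (simp add: gl_submodule_iff subspace_def)
  with ne obtain p0 where p0: "p0 \<in> A" "p0 \<noteq> 0" by auto
  have "bounded (Max ((\<lambda>(a, b). ht a + ht b) ` ({a. msize a = k} \<times> {b. msize b = l}))) p0"
    unfolding bounded_def using p0 hom bihomogeneous_zero[of p0 k l]
    by (intro allI impI Max_ge finite_imageI finite_cartesian_product finite_msize_eq image_eqI) auto
  then have ex: "\<exists>M. \<exists>p\<in>A. p \<noteq> 0 \<and> bounded M p" using p0 by blast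
  define M where "M = (LEAST M. \<exists>p\<in>A. p \<noteq> 0 \<and> bounded M p)"
  \<comment> \<open>a nonzero element of least possible height\<close>
  obtain p where p: "p \<in> A" "p \<noteq> 0" "bounded M p"
    using LeastI_ex[OF ex] unfolding M_def by blast
  have "raising_null p" unfolding raising_null_def
  proof (intro allI impI, rule ccontr)
    fix i j :: 'n assume ij: "i < j" and nz: "gl_unit i j p \<noteq> 0"
    have less: "ht a + ht b < M" if "gl_unit i j p a b \<noteq> 0" for a b
    proof -
      consider "a i \<noteq> 0" "p (a(i := a i - 1, j := a j + 1)) b \<noteq> 0"
        | "b i \<noteq> 0" "p a (b(i := b i - 1, j := b j + 1)) \<noteq> 0"
        using \<open>gl_unit i j p a b \<noteq> 0\<close> ij
        by (cases "a i = 0"; cases "b i = 0"; cases "p (a(i := a i - 1, j := a j + 1)) b = 0")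
          (auto simp: gl_unit_apply)
      then show ?thesis
      proof cases
        case 1
        with p(3) have "ht (a(i := a i - 1, j := a j + 1)) + ht b \<le> M" by (simp add: bounded_def)
        with ht_shift[OF ij, of a, OF 1(1)] show ?thesis by simp
      next
        case 2
        with p(3) have "ht a + ht (b(i := b i - 1, j := b j + 1)) \<le> M" by (simp add: bounded_def)
        with ht_shift[OF ij, of b, OF 2(1)] show ?thesis by simp
      qed
    qed
    then have "bounded (M - 1) (gl_unit i j p)" by (fastforce simp: bounded_def)
    moreover have "gl_unit i j p \<in> A" using sub p by (simp add: gl_submodule_iff)
    ultimately have "M \<le> M - 1" unfolding M_def using nz by (intro Least_le) blast
    moreover from nz obtain a b where "gl_unit i j p a b \<noteq> 0" by (auto simp: fun_eq_iff)
    ultimately show False using less by force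
  qed
  then show ?thesis using that p by blast
qed

definition mfact :: "'n::{finite,linorder} mindex \<Rightarrow> real" where
  "mfact a = (\<Prod>i\<in>UNIV. fact (a i))"

lemma mfact_pos: "mfact a > 0"
  by (simp add: mfact_def prod_pos)

lemma mfact_upd: "mfact (a(i := m)) * fact (a i) = mfact a * fact m"
  by (simp add: mfact_def prod.remove[of UNIV i] mult_ac)

text \<open>
  On monomials, moving a unit of exponent from \<open>j\<close> to \<open>i\<close> and moving it back have matrix
  entries that differ exactly by a ratio of factorials.
\<close>

lemma mindex_shift_adjoint:
  fixes F G :: "'n::{finite,linorder} mindex \<Rightarrow> real"
  assumes ij: "i \<noteq> j"
  shows "(\<Sum>a | msize a = k. mfact a * ((if a i
      = 0 then 0 else real (a j + 1) * F (a(i := a i - 1, j := a j + 1))) * G a)) =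
    (\<Sum>a | msize a = k. mfact a * (F a * (if a j
        = 0 then 0 else real (a i + 1) * G (a(j := a j - 1, i := a i + 1)))))"
    (is "?L = ?R")
proof -
  have sz: "msize (a(i := a i - 1, j := a j + 1)) = msize a" if "a i \<noteq> 0" "i \<noteq> j" for i j
      and a :: "'n mindex"
    using msize_upd[of a i "a i - 1"] msize_upd[of "a(i := a i - 1)" j "a j + 1"] that by simp
  have fac: "mfact a * real (a j + 1) = mfact (a(i := a i - 1, j := a j + 1)) * real (a i)"
    if a: "a i \<noteq> 0" for a
  proof -
    obtain m where m: "a i = Suc m" using a not0_implies_Suc by blast
    have "mfact (a(i := m)) * fact (Suc m) = mfact a * fact m"
      using mfact_upd[of a i m] m by simp
    then have "fact m * (mfact (a(i := m)) * real (Suc m)) = fact m * mfact a"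
      by (simp add: algebra_simps)
    then have 1: "mfact a = mfact (a(i := m)) * real (Suc m)"
      using fact_nonzero[of m, where 'a = real] by (metis mult_cancel_left)
    have "mfact (a(i := m, j := a j + 1)) * fact (a j) = mfact (a(i := m)) * fact (a j + 1)"
      using mfact_upd[of "a(i := m)" j "a j + 1"] ij by simp
    then have "fact (a j) * mfact (a(i := m, j := a j + 1))
        = fact (a j) * (mfact (a(i := m)) * real (a j + 1))"
      by (simp add: algebra_simps)
    then have 2: "mfact (a(i := m, j := a j + 1)) = mfact (a(i := m)) * real (a j + 1)"
      using fact_nonzero[of "a j", where 'a = real] by (metis mult_cancel_left)
    show ?thesis using 1 2 m by simp
  qed
  have "?L = (\<Sum>a | msize a = k \<and> a i \<noteq> 0. mfact
      a * ((real (a j + 1) * F (a(i := a i - 1, j := a j + 1))) * G a))"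
    by (intro sum.mono_neutral_cong_right finite_msize_eq) auto
  also have "\<dots> = (\<Sum>a | msize a = k \<and> a j \<noteq> 0. mfact
      a * (F a * (real (a i + 1) * G (a(j := a j - 1, i := a i + 1)))))"
  proof (rule sum.reindex_bij_witness[where j = "\<lambda>a. a(i := a i - 1, j := a j + 1)" and i =
      "\<lambda>a. a(j := a j - 1, i := a i + 1)"])
    fix a assume "a \<in> {a. msize a = k \<and> a i \<noteq> 0}"
    then have a: "msize a = k" "a i \<noteq> 0" by auto
    show "(a(i := a i - 1, j := a j + 1))(j := (a(i := a i - 1, j := a j + 1)) j
        - 1, i := (a(i := a i - 1, j := a j + 1)) i + 1) = a"
      using a ij by (auto simp: fun_eq_iff)
    then show "mfact (a(i := a i - 1, j := a j + 1)) * (F (a(i := a i - 1, j := a j + 1)) *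
        (real ((a(i := a i - 1, j := a j + 1)) i + 1) * G ((a(i := a i - 1, j := a j + 1))
         (j := (a(i := a i - 1, j := a j + 1)) j - 1, i := (a(i := a i - 1, j := a j + 1)) i + 1)))) =
        mfact a * (real (a j + 1) * F (a(i := a i - 1, j := a j + 1)) * G a)"
      using fac[of a, OF a(2)] a ij by (simp del: fun_upd_apply add: fun_upd_other fun_upd_same mult_ac)
    show "a(i := a i - 1, j := a j + 1) \<in> {a. msize a = k \<and> a j \<noteq> 0}"
      using sz[of a i j, OF a(2) ij] a by simp
  next
    fix a assume "a \<in> {a. msize a = k \<and> a j \<noteq> 0}"
    then have a: "msize a = k" "a j \<noteq> 0" by auto
    show "(a(j := a j - 1, i := a i + 1))(i := (a(j := a j - 1, i := a i + 1)) i
        - 1, j := (a(j := a j - 1, i := a i + 1)) j + 1) = a"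
      using a ij by (auto simp: fun_eq_iff)
    show "a(j := a j - 1, i := a i + 1) \<in> {a. msize a = k \<and> a i \<noteq> 0}"
      using sz[of a j i, OF a(2) ij[symmetric]] a by simp
  qed
  also have "\<dots> = ?R"
    by (intro sum.mono_neutral_cong_left finite_msize_eq) auto
  finally show ?thesis .
qed

text \<open>
  The inner product on bidegree \<open>(k, l)\<close> for which the monomials are orthogonal and \<open>\<alpha>\<^sup>a \<beta>\<^sup>b\<close>
  has squared norm \<open>a! b!\<close>; these weights make multiplication by a variable adjoint to the
  derivative, so that the orthogonal complement of a gl(n)-submodule is a submodule.
\<close>

definition fischer :: "nat \<Rightarrow> nat \<Rightarrow> 'n::{finite,linorder} bipoly \<Rightarrow>
    'n bipoly \<Rightarrow> real" where
  "fischer k l p q = (\<Sum>a | msize a = k. \<Sum>b | msize b = l. mfact a * (mfact b * (p a b * q a b)))"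

lemma fischer_swap: "fischer k l p q = (\<Sum>b | msize b = l. \<Sum>a | msize a
    = k. mfact a * (mfact b * (p a b * q a b)))"
  unfolding fischer_def by (rule sum.swap)

lemma fischer_commute: "fischer k l p q = fischer k l q p"
  by (simp add: fischer_def mult.commute)

lemma fischer_linear:
  "fischer k l (p + p') q = fischer k l p q + fischer k l p' q"
  "fischer k l (p - p') q = fischer k l p q - fischer k l p' q"
  "fischer k l (c *\<^sub>R p) q = c * fischer k l p q"
  "fischer k l 0 q = 0"
  by (simp_all add: fischer_def sum.distrib sum_subtractf sum_distrib_left algebra_simps)

lemma fischer_linear_right:
  "fischer k l q (p - p') = fischer k l q p - fischer k l q p'"
  "fischer k l q (c *\<^sub>R p) = c * fischer k l q p"
  by (simp_all add: fischer_def sum.distrib sum_subtractf sum_distrib_left algebra_simps)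

lemma fischer_gl_unit: "fischer k l (gl_unit i j p) q = fischer k l p (gl_unit j i q)"
proof (cases "i = j")
  case True
  then show ?thesis by (simp add: fischer_def gl_unit_diag_apply mult_ac)
next
  case False
  define A where "A i j p = (\<lambda>a b. if a i
      = 0 then 0 else real (a j + 1) * p (a(i := a i - 1, j := a j + 1)) b)"
    for i j and p :: "'a bipoly"
  define B where "B i j p = (\<lambda>a b. if b i
      = 0 then 0 else real (b j + 1) * p a (b(i := b i - 1, j := b j + 1)))"
    for i j and p :: "'a bipoly"
  have split: "gl_unit i j p = A i j p + B i j p" if "i \<noteq> j" for i j p
    by (intro ext) (simp add: gl_unit_apply[OF that] A_def B_def)
  have A: "fischer k l (A i j p) q = fischer k l p (A j i q)"
    unfolding fischer_swap
  proof (rule sum.cong[OF refl])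
    fix b
    have "(\<Sum>a | msize a = k. mfact b * (mfact a * (A i j p a b * q a b)))
        = (\<Sum>a | msize a = k. mfact b * (mfact a * (p a b * A j i q a b)))"
      unfolding sum_distrib_left[symmetric] A_def
      using mindex_shift_adjoint[OF False, of "\<lambda>a. p a b" "\<lambda>a. q a b"] by simp
    then show "(\<Sum>a | msize a = k. mfact a * (mfact b * (A i j p a b * q a b)))
        = (\<Sum>a | msize a = k. mfact a * (mfact b * (p a b * A j i q a b)))"
      by (simp only: mult.left_commute[of "mfact b"])
  qed
  have B: "fischer k l (B i j p) q = fischer k l p (B j i q)"
    unfolding fischer_def
  proof (rule sum.cong[OF refl])
    fix a
    show "(\<Sum>b | msize b = l. mfact a * (mfact b * (B i j p a b * q a b)))
        = (\<Sum>b | msize b = l. mfact a * (mfact b * (p a b * B j i q a b)))"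
      unfolding sum_distrib_left[symmetric] B_def
      using mindex_shift_adjoint[OF False, of "\<lambda>b. p a b" "\<lambda>b. q a b"] by simp
  qed
  show ?thesis
    using False A B
    by (simp add: split fischer_linear fischer_commute[of k l p])
qed

lemma fischer_pos:
  assumes "p \<in> bihomogeneous k l" "p \<noteq> 0"
  shows "fischer k l p p > 0"
proof -
  obtain a b where ab: "p a b \<noteq> 0" using assms by (auto simp: fun_eq_iff)
  then have sz: "msize a = k" "msize b = l" using assms by (auto simp: bihomogeneous_def)
  have nn: "0 \<le> mfact a * (mfact b * (p a b * p a b))" for a b
    using mfact_pos[of a] mfact_pos[of b] by simp
  have "0 < (\<Sum>b | msize b = l. mfact a * (mfact b * (p a b * p a b)))"
    using nn ab sz mfact_pos[of a] mfact_pos[of b] not_square_less_zero[of "p a b"]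
    by (intro sum_pos2[of _ b] finite_msize_eq) (auto simp: less_le)
  then show ?thesis unfolding fischer_def
    by (rule sum_pos2[of _ a, rotated 2]) (use nn sz finite_msize_eq in \<open>auto intro!: sum_nonneg\<close>)
qed

text \<open>
  Gram-Schmidt orthogonalization in the form of an induction on the support: requiring one
  coefficient to vanish defines a subspace of codimension at most one, to which the
  induction hypothesis applies.
\<close>

lemma fischer_projection:
  fixes A :: "'n::{finite,linorder} bipoly set"
  assumes "finite I" "subspace A" "A \<subseteq> bihomogeneous k l" "\<And>p a b. p \<in> A
      \<Longrightarrow> (a, b) \<notin> I \<Longrightarrow> p a b = 0"
  shows "\<exists>u\<in>A. \<forall>a\<in>A. fischer k l (v - u) a = 0"
  using assms
proof (induction I arbitrary: A v rule: finite_induct)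
  case empty
  then have "A = {0}" by (auto simp: fun_eq_iff subspace_0)
  then show ?case by (simp add: fischer_def)
next
  case (insert i I)
  obtain a0 b0 where i: "i = (a0, b0)" by (cases i)
  define A0 where "A0 = {p \<in> A. p a0 b0 = 0}"
  have sub0: "subspace A0" using insert.prems(1) by (auto simp: A0_def subspace_def)
  have supp0: "p a b = 0" if "p \<in> A0" "(a, b) \<notin> I" for p a b
    using insert.prems(3)[of p a b] that by (cases "(a, b) = i") (auto simp: A0_def i)
  have proj0: "\<exists>u\<in>A0. \<forall>a\<in>A0. fischer k l (v - u) a = 0" for v
    using insert.prems(2) by (intro insert.IH sub0 supp0) (auto simp: A0_def)
  show ?case
  proof (cases "A0 = A")
    case True
    show ?thesis using proj0[of v] unfolding True .
  next
    case False
    then obtain u where u: "u \<in> A" "u a0 b0 \<noteq> 0" by (auto simp: A0_def)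
    obtain u0 where u0: "u0 \<in> A0" "\<forall>a\<in>A0. fischer k l (u - u0) a = 0" using proj0 by blast
    \<comment> \<open>\<open>u'\<close> spans the orthogonal complement of \<open>A0\<close> in \<open>A\<close>\<close>
    define u' where "u' = u - u0"
    have u': "u' \<in> A" "u' a0 b0 \<noteq> 0" "\<forall>a\<in>A0. fischer k l u' a = 0"
      using u u0 insert.prems(1) by (auto simp: u'_def A0_def subspace_diff)
    then have "u' \<noteq> 0" by auto
    then have pos: "fischer k l u' u' > 0" using u' insert.prems by (intro fischer_pos) auto
    obtain v0 where v0: "v0 \<in> A0" "\<forall>a\<in>A0. fischer k l (v - v0) a = 0" using proj0 by blast
    define c where "c = fischer k l v u' / fischer k l u' u'"
    have v0u: "fischer k l v0 u' = 0" using u'(3) v0(1) fischer_commute[of k l v0 u'] by simp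
    show ?thesis
    proof (intro bexI ballI)
      show "v0 + c *\<^sub>R u' \<in> A"
        using v0 u' insert.prems(1) by (auto simp: A0_def subspace_add subspace_scale)
      fix a assume a: "a \<in> A"
      define d where "d = a a0 b0 / u' a0 b0"
      have dA: "a - d *\<^sub>R u' \<in> A0"
        using a u' insert.prems(1) by (auto simp: A0_def subspace_diff subspace_scale d_def)
      have "fischer k l (v - (v0 + c *\<^sub>R u')) (a - d *\<^sub>R u') = 0"
        using v0 u' dA by (simp add: fischer_linear)
      moreover have "fischer k l (v - (v0 + c *\<^sub>R u')) u' = 0"
        using pos v0u by (simp add: fischer_linear c_def)
      ultimately show "fischer k l (v - (v0 + c *\<^sub>R u')) a = 0"
        by (simp add: fischer_linear_right)
    qed
  qed
qed

text \<open>
  The first two coordinates, which carry the weight of a two-line diagram.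
\<close>

definition fst_ix :: "'n::{finite,linorder}" where "fst_ix = Min UNIV"
definition snd_ix :: "'n::{finite,linorder}" where "snd_ix = Min (UNIV - {fst_ix})"

lemma fst_ix_less: "j \<noteq> fst_ix \<Longrightarrow> fst_ix < j"
  using Min_le[OF finite UNIV_I, of j] unfolding fst_ix_def by (simp add: order_less_le)

context
  assumes card2: "CARD('n::{finite,linorder}) \<ge> 2"
begin

lemma other_ix: "UNIV - {fst_ix :: 'n} \<noteq> {}"
proof
  assume "UNIV - {fst_ix :: 'n} = {}"
  then have "(UNIV :: 'n set) = {fst_ix}" by auto
  then have "CARD('n) = 1" by (metis card_1_singleton_iff One_nat_def)
  with card2 show False by simp
qed

lemma snd_ix_neq: "snd_ix \<noteq> (fst_ix :: 'n)"
  using Min_in[OF _ other_ix] unfolding snd_ix_def by auto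

lemma snd_ix_less: "j \<noteq> fst_ix \<Longrightarrow> j \<noteq> snd_ix
    \<Longrightarrow> snd_ix < (j :: 'n)"
  using Min_le[of "UNIV - {fst_ix}" j] unfolding snd_ix_def by (simp add: order_less_le)

lemma line_length_two_rows:
  "line_length [r, s] (j :: 'n) = (if j = fst_ix then r else if j = snd_ix then s else 0)"
proof -
  have less: "\<not> i < fst_ix" "i < snd_ix \<longleftrightarrow> i = fst_ix" for i :: 'n
    using fst_ix_less[of i] fst_ix_less[OF snd_ix_neq] snd_ix_less[of i]
    by (cases "i = fst_ix"; cases "i = snd_ix"; force)+
  have 1: "{i. i < fst_ix} = ({} :: 'n set)" and 2: "{i. i < snd_ix} = {fst_ix :: 'n}"
    by (simp_all add: less)
  have 3: "card {i. i < j} \<ge> 2" if "j \<noteq> fst_ix" "j \<noteq> snd_ix"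
  proof -
    have "card {fst_ix, snd_ix :: 'n} \<le> card {i. i < j}"
      using that fst_ix_less snd_ix_less by (intro card_mono) auto
    then show ?thesis using snd_ix_neq by simp
  qed
  show ?thesis using 1 2 3 by (auto simp: line_length_def Let_def)
qed

lemma sum_first_two:
  assumes "\<And>j. j \<noteq> fst_ix \<Longrightarrow> j \<noteq> snd_ix \<Longrightarrow> f j = 0"
  shows "(\<Sum>j\<in>UNIV. f (j :: 'n)) = f fst_ix + (f snd_ix :: 'v::comm_monoid_add)"
proof -
  have "sum f UNIV = sum f {fst_ix, snd_ix}"
    using assms by (intro sum.mono_neutral_right) auto
  then show ?thesis using snd_ix_neq by simp
qed

text \<open>
  The exponents of \<open>\<alpha>\<^sub>1\<^sup>k\<close> and, in the next definition, of \<open>\<beta>\<^sub>1\<^sup>m \<beta>\<^sub>2\<^sup>r\<close>. The monomials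
  \<open>\<alpha>\<^sub>1\<^sup>k \<beta>\<^sub>1\<^bsup>l-r\<^esup> \<beta>\<^sub>2\<^sup>r\<close> suffice to determine a polynomial of bidegree \<open>(k, l)\<close> that the raising
  operators annihilate.
\<close>

definition lead1 :: "nat \<Rightarrow> 'n mindex" where
  "lead1 k = (\<lambda>_. 0)(fst_ix := k)"

definition lead2 :: "nat \<Rightarrow> nat \<Rightarrow> 'n mindex" where
  "lead2 m r = (\<lambda>_. 0)(fst_ix := m, snd_ix := r)"

lemma lead1_apply [simp]: "lead1 k fst_ix = k" "j \<noteq> fst_ix \<Longrightarrow> lead1 k j = 0"
  by (auto simp: lead1_def)

lemma lead2_apply [simp]: "lead2 m r fst_ix = m" "lead2 m r snd_ix = r"
  "j \<noteq> fst_ix \<Longrightarrow> j \<noteq> snd_ix \<Longrightarrow> lead2 m r j = 0"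
  using snd_ix_neq by (auto simp: lead2_def)

lemma lead1_upd: "(lead1 k)(fst_ix := m) = lead1 m"
  by (simp add: lead1_def)

lemma lead2_upd: "(lead2 m r)(fst_ix := m') = lead2 m' r" "(lead2 m r)(snd_ix := r') = lead2 m r'"
  using snd_ix_neq by (simp_all add: lead2_def fun_upd_twist)

lemma lead1_eqI: "msize a = k \<Longrightarrow> (\<And>j. j \<noteq> fst_ix \<Longrightarrow> a j = 0)
    \<Longrightarrow> a = lead1 k"
  by (rule ext) (auto simp: lead1_def msize_def sum_first_two snd_ix_neq)

lemma lead2_eqI: "msize b = l \<Longrightarrow>
    (\<And>j. j \<noteq> fst_ix \<Longrightarrow> j \<noteq> snd_ix \<Longrightarrow> b j = 0)
    \<Longrightarrow>
    b = lead2 (l - b snd_ix) (b snd_ix)"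
  by (rule ext) (auto simp: lead2_def msize_def sum_first_two snd_ix_neq)

text \<open>
  At monomials containing \<open>\<alpha>\<^sub>1\<^sup>k\<close>, the raising operators with target index 2 eliminate the
  variables \<open>\<beta>\<^sub>j\<close> with \<open>j > 2\<close>; the ones with target index 1 then express each other
  coefficient through coefficients at monomials with a higher power of \<open>\<alpha>\<^sub>1\<close>.
\<close>

lemma leading_coeffs_determine:
  fixes p :: "'n bipoly"
  assumes hom: "p \<in> bihomogeneous k l" and null: "raising_null p"
    and lead: "\<And>r. r \<le> l \<Longrightarrow> p (lead1 k) (lead2 (l - r) r) = 0"
  shows "p = 0"
proof -
  have null': "gl_unit i j p a b = 0" if "i < j" for i j a b
    using null that by (simp add: raising_null_def)
  have base: "p (lead1 k) b = 0" if b: "msize b = l" for b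
  proof (cases "\<exists>j. j \<noteq> fst_ix \<and> j \<noteq> snd_ix \<and> b j \<noteq> 0")
    case True
    then obtain j where j: "j \<noteq> fst_ix" "j \<noteq> snd_ix" "b j \<noteq> 0" by blast
    have "gl_unit snd_ix j p (lead1 k) (b(snd_ix := b snd_ix + 1, j := b j - 1)) = 0"
      using null' snd_ix_less j by simp
    moreover have "b(snd_ix := b snd_ix, j := b j) = b" by simp
    ultimately show ?thesis using j snd_ix_neq
      by (simp add: gl_unit_apply fun_upd_twist)
  next
    case False
    then have "b = lead2 (l - b snd_ix) (b snd_ix)" using b by (intro lead2_eqI) auto
    moreover have "b snd_ix \<le> l" using b by (auto simp: msize_def intro: member_le_sum)
    ultimately show ?thesis using lead by metis
  qed
  \<comment> \<open>induction on the number of variables \<open>\<alpha>\<^sub>j\<close> with \<open>j \<noteq> 1\<close>\<close>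
  have "p a b = 0" if "msize a = k" "msize b = l" "k - a fst_ix = m" for a b m
    using that
  proof (induction m arbitrary: a b)
    case 0
    have "a j = 0" if "j \<noteq> fst_ix" for j
    proof -
      have "(\<Sum>i\<in>{fst_ix, j}. a i) \<le> msize a"
        unfolding msize_def by (intro sum_mono2) auto
      then show ?thesis using that 0 by simp
    qed
    then have "a = lead1 k" using 0 by (intro lead1_eqI) auto
    then show ?case using base 0 by simp
  next
    case (Suc m)
    have "\<exists>j. j \<noteq> fst_ix \<and> a j \<noteq> 0"
    proof (rule ccontr)
      assume "\<not> ?thesis"
      then have "a = lead1 k" using Suc.prems by (intro lead1_eqI) auto
      then show False using Suc.prems by simp
    qed
    then obtain j where j: "j \<noteq> fst_ix" "a j \<noteq> 0" by blast
    define a' where "a' = a(fst_ix := a fst_ix + 1, j := a j - 1)"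
    have a': "a' fst_ix = a fst_ix + 1" "a' j = a j - 1" "a'(fst_ix := a fst_ix, j := a j) = a"
      using j by (auto simp: a'_def)
    have sz: "msize a' = k"
      using msize_upd[of a fst_ix "a fst_ix + 1"] msize_upd[of "a(fst_ix := a fst_ix + 1)" j "a j - 1"]
          j Suc.prems
      by (simp add: a'_def)
    have "gl_unit fst_ix j p a' b = 0" using null'[OF fst_ix_less[OF j(1)]] .
    moreover have "p a' (b(fst_ix := b fst_ix - 1, j := b j + 1)) = 0" if "b fst_ix \<noteq> 0"
    proof (rule Suc.IH)
      show "msize (b(fst_ix := b fst_ix - 1, j := b j + 1)) = l"
        using msize_upd[of b fst_ix "b fst_ix - 1"]
            msize_upd[of "b(fst_ix := b fst_ix - 1)" j "b j + 1"] j Suc.prems that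
        by simp
    qed (use sz a' Suc.prems in auto)
    ultimately show ?case using j a' by (simp add: gl_unit_apply split: if_splits)
  qed
  then have "p a b = 0" for a b
    using bihomogeneous_zero[OF hom] by blast
  then show ?thesis by (simp add: fun_eq_iff)
qed

text \<open>
  At a leading monomial the Capelli operator also involves the coefficient of
  \<open>\<alpha>\<^sub>1\<^bsup>k-1\<^esup> \<alpha>\<^sub>2 \<beta>\<^sub>1\<^bsup>l-r+1\<^esup> \<beta>\<^sub>2\<^bsup>r-1\<^esup>\<close>, but the raising operator from 2 to 1 expresses that one through
  the leading coefficient itself. So the Capelli operator is diagonal on leading
  coefficients, and for \<open>q \<le> min k l\<close> the entry at \<open>q\<close> differs from that at each other
  \<open>r \<le> l\<close>.
\<close>

lemma capelli_leading_coeff: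
  fixes p :: "'n bipoly"
  assumes hom: "p \<in> bihomogeneous k l" and null: "raising_null p" and r: "r \<le> l"
  shows "capelli p (lead1 k) (lead2 (l - r) r) =
    (real r * (real (k + l) + 1 - real r)) * p (lead1 k) (lead2 (l - r) r)"
proof -
  define c where "c = p (lead1 k) (lead2 (l - r) r)"
  have e: "gl_unit fst_ix snd_ix p (lead1 k) (lead2 (l - r + 1) (r - 1)) = 0"
    using null fst_ix_less[OF snd_ix_neq] by (simp add: raising_null_def)
  have raise: "(if k = 0 then 0 else p ((lead1 (k - 1))(snd_ix := 1)) (lead2 (l - r + 1) (r - 1))) =
      - real r * c"
    if "r \<noteq> 0"
    using e that snd_ix_neq by (auto simp: gl_unit_apply lead1_upd lead2_upd c_def split: if_splits)
  have sz: "capelli p (lead1 k) (lead2 (l - r) r) = (real k * real l + real k) * c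
      - polar_up (polar_down p) (lead1 k) (lead2 (l - r) r)"
    using hom by (simp add: capelli_polar_up_down bihomogeneous_iff gl_linear c_def algebra_simps)
  have up: "polar_up q (lead1 k) b = (if k = 0 then 0 else real (b fst_ix + 1) * q (lead1 (k - 1))
      (b(fst_ix := b fst_ix + 1)))" for q b
    unfolding polar_up_def sum_fun_apply
    by (subst sum_first_two) (auto simp: mult_alpha_def D_beta_def lead1_upd snd_ix_neq)
  have down: "polar_down p (lead1 (k - 1)) (lead2 m r) =
     (if m = 0 then 0 else real (k - 1 + 1) * p (lead1 (k - 1 + 1)) (lead2 (m - 1) r))
     + (if r = 0 then 0 else p ((lead1 (k - 1))(snd_ix := 1)) (lead2 m (r - 1)))" for m r
    unfolding polar_down_def sum_fun_apply
    by (subst sum_first_two) (auto simp: mult_beta_def D_alpha_def lead1_upd lead2_upd snd_ix_neq)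
  show ?thesis
  proof (cases "k = 0")
    case True
    then show ?thesis using raise unfolding sz c_def[symmetric] up by auto
  next
    case False
    then have "polar_up (polar_down p) (lead1 k) (lead2 (l - r) r)
        = (real (l - r) + 1) * (real k - real r) * c"
      using raise unfolding up by (cases "r = 0")
          (auto simp: down[simplified] lead2_upd c_def algebra_simps)
    then show ?thesis using r unfolding sz c_def[symmetric]
      by (simp add: of_nat_diff algebra_simps)
  qed
qed

lemma isotypic_leading_coeff:
  fixes p :: "'n bipoly"
  assumes p: "p \<in> isotypic k l q" "raising_null p" and q: "q \<le> min k l" and r: "r \<le> l"
      "r \<noteq> q"
  shows "p (lead1 k) (lead2 (l - r) r) = 0"
proof -
  have "(real q * (real (k + l) + 1 - real q)) * p (lead1 k) (lead2 (l - r) r)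
     = (real r * (real (k + l) + 1 - real r)) * p (lead1 k) (lead2 (l - r) r)"
    using capelli_leading_coeff[of p k l r] p r by (simp add: isotypic_def)
  then have "((real r - real q) * (real (k + l) + 1 - real q - real r)) * p (lead1 k) (lead2 (l - r) r) = 0"
    by (simp add: algebra_simps)
  moreover have "real (k + l) + 1 - real q - real r \<noteq> 0" using q r by auto
  ultimately show ?thesis using r by simp
qed

lemma isotypic_highest_unique:
  fixes p :: "'n bipoly"
  assumes p: "p \<in> isotypic k l q" "raising_null p" and p': "p' \<in> isotypic k l q" "raising_null p'"
    and q: "q \<le> min k l"
  shows "p' (lead1 k) (lead2 (l - q) q) *\<^sub>R p = p (lead1 k) (lead2 (l - q) q) *\<^sub>R p'"
proof -
  let ?c = "\<lambda>p. p (lead1 k) (lead2 (l - q) q)"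
  have "?c p' *\<^sub>R p - ?c p *\<^sub>R p' = 0"
  proof (rule leading_coeffs_determine)
    show "?c p' *\<^sub>R p - ?c p *\<^sub>R p' \<in> bihomogeneous k l"
      using p p' by (simp add: isotypic_def bihomogeneous_iff gl_linear scaleR_diff_right mult.commute)
    show "raising_null (?c p' *\<^sub>R p - ?c p *\<^sub>R p')"
      using p p' by (simp add: raising_null_def gl_linear)
    show "(?c p' *\<^sub>R p - ?c p *\<^sub>R p') (lead1 k) (lead2 (l - r) r) = 0" if "r \<le> l" for r
      using isotypic_leading_coeff[OF p q that] isotypic_leading_coeff[OF p' q that]
      by (cases "r = q") auto
  qed
  then show ?thesis by simp
qed

lemma isotypic_lead_nonzero:
  fixes p :: "'n bipoly"
  assumes p: "p \<in> isotypic k l q" "raising_null p" and q: "q \<le> min k l" and nz: "p \<noteq> 0"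
  shows "p (lead1 k) (lead2 (l - q) q) \<noteq> 0"
  using leading_coeffs_determine[of p k l] isotypic_leading_coeff[OF p q] p nz
  by (auto simp: isotypic_def)

text \<open>
  The witness is \<open>\<alpha>\<^sub>1\<^bsup>k-q\<^esup> \<beta>\<^sub>1\<^bsup>l-q\<^esup> (\<alpha>\<^sub>1 \<beta>\<^sub>2 - \<alpha>\<^sub>2 \<beta>\<^sub>1)\<^sup>q\<close>; the induction builds it up from \<open>q = 0\<close> and
  also follows its leading coefficient in order to see that it does not vanish.
\<close>

lemma isotypic_nonzero:
  assumes q: "q \<le> min k l"
  shows "isotypic k l q \<noteq> ({0} :: 'n bipoly set)"
proof -
  define s t where "s = k - q" and "t = l - q"
  define m where "m = (\<lambda>a b. if a = lead1 s \<and> b = lead2 t 0 then 1 else (0::real))"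
  define h where "h r = (plucker fst_ix (snd_ix :: 'n) ^^ r) m" for r
  have m_hom: "m \<in> bihomogeneous s t"
    by (auto simp: bihomogeneous_def m_def msize_def sum_first_two snd_ix_neq)
  have DA: "D_alpha i m = 0" if "i \<noteq> fst_ix" for i
  proof -
    have "a(i := Suc (a i)) \<noteq> lead1 s" for a
      using that by (metis fun_upd_same lead1_apply(2) nat.distinct(1))
    then show ?thesis by (simp add: D_alpha_def m_def fun_eq_iff)
  qed
  have DB: "D_beta i m = 0" if "i \<noteq> fst_ix" for i
  proof -
    have "lead2 t 0 i = 0" using that by (cases "i = snd_ix") auto
    then have "a(i := Suc (a i)) \<noteq> lead2 t 0" for a
      by (metis fun_upd_same nat.distinct(1))
    then show ?thesis by (simp add: D_beta_def m_def fun_eq_iff)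
  qed
  have capm: "capelli m = 0"
  proof -
    have "mult_alpha i (mult_beta j (D_alpha i (D_beta j m)))
        - mult_alpha i (mult_beta j (D_alpha j (D_beta i m))) = 0" for i j
      using DA[of i] DA[of j] DB[of i] DB[of j] D_beta_D_alpha[of i j m] D_beta_D_alpha[of j i m]
      by (cases "i = fst_ix"; cases "j = fst_ix") (auto simp: weyl_linear simp flip: D_beta_D_alpha)
    then show ?thesis by (simp only: capelli_def sum.neutral_const)
  qed
  have h: "euler_alpha (h r) = real (s + r) *\<^sub>R h r \<and> euler_beta (h r)
      = real (t + r) *\<^sub>R h r
    \<and> capelli (h r) = (real r * (real s + real t + real r + 1)) *\<^sub>R h r
        \<and> h r (lead1 (s + r)) (lead2 t r) = 1" for r
  proof (induction r)
    case 0
    then show ?case using m_hom capm by (simp add: h_def bihomogeneous_iff) (simp add: m_def)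
  next
    case (Suc r)
    have S: "h (Suc r) = plucker fst_ix snd_ix (h r)" by (simp add: h_def)
    have "plucker fst_ix snd_ix (h r) (lead1 (Suc (s + r))) (lead2 t (Suc r))
        = h r (lead1 (s + r)) (lead2 t r)"
      using snd_ix_neq by (simp add: plucker_def mult_alpha_def mult_beta_def lead1_upd lead2_upd)
    moreover have IH: "euler_alpha (h r) = real (s + r) *\<^sub>R h r" "euler_beta (h r)
        = real (t + r) *\<^sub>R h r"
      "capelli (h r) = (real r * (real s + real t + real r + 1)) *\<^sub>R h r"
      using Suc by blast+
    moreover have "euler_alpha (h (Suc r)) = real (s + Suc r) *\<^sub>R h (Suc r)"
      "euler_beta (h (Suc r)) = real (t + Suc r) *\<^sub>R h (Suc r)"
      "capelli (h (Suc r)) = (real (Suc r) * (real s + real t + real (Suc r) + 1)) *\<^sub>R h (Suc r)"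
      unfolding S capelli_plucker euler_plucker euler_total_def IH
        linear_add[OF linear_plucker] linear_scale[OF linear_plucker]
      by (simp_all add: fun_eq_iff algebra_simps)
    moreover have "h (Suc r) (lead1 (s + Suc r)) (lead2 t (Suc r)) = 1"
      using calculation(1) Suc S by simp
    ultimately show ?case by blast
  qed
  have "h q \<in> isotypic k l q"
    using h[of q] q by (simp add: isotypic_def bihomogeneous_iff s_def t_def of_nat_diff algebra_simps)
  moreover have "h q \<noteq> 0"
  proof
    assume "h q = 0"
    then show False using h[of q] by (simp only: zero_fun_apply) simp
  qed
  ultimately show ?thesis by blast
qed

lemma isotypic_highest:
  assumes A: "gl_submodule A" "A \<subseteq> isotypic k l q" "A \<noteq> {0}" and q: "q \<le> min k l"
  obtains p :: "'n bipoly" where "p \<in> A" "p \<noteq> 0" "raising_null p"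
  using raising_null_exists[OF A(1) _ A(3), of k l] A(2) unfolding isotypic_def by blast

text \<open>
  A proper nonzero submodule and its Fischer complement would both contain vectors
  annihilated by the raising operators; but these are unique up to a factor
  (\<open>isotypic_highest_unique\<close>), so a nonzero vector would be orthogonal to itself.
\<close>

lemma gl_irreducible_isotypic:
  assumes q: "q \<le> min k l"
  shows "gl_irreducible (isotypic k l q :: 'n bipoly set)"
  unfolding gl_irreducible_def zero_fun_def[symmetric]
proof (intro conjI gl_submodule_isotypic isotypic_nonzero q allI impI)
  fix U :: "'n bipoly set" assume "gl_submodule U \<and> U \<subseteq> isotypic k l q"
  then have U: "gl_submodule U" "U \<subseteq> isotypic k l q" by auto
  have subU: "subspace U" using U by (simp add: gl_submodule_iff)
  have hom: "isotypic k l q \<subseteq> (bihomogeneous k l :: 'n bipoly set)" by (auto simp: isotypic_def)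
  show "U = {0} \<or> U = isotypic k l q"
  proof (rule ccontr)
    assume "\<not> ?thesis"
    then obtain w where ne: "U \<noteq> {0}" and w: "w \<in> isotypic k l q" "w \<notin> U" using U by blast
    define W where "W = {p \<in> isotypic k l q. \<forall>a\<in>U. fischer k l p a = 0}"
    have fin: "finite ({a :: 'n mindex. msize a = k} \<times> {b :: 'n mindex. msize b = l})"
      by (intro finite_cartesian_product finite_msize_eq)
    have Uhom: "U \<subseteq> bihomogeneous k l" using U hom by (rule_tac order_trans)
    have supp: "p a b = 0" if "p \<in> U" "(a, b) \<notin> {a. msize a = k} \<times> {b. msize b = l}"
        for p a b
      using bihomogeneous_zero[of p k l a b] Uhom that by auto
    have "\<exists>u\<in>U. \<forall>a\<in>U. fischer k l (w - u) a = 0"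
      by (rule fischer_projection[OF fin subU Uhom]) (rule supp)
    then obtain u where u: "u \<in> U" "\<forall>a\<in>U. fischer k l (w - u) a = 0" by blast
    have sub: "subspace (isotypic k l q :: 'n bipoly set)"
      using gl_submodule_isotypic[where 'a = 'n] by (simp add: gl_submodule_iff)
    have "w - u \<in> W" using u w U sub by (auto simp: W_def intro: subspace_diff)
    moreover have "w - u \<noteq> 0" using w u by auto
    ultimately have Wne: "W \<noteq> {0}" by blast
    have "gl_submodule W" unfolding gl_submodule_iff
    proof safe
      show "subspace W" using sub by (auto simp: subspace_def W_def fischer_linear)
      show "gl_unit i j p \<in> W" if "p \<in> W" for i j p
        using that U gl_submodule_isotypic[of k l q, where 'a = 'n]
            by (auto simp: W_def gl_submodule_iff fischer_gl_unit)
    qed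
    then obtain p where p: "p \<in> W" "p \<noteq> 0" "raising_null p"
      using isotypic_highest[of W k l q] Wne q unfolding W_def by blast
    obtain p' where p': "p' \<in> U" "p' \<noteq> 0" "raising_null p'"
      using isotypic_highest[of U k l q] ne q U by blast
    have piso: "p \<in> isotypic k l q" "p' \<in> isotypic k l q" using p p' U by (auto simp: W_def)
    let ?c = "\<lambda>p. p (lead1 k) (lead2 (l - q) q)"
    have c: "?c p' \<noteq> 0" using isotypic_lead_nonzero[OF piso(2) p'(3) q p'(2)] .
    have "?c p' *\<^sub>R p = ?c p *\<^sub>R p'"
      using isotypic_highest_unique[OF piso(1) p(3) piso(2) p'(3) q] .
    then have "?c p' *\<^sub>R p \<in> U" using subU p' by (simp add: subspace_scale)
    then have "(1 / ?c p') *\<^sub>R ?c p' *\<^sub>R p \<in> U" by (rule subspace_scale[OF subU])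
    then have "p \<in> U" using c by simp
    then have "fischer k l p p = 0" using p by (auto simp: W_def)
    then show False using fischer_pos[of p k l] p piso by (auto simp: isotypic_def)
  qed
qed

text \<open>
  Diagonal operators preserve the line of vectors of \<open>isotypic k l q\<close> that the raising
  operators annihilate, and the weight can be read off from the leading monomial
  \<open>\<alpha>\<^sub>1\<^sup>k \<beta>\<^sub>1\<^bsup>l-q\<^esup> \<beta>\<^sub>2\<^sup>q\<close>.
\<close>

lemma isotypic_highest_weight_vector:
  fixes p :: "'n bipoly"
  assumes p: "p \<in> isotypic k l q" "p \<noteq> 0" "raising_null p" and q: "q \<le> min k l"
  shows "highest_weight_vector [k + l - q, q] p"
proof -
  have "gl_unit i i p = real (line_length [k + l - q, q] i) *\<^sub>R p" for i
  proof -
    let ?c = "\<lambda>p. p (lead1 k) (lead2 (l - q) q)"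
    have "gl_unit i i p \<in> isotypic k l q" "raising_null (gl_unit i i p)"
    proof -
      show "gl_unit i i p \<in> isotypic k l q" using gl_submodule_isotypic[of k l q, where 'a = 'n] p
        by (simp add: gl_submodule_iff)
      have comm: "gl_unit j' j (gl_unit i i p) = gl_unit i i (gl_unit j' j p)
          + of_bool (j = i) *\<^sub>R gl_unit j' i p - of_bool (j' = i) *\<^sub>R gl_unit i j p" for j j'
        by (simp add: gl_unit_eq weyl_linear weyl_relations algebra_simps of_bool_def)
      show "raising_null (gl_unit i i p)" using p(3)
        by (auto simp: raising_null_def comm gl_linear)
    qed
    then have "?c p *\<^sub>R gl_unit i i p = ?c (gl_unit i i p) *\<^sub>R p"
      using isotypic_highest_unique[of "gl_unit i i p" k l q p] p q by simp
    also have "?c (gl_unit i i p) = real (line_length [k + l - q, q] i) * ?c p"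
      using q by (cases "i = fst_ix"; cases "i = snd_ix")
          (auto simp: gl_unit_diag_apply line_length_two_rows snd_ix_neq)
    finally have "?c p *\<^sub>R gl_unit i i p
        = ?c p *\<^sub>R (real (line_length [k + l - q, q] i) *\<^sub>R p)"
      by (simp only: scaleR_scaleR mult.commute)
    then show ?thesis using isotypic_lead_nonzero[OF p(1,3) q p(2)] by (simp only: scaleR_cancel_left) simp
  qed
  then show ?thesis using p unfolding highest_weight_vector_def raising_null_def
    by (simp add: zero_fun_def scaleR_fun_def)
qed

text \<open>
  A highest weight vector of weight \<open>(k + l - q, q)\<close> has, for reasons of weight, the leading
  monomial with \<open>r = q\<close> as its only possible one, and is therefore proportional to the one
  in \<open>isotypic k l q\<close>. An irreducible module with this highest weight thus meets
  \<open>isotypic k l q\<close> and, both being irreducible, equals it.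
\<close>

theorem V_eq_isotypic:
  assumes q: "q \<le> min k l"
  shows "V k l q = (isotypic k l q :: 'n bipoly set)"
  unfolding V_def
proof (rule the_equality)
  obtain p :: "'n bipoly" where p: "p \<in> isotypic k l q" "p \<noteq> 0" "raising_null p"
    using isotypic_highest[OF gl_submodule_isotypic subset_refl isotypic_nonzero[OF q] q] by blast
  note hwv = isotypic_highest_weight_vector[OF p q]
  show "isotypic k l q \<subseteq> bihomogeneous k l
      \<and> has_young_diagram [k + l - q, q] (isotypic k l q :: 'n bipoly set)"
    using gl_irreducible_isotypic[OF q] p hwv by (auto simp: has_young_diagram_def isotypic_def)
  fix W :: "'n bipoly set"
  assume "W \<subseteq> bihomogeneous k l \<and> has_young_diagram [k + l - q, q] W"
  then obtain p' where W: "W \<subseteq> bihomogeneous k l" "gl_irreducible W" and p': "p' \<in> W"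
    "highest_weight_vector [k + l - q, q] p'" by (auto simp: has_young_diagram_def)
  have p'': "p' \<noteq> 0" "raising_null p'" "p' \<in> bihomogeneous k l"
    using p' W by (auto simp: highest_weight_vector_def raising_null_def zero_fun_def)
  let ?c = "\<lambda>p. p (lead1 k) (lead2 (l - q) q)"
  have lead': "p' (lead1 k) (lead2 (l - r) r) = 0" if "r \<le> l" "r \<noteq> q" for r
  proof -
    have "gl_unit snd_ix snd_ix p' = (\<lambda>a b. real q * p' a b)"
      using p'(2) by (simp add: highest_weight_vector_def line_length_two_rows snd_ix_neq)
    then have "real (lead1 k snd_ix + lead2 (l - r) r snd_ix) * p' (lead1 k) (lead2 (l - r) r)
        = real q * p' (lead1 k) (lead2 (l - r) r)"
      by (metis gl_unit_diag_apply)
    then show ?thesis using that snd_ix_neq by auto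
  qed
  have "?c p *\<^sub>R p' - ?c p' *\<^sub>R p = 0"
  proof (rule leading_coeffs_determine)
    show "?c p *\<^sub>R p' - ?c p' *\<^sub>R p \<in> bihomogeneous k l"
      using p p'' by (simp add: isotypic_def bihomogeneous_iff gl_linear scaleR_diff_right mult.commute)
    show "raising_null (?c p *\<^sub>R p' - ?c p' *\<^sub>R p)"
      using p p'' by (simp add: raising_null_def gl_linear)
    show "(?c p *\<^sub>R p' - ?c p' *\<^sub>R p) (lead1 k) (lead2 (l - r) r) = 0" if "r \<le> l" for r
      using isotypic_leading_coeff[OF p(1,3) q that] lead'[OF that]
      by (cases "r = q") auto
  qed
  then have eq: "?c p *\<^sub>R p' = ?c p' *\<^sub>R p" by simp
  have sub: "gl_submodule (isotypic k l q :: 'n bipoly set)" "subspace (isotypic k l q :: 'n bipoly set)"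
    using gl_submodule_isotypic[where 'a = 'n] by (simp_all add: gl_submodule_iff)
  have "(1 / ?c p) *\<^sub>R ?c p *\<^sub>R p' \<in> isotypic k l q"
    unfolding eq using p sub by (intro subspace_scale) auto
  then have p'iso: "p' \<in> isotypic k l q" using isotypic_lead_nonzero[OF p(1,3) q p(2)] by simp
  have subW: "gl_submodule W" using W(2) by (simp add: gl_irreducible_def)
  have "gl_submodule (W \<inter> isotypic k l q)"
    using sub subW by (auto simp: gl_submodule_iff subspace_inter)
  moreover have "W \<inter> isotypic k l q \<noteq> {0}" using p' p'' p'iso by blast
  ultimately have "W \<inter> isotypic k l q = W" "W \<inter> isotypic k l q = isotypic k l q"
    using W(2) gl_irreducible_isotypic[OF q] unfolding gl_irreducible_def zero_fun_def[symmetric]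
    by (metis Int_lower1, metis Int_lower2)
  then show "W = isotypic k l q" by simp
qed

end

section \<open>Closure properties of smooth functions\<close>

lemma pderiv_at_eqI: "(f has_derivative f') (at x) \<Longrightarrow> pderiv_at i f x = f' (axis i 1)"
  unfolding pderiv_at_def using frechet_derivative_at by metis

lemma smooth_differentiable: "smooth f \<Longrightarrow> f differentiable (at x)"
  unfolding smooth_def by (drule spec[of _ "[]"]) simp

lemma smooth_has_derivative: "smooth f \<Longrightarrow> (f has_derivative frechet_derivative f (at x))
    (at x)"
  using smooth_differentiable frechet_derivative_works by blast

lemma smooth_pderiv: "smooth f \<Longrightarrow> smooth (pderiv_at i f)"
  unfolding smooth_def
proof (intro allI)
  fix "is" x assume "\<forall>is x. foldr pderiv_at is f differentiable at x"
  from this[rule_format, of "is @ [i]"] show "foldr pderiv_at is (pderiv_at i f) differentiable at x"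
      by simp
qed

text \<open>
  Smoothness is the largest property that implies differentiability and is inherited by
  partial derivatives.
\<close>

lemma smooth_coinduct [consumes 1, case_names differentiable pderiv]:
  assumes "P f" and d: "\<And>f x. P f \<Longrightarrow> f differentiable (at x)" and p:
      "\<And>f i. P f \<Longrightarrow> P (pderiv_at i f)"
  shows "smooth f"
proof -
  have "P (foldr pderiv_at is f)" for "is"
    by (induction "is") (auto intro: p \<open>P f\<close>)
  then show ?thesis by (auto simp: smooth_def intro: d)
qed

lemma pderiv_add:
  "f differentiable (at x) \<Longrightarrow> g differentiable (at x)
      \<Longrightarrow> pderiv_at i (f + g) x = pderiv_at i f x + pderiv_at i g x"
  unfolding plus_fun_def
  by (subst pderiv_at_eqI[OF has_derivative_add]) (auto simp: frechet_derivative_works pderiv_at_def)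

lemma pderiv_scale:
  "f differentiable (at x) \<Longrightarrow> pderiv_at i (c *\<^sub>R f) x = c * pderiv_at i f x"
  unfolding scaleR_fun_def
  by (subst pderiv_at_eqI[OF has_derivative_scaleR_right])
      (auto simp: frechet_derivative_works pderiv_at_def)

lemma pderiv_mult:
  fixes f g :: "'n::{finite,linorder} fn"
  assumes "f differentiable (at x)" "g differentiable (at x)"
  shows "pderiv_at i (f * g) x = pderiv_at i f x * g x + f x * pderiv_at i g x"
proof -
  have "((\<lambda>y. f y * g y) has_derivative
      (\<lambda>h. f x * frechet_derivative g (at x) h + frechet_derivative f (at x) h * g x)) (at x)"
    using assms by (intro has_derivative_mult) (auto simp: frechet_derivative_works)
  from pderiv_at_eqI[OF this] show ?thesis
    by (simp add: times_fun_def pderiv_at_def)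
qed

lemma pderiv_const: "pderiv_at i (\<lambda>x. c) = 0"
  by (rule ext) (simp add: pderiv_at_eqI[OF has_derivative_const])

definition coord :: "'n \<Rightarrow> 'n::{finite,linorder} fn" where
  "coord j = (\<lambda>x. x $ j)"

lemma coord_has_derivative: "(coord j has_derivative (\<lambda>h. h $ j)) (at x)"
  unfolding coord_def by (rule bounded_linear.has_derivative[OF bounded_linear_vec_nth])
      (rule has_derivative_ident)

lemma pderiv_coord: "pderiv_at i (coord j) = (\<lambda>x. of_bool (i = j))"
  by (rule ext) (simp add: pderiv_at_eqI[OF coord_has_derivative] axis_def)

lemma smooth_zero: "smooth 0"
proof -
  have "(0 :: 'a fn) = 0" ..
  then show ?thesis
  proof (rule smooth_coinduct[where P = "\<lambda>f. f = 0"])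
    fix f :: "'a fn" and x i assume "f = 0"
    then show "f differentiable (at x)" "pderiv_at i f = 0"
      by (simp_all add: zero_fun_def pderiv_const)
  qed
qed

lemma smooth_if_derivatives_smooth:
  assumes d: "\<And>x. f differentiable (at x)" and s: "\<And>i. smooth (pderiv_at i f)"
  shows "smooth f"
proof (rule smooth_coinduct[where P = "\<lambda>g. g = f \<or> smooth g"])
  fix g x i assume "g = f \<or> smooth g"
  then show "g differentiable (at x)" "pderiv_at i g = f \<or> smooth (pderiv_at i g)"
    using d s by (auto intro: smooth_pderiv smooth_differentiable)
qed simp

lemma smooth_const: "smooth (\<lambda>x. c)"
  by (rule smooth_if_derivatives_smooth) (simp_all add: pderiv_const smooth_zero)

lemma smooth_coord: "smooth (coord j)"
proof (rule smooth_if_derivatives_smooth)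
  show "coord j differentiable (at x)" for x
    using coord_has_derivative by (auto simp: differentiable_def)
  show "smooth (pderiv_at i (coord j))" for i
    unfolding pderiv_coord by (rule smooth_const)
qed

lemma pderiv_add_smooth: "smooth f \<Longrightarrow> smooth g \<Longrightarrow> pderiv_at i (f + g)
    = pderiv_at i f + pderiv_at i g"
  by (rule ext) (simp add: pderiv_add smooth_differentiable)

lemma pderiv_scale_smooth: "smooth f \<Longrightarrow> pderiv_at i (c *\<^sub>R f)
    = c *\<^sub>R pderiv_at i f"
  by (rule ext) (simp add: pderiv_scale smooth_differentiable)

lemma pderiv_mult_smooth: "smooth f \<Longrightarrow> smooth g \<Longrightarrow> pderiv_at i (f * g)
    = pderiv_at i f * g + f * pderiv_at i g"
  by (rule ext) (simp add: pderiv_mult smooth_differentiable)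

text \<open>
  The products of smooth functions are not closed under derivatives, but their finite sums
  are: this is the invariant for coinduction that yields the smoothness of products and of
  sums at once.
\<close>

inductive sum_of_products :: "'n::{finite,linorder} fn \<Rightarrow> bool" where
  prod: "smooth f \<Longrightarrow> smooth g \<Longrightarrow> sum_of_products (f * g)"
| add: "sum_of_products f \<Longrightarrow> sum_of_products g \<Longrightarrow> sum_of_products (f + g)"

lemma sum_of_products_differentiable: "sum_of_products f \<Longrightarrow> f differentiable (at x)"
proof (induction rule: sum_of_products.induct)
  case (prod f g)
  then show ?case unfolding times_fun_def by (intro differentiable_mult smooth_differentiable)
next
  case (add f g)
  then show ?case unfolding plus_fun_def by (intro differentiable_add)
qed

lemma sum_of_products_pderiv: "sum_of_products f \<Longrightarrow> sum_of_products (pderiv_at i f)"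
proof (induction rule: sum_of_products.induct)
  case (prod f g)
  then show ?case unfolding pderiv_mult_smooth[OF prod] by (intro sum_of_products.intros smooth_pderiv)
next
  case (add f g)
  then have "pderiv_at i (f + g) = pderiv_at i f + pderiv_at i g"
    by (intro ext) (simp add: pderiv_add sum_of_products_differentiable)
  then show "sum_of_products (pderiv_at i (f + g))"
    using sum_of_products.add[OF add(3,4)] by (simp only:)
qed

lemma sum_of_products_smooth: "sum_of_products f \<Longrightarrow> smooth f"
  by (erule smooth_coinduct) (auto intro: sum_of_products_differentiable sum_of_products_pderiv)

lemma smooth_mult: "smooth f \<Longrightarrow> smooth g \<Longrightarrow> smooth (f * g)"
  by (rule sum_of_products_smooth[OF sum_of_products.prod])

lemma smooth_add:
  assumes "smooth f" "smooth g" shows "smooth (f + g)"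
proof -
  have "sum_of_products ((\<lambda>x. 1) * f + (\<lambda>x. 1) * g)"
    by (rule sum_of_products.add; rule sum_of_products.prod[OF smooth_const]; fact)
  moreover have "(\<lambda>x. 1) * f + (\<lambda>x. 1) * g = f + g" by (simp add: fun_eq_iff)
  ultimately show ?thesis by (metis sum_of_products_smooth)
qed

lemma smooth_scale: "smooth f \<Longrightarrow> smooth (c *\<^sub>R f)"
  using smooth_mult[OF smooth_const[of c], of f] by (simp add: times_fun_def scaleR_fun_def)

lemma smooth_sum: "(\<And>k. k \<in> K \<Longrightarrow> smooth (f k))
    \<Longrightarrow> smooth (\<Sum>k\<in>K. f k)"
  by (induction K rule: infinite_finite_induct) (auto intro: smooth_add smooth_zero)

lemma pderiv_sum_smooth:
  "(\<And>k. k \<in> K \<Longrightarrow> smooth (f k))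
      \<Longrightarrow> pderiv_at i (\<Sum>k\<in>K. f k) = (\<Sum>k\<in>K. pderiv_at i (f k))"
proof (induction K rule: infinite_finite_induct)
  case (insert k K)
  have "pderiv_at i (f k + sum f K) = pderiv_at i (f k) + pderiv_at i (sum f K)"
    using insert.prems by (intro pderiv_add_smooth smooth_sum) auto
  moreover have "pderiv_at i (sum f K) = (\<Sum>k\<in>K. pderiv_at i (f k))"
    using insert by blast
  ultimately show "pderiv_at i (sum f (insert k K)) = (\<Sum>k\<in>insert k K. pderiv_at i (f k))"
    using insert.hyps by simp
qed (simp_all add: zero_fun_def pderiv_const)

section \<open>Symmetry of second derivatives\<close>

lemma has_derivative_along_axis:
  assumes "smooth f"
  shows "((\<lambda>t. f (y + t *\<^sub>R axis i 1)) has_real_derivative pderiv_at i f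
      (y + t *\<^sub>R axis i 1)) (at t)"
proof -
  have "((\<lambda>t. y + t *\<^sub>R axis i 1) has_derivative (\<lambda>s. s *\<^sub>R axis i 1)) (at t)"
    by (auto intro!: derivative_eq_intros)
  from has_derivative_compose[OF this smooth_has_derivative[OF assms]]
  have "((\<lambda>t. f (y + t *\<^sub>R axis i 1)) has_derivative
     (\<lambda>s. frechet_derivative f (at (y + t *\<^sub>R axis i 1)) (s *\<^sub>R axis i 1))) (at t)" .
  moreover have "(\<lambda>s. frechet_derivative f (at (y + t *\<^sub>R axis i 1)) (s *\<^sub>R axis i 1)) =
     (*) (pderiv_at i f (y + t *\<^sub>R axis i 1))"
    using linear_frechet_derivative[OF smooth_differentiable[OF assms]]
    by (auto simp: pderiv_at_def linear_scale)
  ultimately show ?thesis by (simp add: has_field_derivative_def)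
qed

text \<open>
  Mean value theorem, first along the axis \<open>i\<close> for a difference in direction \<open>j\<close>, then along
  the axis \<open>j\<close>.
\<close>

lemma mixed_difference:
  assumes f: "smooth f" and h: "h > 0"
  obtains s t where "0 < s" "s < h" "0 < t" "t < h"
    "f (x + h *\<^sub>R axis i 1 + h *\<^sub>R axis j 1) - f (x + h *\<^sub>R axis i 1)
        - f (x + h *\<^sub>R axis j 1) + f x =
      h * h * pderiv_at j (pderiv_at i f) (x + s *\<^sub>R axis i 1 + t *\<^sub>R axis j 1)"
proof -
  let ?g = "\<lambda>s. f ((x + h *\<^sub>R axis j 1) + s *\<^sub>R axis i 1)
      - f (x + s *\<^sub>R axis i 1)"
  have "\<exists>s>0. s < h \<and> ?g h - ?g 0
      = (h - 0) * (pderiv_at i f ((x + h *\<^sub>R axis j 1) + s *\<^sub>R axis i 1)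
      - pderiv_at i f (x + s *\<^sub>R axis i 1))"
    by (intro MVT2[OF h] DERIV_diff has_derivative_along_axis f)
  then obtain s where s: "0 < s" "s < h" and 1: "?g h - ?g 0
      = h * (pderiv_at i f ((x + h *\<^sub>R axis j 1) + s *\<^sub>R axis i 1)
      - pderiv_at i f (x + s *\<^sub>R axis i 1))"
    by auto
  let ?k = "\<lambda>t. pderiv_at i f ((x + s *\<^sub>R axis i 1) + t *\<^sub>R axis j 1)"
  have "\<exists>t>0. t < h \<and> ?k h - ?k 0
      = (h - 0) * pderiv_at j (pderiv_at i f) ((x + s *\<^sub>R axis i 1) + t *\<^sub>R axis j 1)"
    by (intro MVT2[OF h] has_derivative_along_axis smooth_pderiv f)
  then obtain t where t: "0 < t" "t < h" and 2: "?k h - ?k 0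
      = h * pderiv_at j (pderiv_at i f) ((x + s *\<^sub>R axis i 1) + t *\<^sub>R axis j 1)"
    by auto
  have "?g h - ?g 0 = h * (?k h - ?k 0)" unfolding 1 by (simp add: add_ac)
  then have "?g h - ?g 0 = h * h * pderiv_at j (pderiv_at i f)
      ((x + s *\<^sub>R axis i 1) + t *\<^sub>R axis j 1)"
    unfolding 2 by simp
  then show ?thesis using that[OF s t] by (simp add: algebra_simps)
qed

text \<open>
  The mixed second difference is symmetric in the two directions. By \<open>mixed_difference\<close> it
  is a value of either mixed derivative at a point arbitrarily close to \<open>x\<close>, and these
  derivatives are continuous.
\<close>

lemma pderiv_commute:
  fixes f :: "'n::{finite,linorder} fn"
  assumes f: "smooth f"
  shows "pderiv_at i (pderiv_at j f) = pderiv_at j (pderiv_at i f)"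
proof (rule ext, rule ccontr)
  fix x
  let ?A = "pderiv_at j (pderiv_at i f)" and ?B = "pderiv_at i (pderiv_at j f)"
  assume "?B x \<noteq> ?A x"
  define e where "e = \<bar>?A x - ?B x\<bar> / 2"
  have e: "e > 0" using \<open>?B x \<noteq> ?A x\<close> by (simp add: e_def)
  have "isCont ?A x" "isCont ?B x"
    by (intro differentiable_imp_continuous_within smooth_differentiable smooth_pderiv f)+
  then obtain d1 d2 where d: "d1 > 0" "\<And>y. dist y x < d1 \<Longrightarrow> dist (?A y) (?A x) < e"
    "d2 > 0" "\<And>y. dist y x < d2 \<Longrightarrow> dist (?B y) (?B x) < e"
    using e unfolding continuous_at_eps_delta by metis
  \<comment> \<open>the intermediate points are within \<open>2 h\<close> of \<open>x\<close>\<close>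
  define h where "h = min d1 d2 / 4"
  have h: "h > 0" using d by (simp add: h_def)
  have near: "dist (x + s *\<^sub>R axis i 1 + t *\<^sub>R axis j 1) x < min d1 d2"
    if "0 < s" "s < h" "0 < t" "t < h" for s t i j
  proof -
    have "dist (x + s *\<^sub>R axis i 1 + t *\<^sub>R axis j 1) x \<le> norm
        (s *\<^sub>R axis i 1 ::(real, 'n) vec) + norm (t *\<^sub>R axis j 1 ::(real, 'n) vec)"
      unfolding dist_norm using norm_triangle_ineq[of "s *\<^sub>R axis i 1 ::(real, 'n) vec"
          "t *\<^sub>R axis j 1"] by (simp add: add_ac)
    also have "\<dots> = s + t" using that by (simp add: norm_axis_1)
    also have "\<dots> < min d1 d2" using that h by (simp add: h_def)
    finally show ?thesis .
  qed
  obtain s t where st: "0 < s" "s < h" "0 < t" "t < h" and 1: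
    "f (x + h *\<^sub>R axis i 1 + h *\<^sub>R axis j 1) - f (x + h *\<^sub>R axis i 1)
        - f (x + h *\<^sub>R axis j 1) + f x =
      h * h * ?A (x + s *\<^sub>R axis i 1 + t *\<^sub>R axis j 1)"
    using mixed_difference[OF f h] by metis
  obtain s' t' where st': "0 < s'" "s' < h" "0 < t'" "t' < h" and 2:
    "f (x + h *\<^sub>R axis j 1 + h *\<^sub>R axis i 1) - f (x + h *\<^sub>R axis j 1)
        - f (x + h *\<^sub>R axis i 1) + f x =
      h * h * ?B (x + s' *\<^sub>R axis j 1 + t' *\<^sub>R axis i 1)"
    using mixed_difference[OF f h] by metis
  have "h * h * ?A (x + s *\<^sub>R axis i 1 + t *\<^sub>R axis j 1)
      = h * h * ?B (x + s' *\<^sub>R axis j 1 + t' *\<^sub>R axis i 1)"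
  proof -
    have "x + h *\<^sub>R axis j 1 + h *\<^sub>R axis i 1 = x + h *\<^sub>R axis i 1
        + h *\<^sub>R axis j 1" by (simp add: add_ac)
    then show ?thesis using 1 2 by (simp only:)
  qed
  then have eq: "?A (x + s *\<^sub>R axis i 1 + t *\<^sub>R axis j 1)
      = ?B (x + s' *\<^sub>R axis j 1 + t' *\<^sub>R axis i 1)"
    using h by simp
  have "\<bar>?A (x + s *\<^sub>R axis i 1 + t *\<^sub>R axis j 1) - ?A x\<bar> < e"
    using d(2) near[OF st] by (simp add: dist_real_def)
  moreover have "\<bar>?B (x + s' *\<^sub>R axis j 1 + t' *\<^sub>R axis i 1) - ?B x\<bar> < e"
    using d(4) near[OF st'] by (simp add: dist_real_def)
  ultimately show False unfolding eq using \<open>?B x \<noteq> ?A x\<close> by (simp add: e_def abs_if split: if_splits)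
qed

section \<open>Multi-index derivatives\<close>

lemma smooth_pderiv_power: "smooth f \<Longrightarrow> smooth ((pderiv_at i ^^ m) f)"
  by (induction m) (auto intro: smooth_pderiv)

lemma pderiv_power_commute: "smooth f \<Longrightarrow> (pderiv_at i ^^ m) (pderiv_at j f)
    = pderiv_at j ((pderiv_at i ^^ m) f)"
  by (induction m) (simp_all add: pderiv_commute[of _ i j] smooth_pderiv_power)

text \<open>
  Derivatives in an arbitrary order of the coordinates, so that one can argue by induction
  on the list of coordinates.
\<close>

definition list_deriv :: "'n list \<Rightarrow> 'n mindex \<Rightarrow> 'n::{finite,linorder} fn
    \<Rightarrow> 'n fn" where
  "list_deriv xs a f = foldr (\<lambda>i. pderiv_at i ^^ a i) xs f"

lemma list_deriv_Nil: "list_deriv [] a f = f"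
  and list_deriv_Cons: "list_deriv (i # xs) a f = (pderiv_at i ^^ a i) (list_deriv xs a f)"
  by (simp_all add: list_deriv_def)

lemmas list_deriv_simps = list_deriv_Nil list_deriv_Cons

lemma smooth_list_deriv: "smooth f \<Longrightarrow> smooth (list_deriv xs a f)"
  by (induction xs) (auto simp: list_deriv_simps intro: smooth_pderiv_power)

lemma list_deriv_pderiv: "smooth f \<Longrightarrow> list_deriv xs a (pderiv_at i f)
    = pderiv_at i (list_deriv xs a f)"
  by (induction xs) (simp_all add: list_deriv_simps pderiv_power_commute smooth_list_deriv)

lemma list_deriv_cong: "(\<And>i. i \<in> set xs \<Longrightarrow> a i = b i)
    \<Longrightarrow> list_deriv xs a f = list_deriv xs b f"
  by (induction xs) (simp_all add: list_deriv_simps)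

lemma list_deriv_Cons_upd:
  "j \<notin> set xs \<Longrightarrow> list_deriv (j # xs) (a(j := m)) f
      = (pderiv_at j ^^ m) (list_deriv xs a f)"
proof -
  assume "j \<notin> set xs"
  then have "list_deriv xs (a(j := m)) f = list_deriv xs a f" by (intro list_deriv_cong) auto
  then show ?thesis unfolding list_deriv_Cons by (simp only: fun_upd_same)
qed

lemma list_deriv_Suc: "smooth f \<Longrightarrow> distinct xs \<Longrightarrow> i \<in> set xs
    \<Longrightarrow>
    list_deriv xs (a(i := Suc (a i))) f = pderiv_at i (list_deriv xs a f)"
proof (induction xs)
  case (Cons j xs)
  show "list_deriv (j # xs) (a(i := Suc (a i))) f = pderiv_at i (list_deriv (j # xs) a f)"
  proof (cases "i = j")
    case True
    with Cons.prems show ?thesis by (simp add: list_deriv_Cons_upd del: fun_upd_apply)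
        (simp add: list_deriv_Cons)
  next
    case False
    have IH: "list_deriv xs (a(i := Suc (a i))) f = pderiv_at i (list_deriv xs a f)"
      by (rule Cons.IH) (use Cons.prems False in auto)
    show ?thesis using False Cons.prems
      unfolding list_deriv_Cons IH by (simp add: pderiv_power_commute smooth_list_deriv)
  qed
qed simp

lemma pderiv_power_linear:
  assumes "smooth f" "smooth g"
  shows "(pderiv_at i ^^ m) (f + g) = (pderiv_at i ^^ m) f + (pderiv_at i ^^ m) g"
    "(pderiv_at i ^^ m) (c *\<^sub>R f) = c *\<^sub>R (pderiv_at i ^^ m) f"
  using assms by (induction m) (simp_all add: pderiv_add_smooth pderiv_scale_smooth smooth_pderiv_power)

lemma list_deriv_linear:
  assumes "smooth f" "smooth g"
  shows "list_deriv xs a (f + g) = list_deriv xs a f + list_deriv xs a g"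
    "list_deriv xs a (c *\<^sub>R f) = c *\<^sub>R list_deriv xs a f"
  using assms by (induction xs) (simp_all add: list_deriv_simps pderiv_power_linear smooth_list_deriv)

lemma pderiv_coord_mult: "smooth f \<Longrightarrow> pderiv_at i (coord j * f)
    = coord j * pderiv_at i f + of_bool (i = j) *\<^sub>R f"
  by (rule ext) (simp add: pderiv_mult_smooth smooth_coord pderiv_coord)

lemma pderiv_power_coord_mult:
  assumes "smooth f"
  shows "(pderiv_at i ^^ m) (coord j * f) = coord j * (pderiv_at i ^^ m) f
    + (of_bool (i = j) * real m) *\<^sub>R (pderiv_at i ^^ (m - 1)) f"
proof (induction m)
  case (Suc m)
  have "(pderiv_at i ^^ Suc m) (coord j * f) = pderiv_at i ((pderiv_at i ^^ m) (coord j * f))" by simp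
  also have "(pderiv_at i ^^ m) (coord j * f) = coord j * (pderiv_at i ^^ m) f
    + (of_bool (i = j) * real m) *\<^sub>R (pderiv_at i ^^ (m - 1)) f"
    using Suc by blast
  also have "pderiv_at i (\<dots>) = coord j * (pderiv_at i ^^ Suc m) f
      + of_bool (i = j) *\<^sub>R (pderiv_at i ^^ m) f
    + (of_bool (i = j) * real m) *\<^sub>R pderiv_at i ((pderiv_at i ^^ (m - 1)) f)"
    using assms by (simp add: pderiv_add_smooth pderiv_scale_smooth smooth_pderiv_power smooth_mult
       smooth_coord smooth_scale pderiv_coord_mult)
  also have "\<dots> = coord j * (pderiv_at i ^^ Suc m) f
    + (of_bool (i = j) * real (Suc m)) *\<^sub>R (pderiv_at i ^^ (Suc m - 1)) f"
    by (cases m) (simp_all add: fun_eq_iff algebra_simps)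
  finally show "(pderiv_at i ^^ Suc m) (coord j * f) = coord j * (pderiv_at i ^^ Suc m) f
    + (of_bool (i = j) * real (Suc m)) *\<^sub>R (pderiv_at i ^^ (Suc m - 1)) f" .
qed simp

lemma list_deriv_coord_mult:
  assumes f: "smooth f" and "distinct xs"
  shows "list_deriv xs a (coord j * f) = coord j * list_deriv xs a f
    + (of_bool (j \<in> set xs) * real (a j)) *\<^sub>R list_deriv xs (a(j := a j - 1)) f"
  using assms(2)
proof (induction xs)
  case (Cons i xs)
  note sm = smooth_list_deriv[OF f]
  have IH: "list_deriv xs a (coord j * f) = coord j * list_deriv xs a f
    + (of_bool (j \<in> set xs) * real (a j)) *\<^sub>R list_deriv xs (a(j := a j - 1)) f"
    by (rule Cons.IH) (use Cons.prems in simp)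
  show "list_deriv (i # xs) a (coord j * f) = coord j * list_deriv (i # xs) a f
    + (of_bool (j \<in> set (i # xs)) * real (a j)) *\<^sub>R list_deriv (i # xs) (a(j := a j - 1)) f"
  proof (cases "i = j")
    case True
    then have j: "j \<notin> set xs" using Cons.prems by simp
    then have "list_deriv xs a (coord j * f) = coord j * list_deriv xs a f" using IH by simp
    then have "list_deriv (j # xs) a (coord j * f) = (pderiv_at j ^^ a j) (coord j * list_deriv xs a f)"
      by (simp only: list_deriv_Cons)
    also have "\<dots> = coord j * list_deriv (j # xs) a f
        + real (a j) *\<^sub>R (pderiv_at j ^^ (a j - 1)) (list_deriv xs a f)"
      by (simp add: pderiv_power_coord_mult[OF sm] list_deriv_Cons)
    finally show ?thesis using True j by (simp add: list_deriv_Cons_upd del: fun_upd_apply)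
  next
    case False
    have "list_deriv (i # xs) a (coord j * f) = (pderiv_at i ^^ a i) (coord j * list_deriv xs a f
      + (of_bool (j \<in> set xs) * real (a j)) *\<^sub>R list_deriv xs (a(j := a j - 1)) f)"
      unfolding list_deriv_Cons IH ..
    also have "\<dots> = (pderiv_at i ^^ a i) (coord j * list_deriv xs a f)
      + (of_bool (j \<in> set xs) * real (a j)) *\<^sub>R (pderiv_at i ^^ a i)
          (list_deriv xs (a(j := a j - 1)) f)"
      by (simp only: pderiv_power_linear(1)[OF smooth_mult[OF smooth_coord sm] smooth_scale[OF sm]]
          pderiv_power_linear(2)[OF sm sm])
    finally show ?thesis using False
      by (simp add: pderiv_power_coord_mult[OF sm] list_deriv_Cons)
  qed
qed (simp add: list_deriv_simps)

lemma multi_deriv_eq: "multi_deriv a f = list_deriv (sorted_list_of_set UNIV) a f"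
  by (simp add: multi_deriv_def list_deriv_def)

lemma smooth_multi_deriv: "smooth f \<Longrightarrow> smooth (multi_deriv a f)"
  by (simp add: multi_deriv_eq smooth_list_deriv)

lemma multi_deriv_pderiv: "smooth f \<Longrightarrow> multi_deriv a (pderiv_at i f)
    = pderiv_at i (multi_deriv a f)"
  by (simp add: multi_deriv_eq list_deriv_pderiv)

lemma multi_deriv_Suc: "smooth f \<Longrightarrow> multi_deriv (a(i := Suc (a i))) f
    = pderiv_at i (multi_deriv a f)"
  by (simp add: multi_deriv_eq list_deriv_Suc)

lemma multi_deriv_linear:
  assumes "smooth f" "smooth g"
  shows "multi_deriv a (f + g) = multi_deriv a f + multi_deriv a g"
    "multi_deriv a (c *\<^sub>R f) = c *\<^sub>R multi_deriv a f"
  using assms by (simp_all add: multi_deriv_eq list_deriv_linear)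

lemma multi_deriv_coord_mult:
  "smooth f \<Longrightarrow> multi_deriv a (coord j * f) = coord j * multi_deriv a f
      + real (a j) *\<^sub>R multi_deriv (a(j := a j - 1)) f"
  by (simp add: multi_deriv_eq list_deriv_coord_mult)

lemma multi_deriv_0: "multi_deriv (\<lambda>_. 0) f = f"
proof -
  have "list_deriv xs (\<lambda>_. 0) f = f" for xs by (induction xs) (simp_all add: list_deriv_simps)
  then show ?thesis by (simp add: multi_deriv_eq)
qed

lemma multi_deriv_const: "a \<noteq> (\<lambda>_. 0) \<Longrightarrow> multi_deriv a (\<lambda>x. c) = 0"
proof -
  assume "a \<noteq> (\<lambda>_. 0)"
  then obtain i where "a i \<noteq> 0" by auto
  then have "a = (a(i := a i - 1))(i := Suc ((a(i := a i - 1)) i))" by auto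
  then have "multi_deriv a (\<lambda>x. c) = multi_deriv (a(i := a i - 1)) (pderiv_at i (\<lambda>x. c))"
    using multi_deriv_Suc[OF smooth_const, of "a(i := a i - 1)" i]
        multi_deriv_pderiv[OF smooth_const, of "a(i := a i - 1)" i] by metis
  also have "\<dots> = multi_deriv (a(i := a i - 1)) (0 *\<^sub>R (\<lambda>x. c))"
    by (simp add: pderiv_const)
  also have "\<dots> = 0"
    by (subst multi_deriv_linear) (auto intro: smooth_const)
  finally show ?thesis .
qed

section \<open>Bidifferential operators and their polynomial forms\<close>

definition finsupp :: "'n::{finite,linorder} bipoly \<Rightarrow> bool" where
  "finsupp p \<longleftrightarrow> finite {(a, b). p a b \<noteq> 0}"

text \<open>
  The operator with constant coefficients \<open>p\<close>, evaluated at \<open>x\<close>. The value of a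
  bidifferential operator at \<open>x\<close> is of this form (\<open>bidiff_eq_pair\<close>), and the operators on
  polynomials translate: multiplication by \<open>\<alpha>\<^sub>i\<close> differentiates the first argument
  (\<open>pair_mult_alpha\<close>), while \<open>D\<^bsub>\<alpha>\<^sub>j\<^esub>\<close> is the commutator with multiplication of the first
  argument by \<open>x\<^sup>j\<close> (\<open>pair_coord\<close>).
\<close>

definition pair :: "'n::{finite,linorder} bipoly \<Rightarrow> 'n fn \<Rightarrow> 'n fn \<Rightarrow>
    (real, 'n) vec \<Rightarrow> real" where
  "pair p f g x = (\<Sum>(a, b) | p a b \<noteq> 0. p a b * multi_deriv a f x * multi_deriv b g x)"

lemma pair_eq:
  assumes "finite I" "\<And>a b. p a b \<noteq> 0 \<Longrightarrow> (a, b) \<in> I"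
  shows "pair p f g x = (\<Sum>(a, b)\<in>I. p a b * multi_deriv a f x * multi_deriv b g x)"
  unfolding pair_def using assms by (intro sum.mono_neutral_left) auto

lemma finsupp_add: "finsupp p \<Longrightarrow> finsupp q \<Longrightarrow> finsupp (p + q)"
  unfolding finsupp_def by (erule (1) finite_subset[OF _ finite_UnI, rotated]) auto

lemma finsupp_scale: "finsupp p \<Longrightarrow> finsupp (c *\<^sub>R p)"
  unfolding finsupp_def by (erule finite_subset[rotated]) auto

lemma finsupp_zero: "finsupp 0"
  by (simp add: finsupp_def)

lemma finsupp_sum: "(\<And>k. k \<in> K \<Longrightarrow> finsupp (F k))
    \<Longrightarrow> finsupp (\<Sum>k\<in>K. F k)"
  by (induction K rule: infinite_finite_induct) (auto intro: finsupp_add finsupp_zero)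

lemma finsupp_diff: "finsupp p \<Longrightarrow> finsupp q \<Longrightarrow> finsupp (p - q)"
  using finsupp_add[of p "(-1) *\<^sub>R q"] finsupp_scale[of q "-1"] by simp

lemma pair_add:
  assumes "finsupp p" "finsupp q"
  shows "pair (p + q) f g x = pair p f g x + pair q f g x"
proof -
  let ?I = "{(a, b). p a b \<noteq> 0} \<union> {(a, b). q a b \<noteq> 0}"
  have "finite ?I" using assms by (simp add: finsupp_def)
  then show ?thesis
    by (subst (1 2 3) pair_eq[of ?I])
       (auto simp: sum.distrib[symmetric] algebra_simps case_prod_beta intro!: sum.cong)
qed

lemma pair_scale: "finsupp p \<Longrightarrow> pair (c *\<^sub>R p) f g x = c * pair p f g x"
  by (subst (1 2) pair_eq[of "{(a, b). p a b \<noteq> 0}"])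
     (auto simp: finsupp_def sum_distrib_left algebra_simps intro!: sum.cong)

lemma pair_diff: "finsupp p \<Longrightarrow> finsupp q \<Longrightarrow> pair (p - q) f g x
    = pair p f g x - pair q f g x"
  using pair_add[of p "(-1) *\<^sub>R q"] pair_scale[of q "-1"] finsupp_scale[of q "-1"] by simp

lemma pair_zero: "pair 0 f g x = 0"
  by (simp add: pair_def)

lemma pair_sum: "(\<And>k. k \<in> K \<Longrightarrow> finsupp (F k))
    \<Longrightarrow> pair (\<Sum>k\<in>K. F k) f g x = (\<Sum>k\<in>K. pair (F k) f g x)"
  by (induction K rule: infinite_finite_induct) (simp_all add: pair_zero pair_add finsupp_sum)

lemma finsupp_D_alpha: "finsupp p \<Longrightarrow> finsupp (D_alpha j p)"
  unfolding finsupp_def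
  by (erule finite_subset[OF _ finite_imageI[of _ "\<lambda>(a, b). (a(j := a j - 1), b)"], rotated])
     (force simp: D_alpha_def image_iff)

lemma finsupp_mult_alpha: "finsupp p \<Longrightarrow> finsupp (mult_alpha i p)"
  unfolding finsupp_def
  by (erule finite_subset[OF _ finite_imageI[of _ "\<lambda>(a, b). (a(i := a i + 1), b)"], rotated])
     (force simp: mult_alpha_def image_iff split: if_splits)

lemma pair_mult_alpha:
  assumes p: "finsupp p" and f: "smooth f"
  shows "pair (mult_alpha i p) f g x = pair p (pderiv_at i f) g x"
proof -
  have "pair (mult_alpha i p) f g x =
     (\<Sum>(a, b) | p a b \<noteq> 0. p a b * multi_deriv (a(i := Suc (a i))) f x * multi_deriv b g x)"
    unfolding pair_def
    by (rule sum.reindex_bij_witness[where j = "\<lambda>(a, b). (a(i := a i - 1), b)" and i =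
        "\<lambda>(a, b). (a(i := Suc (a i)), b)"])
       (auto simp: mult_alpha_def split: if_splits)
  then show ?thesis unfolding pair_def
    by (simp only: multi_deriv_Suc[OF f] multi_deriv_pderiv[OF f])
qed

lemma pair_D_alpha:
  assumes p: "finsupp p"
  shows "pair (D_alpha j p) f g x =
     (\<Sum>(a, b) | p a b \<noteq> 0. p a b * (real (a j) * multi_deriv (a(j := a j - 1)) f
         x) * multi_deriv b g x)"
proof -
  have "(\<Sum>(a, b) | p a b \<noteq> 0. p a b * (real (a j) * multi_deriv (a(j := a j - 1)) f
      x) * multi_deriv b g x) =
    (\<Sum>(a, b) | p a b \<noteq> 0 \<and> a j \<noteq> 0. p a
        b * (real (a j) * multi_deriv (a(j := a j - 1)) f x) * multi_deriv b g x)"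
    using p by (intro sum.mono_neutral_right) (auto simp: finsupp_def)
  also have "\<dots> = pair (D_alpha j p) f g x"
    unfolding pair_def
    by (rule sum.reindex_bij_witness[where j = "\<lambda>(a, b). (a(j := a j - 1), b)" and i =
        "\<lambda>(a, b). (a(j := Suc (a j)), b)"])
       (auto simp: D_alpha_def)
  finally show ?thesis by simp
qed

lemma pair_coord:
  assumes p: "finsupp p" and f: "smooth f"
  shows "pair p (coord j * f) g x = x $ j * pair p f g x + pair (D_alpha j p) f g x"
  unfolding pair_D_alpha[OF p] unfolding pair_def sum_distrib_left multi_deriv_coord_mult[OF f]
  by (auto simp: sum.distrib[symmetric] coord_def case_prod_beta algebra_simps intro!: sum.cong)

lemma pair_fun_linear:
  assumes "smooth f" "smooth f'"
  shows "pair p (f + f') g x = pair p f g x + pair p f' g x"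
    "pair p (c *\<^sub>R f) g x = c * pair p f g x"
  unfolding pair_def multi_deriv_linear[OF assms]
  by (auto simp: sum.distrib[symmetric] sum_distrib_left case_prod_beta algebra_simps intro!: sum.cong)

lemma pair_fun_sum:
  assumes "\<And>k. k \<in> K \<Longrightarrow> smooth (F k)"
  shows "pair p (\<Sum>k\<in>K. F k) g x = (\<Sum>k\<in>K. pair p (F k) g x)"
  using assms
proof (induction K rule: infinite_finite_induct)
  case (insert k K)
  have "pair p (F k + sum F K) g x = pair p (F k) g x + pair p (sum F K) g x"
    using insert.prems by (intro pair_fun_linear(1) smooth_sum) auto
  moreover have "pair p (sum F K) g x = (\<Sum>k\<in>K. pair p (F k) g x)"
    by (rule insert.IH) (use insert.prems in auto)
  ultimately show "pair p (sum F (insert k K)) g x = (\<Sum>k\<in>insert k K. pair p (F k) g x)"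
    by (simp only: sum.insert[OF insert.hyps])
next
  have z: "pair p 0 g x = 0" using pair_fun_linear(2)[OF smooth_zero smooth_zero, of p 0] by simp
  { case (infinite K)
    show "pair p (sum F K) g x = (\<Sum>k\<in>K. pair p (F k) g x)"
        by (simp only: sum.infinite[OF infinite(1)] z) }
  { case empty
    show "pair p (sum F {}) g x = (\<Sum>k\<in>{}. pair p (F k) g x)" by (simp only: sum.empty z) }
qed

lemma pair_swap_args: "pair p f g x = pair (swap_args p) g f x"
  unfolding pair_def swap_args_def
  by (rule sum.reindex_bij_witness[where j = prod.swap and i = prod.swap]) auto

lemma finsupp_swap_args: "finsupp p \<Longrightarrow> finsupp (swap_args p)"
  unfolding finsupp_def swap_args_def
  by (erule finite_subset[OF _ finite_imageI[of _ prod.swap], rotated]) (force simp: image_iff)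

lemma finsupp_beta: "finsupp p \<Longrightarrow> finsupp (D_beta j p)" "finsupp p
    \<Longrightarrow> finsupp (mult_beta i p)"
  by (simp_all add: swap_args_weyl(3,4) finsupp_swap_args finsupp_D_alpha finsupp_mult_alpha)

lemmas finsupp_intros = finsupp_add finsupp_scale finsupp_zero finsupp_sum finsupp_diff finsupp_D_alpha
  finsupp_mult_alpha finsupp_beta

lemma pair_coord_right:
  "finsupp p \<Longrightarrow> smooth g \<Longrightarrow> pair p f (coord j * g) x
      = x $ j * pair p f g x + pair (D_beta j p) f g x"
  by (simp add: pair_swap_args[of _ f] swap_args_weyl pair_coord finsupp_swap_args swap_args_swap_args)

lemma pair_const:
  assumes p: "finsupp p" shows "pair p (\<lambda>x. 1) (\<lambda>x. 1) x
      = p (\<lambda>_. 0) (\<lambda>_. 0)"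
proof -
  have "pair p (\<lambda>x. 1) (\<lambda>x. 1) x
      = (\<Sum>(a, b)\<in>insert (\<lambda>_. 0, \<lambda>_. 0) {(a, b). p a b \<noteq> 0}.
     p a b * multi_deriv a (\<lambda>x. 1) x * multi_deriv b (\<lambda>x. 1) x)"
    using p by (intro pair_eq) (auto simp: finsupp_def)
  also have "\<dots> = (\<Sum>(a, b)\<in>{(\<lambda>_. 0, \<lambda>_. 0)}. p a b * multi_deriv a
      (\<lambda>x. 1) x * multi_deriv b (\<lambda>x. 1) x)"
  proof (intro sum.mono_neutral_right ballI)
    fix ab assume ab: "ab \<in> insert (\<lambda>_. 0, \<lambda>_. 0) {(a, b). p a b \<noteq> 0}
        - {(\<lambda>_. 0, \<lambda>_. 0)}"
    obtain a b where "ab = (a, b)" by (cases ab)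
    with ab have "a \<noteq> (\<lambda>_. 0) \<or> b \<noteq> (\<lambda>_. 0)" by auto
    then show "(case ab of (a, b) \<Rightarrow> p a b * multi_deriv a (\<lambda>x. 1) x * multi_deriv b
        (\<lambda>x. 1) x) = 0"
      using \<open>ab = (a, b)\<close> by (auto simp: multi_deriv_const)
  qed (use p in \<open>auto simp: finsupp_def\<close>)
  finally show ?thesis by (simp add: multi_deriv_0)
qed

text \<open>
  If the operator vanishes, so do its commutators with coordinate functions, that is, the
  operators of \<open>D\<^bsub>\<alpha>\<^sub>i\<^esub> p\<close> and \<open>D\<^bsub>\<beta>\<^sub>i\<^esub> p\<close>. Iterating reduces every coefficient to the constant one,
  which is seen by applying the operator to constants.
\<close>

lemma pair_nondegenerate:
  assumes "finsupp p" "\<And>f g. smooth f \<Longrightarrow> smooth g \<Longrightarrow> pair p f g x = 0"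
  shows "p = 0"
proof -
  have "p a b = 0" if "msize a + msize b = m" for a b m
    using assms that
  proof (induction m arbitrary: p a b)
    case 0
    then have "a = (\<lambda>_. 0)" "b = (\<lambda>_. 0)" by (auto simp: msize_def fun_eq_iff)
    then show ?case using pair_const[OF 0(1), of x] 0(2)[OF smooth_const smooth_const] by simp
  next
    case (Suc m)
    have "(\<exists>i. a i \<noteq> 0) \<or> (\<exists>i. b i \<noteq> 0)"
    proof (rule ccontr)
      assume "\<not> ?thesis"
      then show False using Suc.prems(3) by (simp add: msize_def)
    qed
    then consider i where "a i \<noteq> 0" | i where "b i \<noteq> 0" by blast
    then show ?case
    proof cases
      case 1
      have "D_alpha i p (a(i := a i - 1)) b = 0"
      proof (rule Suc.IH)
        show "pair (D_alpha i p) f g x = 0" if "smooth f" "smooth g" for f g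
          using pair_coord[OF Suc.prems(1) that(1), of i g x]
            Suc.prems(2)[OF smooth_mult[OF smooth_coord that(1)] that(2)] Suc.prems(2)[OF that] by simp
        show "msize (a(i := a i - 1)) + msize b = m"
          using msize_upd[of a i "a i - 1"] Suc.prems 1 by simp
      qed (use Suc.prems finsupp_D_alpha in blast)
      then show ?thesis using 1 by (simp add: D_alpha_def)
    next
      case 2
      have "D_beta i p a (b(i := b i - 1)) = 0"
      proof (rule Suc.IH)
        show "pair (D_beta i p) f g x = 0" if "smooth f" "smooth g" for f g
          using pair_coord_right[OF Suc.prems(1) that(2), of f i x]
            Suc.prems(2)[OF that(1) smooth_mult[OF smooth_coord that(2)]] Suc.prems(2)[OF that] by simp
        show "msize a + msize (b(i := b i - 1)) = m"
          using msize_upd[of b i "b i - 1"] Suc.prems 2 by simp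
      qed (use Suc.prems finsupp_beta in blast)
      then show ?thesis using 2 by (simp add: D_beta_def)
    qed
  qed
  then show ?thesis by (simp add: fun_eq_iff)
qed

definition slice :: "'n::{finite,linorder} symbol \<Rightarrow> (real, 'n) vec \<Rightarrow> 'n bipoly"
    where
  "slice A x = (\<lambda>a b. A a b x)"

lemma slice_linear: "slice (A + B) x = slice A x + slice B x" "slice (A - B) x = slice A x - slice B x"
  "slice (c *\<^sub>R A) x = c *\<^sub>R slice A x" "slice (sum F K) x
      = (\<Sum>k\<in>K. slice (F k) x)" "slice 0 x = 0"
  by (simp_all add: slice_def fun_eq_iff)

lemma slice_eqI: "(\<And>x. slice A x = slice B x) \<Longrightarrow> A = B"
  by (simp add: slice_def fun_eq_iff)

lemma symbols_smooth: "A \<in> symbols \<Longrightarrow> smooth (A a b)"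
  by (simp add: symbols_def)

lemma finsupp_slice: "A \<in> symbols \<Longrightarrow> finsupp (slice A x)"
proof -
  assume "A \<in> symbols"
  then have "finite {(a, b). A a b \<noteq> (\<lambda>x. 0)}" by (simp add: symbols_def)
  moreover have "{(a, b). slice A x a b \<noteq> 0} \<subseteq> {(a, b). A a b \<noteq> (\<lambda>x. 0)}"
    by (auto simp: slice_def)
  ultimately show ?thesis unfolding finsupp_def by (rule finite_subset[rotated])
qed

lemma symbols_zero: "0 \<in> symbols"
  by (simp add: symbols_def smooth_zero fun_eq_iff)

lemma symbolsI: "(\<And>a b. smooth (A a b)) \<Longrightarrow> finite I
    \<Longrightarrow> (\<And>a b. (a, b) \<notin> I \<Longrightarrow> A a b = 0) \<Longrightarrow> A
    \<in> symbols"
  unfolding symbols_def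
  by (auto simp: zero_fun_def intro!: finite_subset[of _ I])

lemma symbols_supp:
  assumes "A \<in> symbols"
  obtains I where "finite I" "\<And>a b. (a, b) \<notin> I \<Longrightarrow> A a b = 0"
proof (rule that[of "{(a, b). A a b \<noteq> (\<lambda>x. 0)}"])
  show "finite {(a, b). A a b \<noteq> (\<lambda>x. 0)}" using assms by (simp add: symbols_def)
  show "A a b = 0" if "(a, b) \<notin> {(a, b). A a b \<noteq> (\<lambda>x. 0)}" for a b
    using that by (simp add: zero_fun_eq)
qed

lemma symbols_add: "A \<in> symbols \<Longrightarrow> B \<in> symbols \<Longrightarrow> A + B \<in> symbols"
proof -
  assume A: "A \<in> symbols" and B: "B \<in> symbols"
  obtain I where I: "finite I" "\<And>a b. (a, b) \<notin> I \<Longrightarrow> A a b = 0"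
      using A symbols_supp by blast
  obtain J where J: "finite J" "\<And>a b. (a, b) \<notin> J \<Longrightarrow> B a b = 0"
      using B symbols_supp by blast
  show ?thesis
    by (rule symbolsI[of _ "I \<union> J"]) (use I J in \<open>auto intro!: smooth_add symbols_smooth[OF A] symbols_smooth[OF B]\<close>)
qed

lemma symbols_mult: "A \<in> symbols \<Longrightarrow> smooth h
    \<Longrightarrow> (\<lambda>a b. h * A a b) \<in> symbols"
proof -
  assume A: "A \<in> symbols" and h: "smooth h"
  obtain I where I: "finite I" "\<And>a b. (a, b) \<notin> I \<Longrightarrow> A a b = 0"
      using A symbols_supp by blast
  show ?thesis
    by (rule symbolsI[of _ I]) (use I in \<open>auto intro!: smooth_mult symbols_smooth[OF A] h\<close>)
qed

lemma symbols_scale: "A \<in> symbols \<Longrightarrow> c *\<^sub>R A \<in> symbols"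
proof -
  assume A: "A \<in> symbols"
  obtain I where I: "finite I" "\<And>a b. (a, b) \<notin> I \<Longrightarrow> A a b = 0"
      using A symbols_supp by blast
  show ?thesis
    by (rule symbolsI[of _ I]) (use I in \<open>auto intro!: smooth_scale symbols_smooth[OF A]\<close>)
qed

lemma subspace_symbols: "subspace symbols"
  by (simp add: subspace_def symbols_zero symbols_add symbols_scale)

lemmas symbols_diff = subspace_diff[OF subspace_symbols]
lemmas symbols_sum = subspace_sum[OF subspace_symbols]

lemma bidiff_eq_pair:
  assumes A: "A \<in> symbols" and "smooth f" "smooth g"
  shows "bidiff A f g = (\<lambda>x. pair (slice A x) f g x)"
proof
  fix x
  have "finite {(a, b). A a b \<noteq> (\<lambda>x. 0)}" using A by (simp add: symbols_def)
  then have "pair (slice A x) f g x = (\<Sum>(a, b) | A a b \<noteq> (\<lambda>x. 0). slice A x a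
      b * multi_deriv a f x * multi_deriv b g x)"
    by (rule pair_eq) (auto simp: slice_def)
  then show "bidiff A f g x = pair (slice A x) f g x"
    using assms by (simp add: bidiff_def slice_def)
qed

lemma bidiff_not_smooth: "\<not> (smooth f \<and> smooth g) \<Longrightarrow> bidiff A f g
    = (\<lambda>x. 0)"
  by (auto simp: bidiff_def)

lemma bidiff_inj:
  assumes A: "A \<in> symbols" and B: "B \<in> symbols" and eq: "bidiff A = bidiff B"
  shows "A = B"
proof (rule slice_eqI)
  fix x
  have "slice A x - slice B x = 0"
  proof (rule pair_nondegenerate)
    show "finsupp (slice A x - slice B x)" using A B finsupp_slice finsupp_diff by blast
    show "pair (slice A x - slice B x) f g x = 0" if "smooth f" "smooth g" for f g
      using fun_cong[OF fun_cong[OF fun_cong[OF eq]], of f g x] A B that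
      by (simp add: pair_diff finsupp_slice bidiff_eq_pair)
  qed
  then show "slice A x = slice B x" by simp
qed

lemma polynomial_form_bidiff: "A \<in> symbols \<Longrightarrow> polynomial_form (bidiff A) = A"
  unfolding polynomial_form_def by (rule the_equality) (auto intro: bidiff_inj)

lemma bidiff_add: "A \<in> symbols \<Longrightarrow> B \<in> symbols \<Longrightarrow> bidiff (A + B)
    = bidiff A + bidiff B"
proof (intro ext)
  fix f g x assume "A \<in> symbols" "B \<in> symbols"
  then show "bidiff (A + B) f g x = (bidiff A + bidiff B) f g x"
    by (cases "smooth f \<and> smooth g")
      (simp_all add: bidiff_eq_pair symbols_add slice_linear pair_add finsupp_slice bidiff_not_smooth)
qed

lemma bidiff_scale: "A \<in> symbols \<Longrightarrow> bidiff (c *\<^sub>R A) = c *\<^sub>R bidiff A"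
proof (intro ext)
  fix f g x assume "A \<in> symbols"
  then show "bidiff (c *\<^sub>R A) f g x = (c *\<^sub>R bidiff A) f g x"
    by (cases "smooth f \<and> smooth g")
      (simp_all add: bidiff_eq_pair symbols_scale slice_linear pair_scale finsupp_slice bidiff_not_smooth)
qed

lemma bidiff_zero: "bidiff 0 = 0"
  using bidiff_scale[OF symbols_zero, of 0] by simp

lemma bidiff_sum: "(\<And>k. k \<in> K \<Longrightarrow> F k \<in> symbols)
    \<Longrightarrow> bidiff (\<Sum>k\<in>K. F k) = (\<Sum>k\<in>K. bidiff (F k))"
proof (induction K rule: infinite_finite_induct)
  case (insert k K)
  have "bidiff (F k + sum F K) = bidiff (F k) + bidiff (sum F K)"
    using insert.prems by (intro bidiff_add symbols_sum) auto
  moreover have "bidiff (sum F K) = (\<Sum>k\<in>K. bidiff (F k))"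
    by (rule insert.IH) (use insert.prems in auto)
  ultimately show "bidiff (sum F (insert k K)) = (\<Sum>k\<in>insert k K. bidiff (F k))"
    by (simp only: sum.insert[OF insert.hyps])
next
  case (infinite K)
  show "bidiff (sum F K) = (\<Sum>k\<in>K. bidiff (F k))"
      by (simp only: sum.infinite[OF infinite(1)] bidiff_zero)
next
  case empty
  show "bidiff (sum F {}) = (\<Sum>k\<in>{}. bidiff (F k))" by (simp only: sum.empty bidiff_zero)
qed

definition pd :: "'n \<Rightarrow> 'n::{finite,linorder} symbol \<Rightarrow> 'n symbol" where
  "pd i A = (\<lambda>a b. pderiv_at i (A a b))"

definition ptw :: "('n::{finite,linorder} bipoly \<Rightarrow> 'n bipoly) \<Rightarrow> 'n symbol
    \<Rightarrow> 'n symbol" where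
  "ptw F A = (\<lambda>a b x. F (slice A x) a b)"

lemma slice_ptw: "slice (ptw F A) x = F (slice A x)"
  by (simp add: slice_def ptw_def)

lemma pderiv_zero: "pderiv_at i 0 = 0"
  using pderiv_const[of i 0] by (simp add: zero_fun_def)

lemma symbols_pd: "A \<in> symbols \<Longrightarrow> pd i A \<in> symbols"
proof -
  assume A: "A \<in> symbols"
  obtain I where I: "finite I" "\<And>a b. (a, b) \<notin> I \<Longrightarrow> A a b = 0"
      using A symbols_supp by blast
  show ?thesis
    by (rule symbolsI[of _ I]) (use I in \<open>auto simp: pd_def pderiv_zero intro!: smooth_pderiv symbols_smooth[OF A]\<close>)
qed

lemma pd_linear:
  "A \<in> symbols \<Longrightarrow> B \<in> symbols \<Longrightarrow> pd i (A + B) = pd i A + pd i B"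
  "A \<in> symbols \<Longrightarrow> pd i (c *\<^sub>R A) = c *\<^sub>R pd i A"
  by (intro ext, simp add: pd_def pderiv_add_smooth pderiv_scale_smooth symbols_smooth)+

lemma pd_commute: "A \<in> symbols \<Longrightarrow> pd i (pd j A) = pd j (pd i A)"
  by (intro ext) (simp add: pd_def pderiv_commute[of _ i j] symbols_smooth)

lemma pd_sum: "(\<And>k. k \<in> K \<Longrightarrow> F k \<in> symbols)
    \<Longrightarrow> pd i (\<Sum>k\<in>K. F k) = (\<Sum>k\<in>K. pd i (F k))"
  by (intro ext) (simp add: pd_def pderiv_sum_smooth symbols_smooth)

lemma pd_mult: "A \<in> symbols \<Longrightarrow> smooth h \<Longrightarrow>
   pd i (\<lambda>a b. h * A a b) = (\<lambda>a b. pderiv_at i h * A a b) + (\<lambda>a b. h * pd i A a b)"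
  by (intro ext) (simp add: pd_def pderiv_mult_smooth symbols_smooth)

text \<open>
  Operators on polynomials that, applied at each point, preserve symbols and commute with
  the differentiation of coefficients. All operators with constant coefficients built from
  the variables and their derivatives qualify; the closure lemmas below spare the
  verification for each of them.
\<close>

definition const_op :: "('n::{finite,linorder} bipoly \<Rightarrow> 'n bipoly) \<Rightarrow> bool" where
  "const_op F \<longleftrightarrow> linear F \<and>
      (\<forall>A\<in>symbols. ptw F A \<in> symbols \<and> (\<forall>i. pd i (ptw F A) = ptw F (pd i A)))"

lemma const_opD:
  assumes "const_op F"
  shows "linear F" "A \<in> symbols \<Longrightarrow> ptw F A \<in> symbols" "A \<in> symbols
      \<Longrightarrow> pd i (ptw F A) = ptw F (pd i A)"
  using assms by (auto simp: const_op_def)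

lemma const_op_mult_alpha: "const_op (mult_alpha i)"
proof -
  have eq: "ptw (mult_alpha i) A a b = (if a i = 0 then 0 else A (a(i := a i - 1)) b)" for A ::
      "'a symbol" and a b
    by (auto simp: fun_eq_iff ptw_def mult_alpha_def slice_def)
  have "ptw (mult_alpha i) A \<in> symbols" if A: "A \<in> symbols" for A
  proof -
    obtain I where I: "finite I" "\<And>a b. (a, b) \<notin> I \<Longrightarrow> A a b = 0"
        using A symbols_supp by blast
    show ?thesis
    proof (rule symbolsI[of _ "(\<lambda>(a, b). (a(i := a i + 1), b)) ` I"])
      fix a b assume ab: "(a, b) \<notin> (\<lambda>(a, b). (a(i := a i + 1), b)) ` I"
      show "ptw (mult_alpha i) A a b = 0"
      proof (cases "a i = 0")
        case False
        then have "(a, b) = (\<lambda>(a, b). (a(i := a i + 1), b)) (a(i := a i - 1), b)" by auto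
        with ab have "(a(i := a i - 1), b) \<notin> I" by blast
        then show ?thesis using I eq by simp
      qed (simp add: eq)
    qed (use I in \<open>auto simp: eq intro!: smooth_zero symbols_smooth[OF A]\<close>)
  qed
  moreover have "pd j (ptw (mult_alpha i) A) = ptw (mult_alpha i) (pd j A)" for A j
    by (intro ext) (simp add: pd_def eq pderiv_zero)
  ultimately show ?thesis by (simp add: const_op_def linear_mult_alpha)
qed

lemma const_op_D_alpha: "const_op (D_alpha i)"
proof -
  have eq: "ptw (D_alpha i) A a b = real (a i + 1) *\<^sub>R A (a(i := a i + 1)) b" for A ::
      "'a symbol" and a b
    by (auto simp: fun_eq_iff ptw_def D_alpha_def slice_def)
  have "ptw (D_alpha i) A \<in> symbols" if A: "A \<in> symbols" for A
  proof -
    obtain I where I: "finite I" "\<And>a b. (a, b) \<notin> I \<Longrightarrow> A a b = 0"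
        using A symbols_supp by blast
    show ?thesis
    proof (rule symbolsI[of _ "(\<lambda>(a, b). (a(i := a i - 1), b)) ` I"])
      fix a b assume ab: "(a, b) \<notin> (\<lambda>(a, b). (a(i := a i - 1), b)) ` I"
      have "(a, b) = (\<lambda>(a, b). (a(i := a i - 1), b)) (a(i := a i + 1), b)" by auto
      with ab have "(a(i := a i + 1), b) \<notin> I" by blast
      then show "ptw (D_alpha i) A a b = 0" using I eq by simp
    qed (use I in \<open>auto simp only: eq intro!: smooth_scale symbols_smooth[OF A]\<close>)
  qed
  moreover have "pd j (ptw (D_alpha i) A) = ptw (D_alpha i) (pd j A)" if "A \<in> symbols" for A j
    by (intro ext) (simp only: pd_def eq pderiv_scale_smooth[OF symbols_smooth[OF that]])
  ultimately show ?thesis by (simp add: const_op_def linear_D_alpha)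
qed

definition swap_symbol :: "'n::{finite,linorder} symbol \<Rightarrow> 'n symbol" where
  "swap_symbol A = (\<lambda>a b. A b a)"

lemma symbols_swap: "A \<in> symbols \<Longrightarrow> swap_symbol A \<in> symbols"
proof -
  assume A: "A \<in> symbols"
  obtain I where I: "finite I" "\<And>a b. (a, b) \<notin> I \<Longrightarrow> A a b = 0"
      using A symbols_supp by blast
  show ?thesis
    by (rule symbolsI[of _ "prod.swap ` I"]) (use I symbols_smooth[OF A] in \<open>force simp: swap_symbol_def\<close>)+
qed

lemma const_op_swap:
  assumes "const_op F" shows "const_op (\<lambda>p. swap_args (F (swap_args p)))"
proof -
  have eq: "ptw (\<lambda>p. swap_args (F (swap_args p))) A = swap_symbol (ptw F (swap_symbol A))" for A
    by (simp add: ptw_def swap_args_def swap_symbol_def slice_def)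
  have lin: "linear (\<lambda>p. swap_args (F (swap_args p)))"
    using linear_compose[OF linear_compose[OF linear_swap_args const_opD(1)[OF assms]] linear_swap_args]
    by (simp add: o_def)
  have pds: "pd i (swap_symbol A) = swap_symbol (pd i A)" for i and A :: "'a symbol"
    by (simp add: pd_def swap_symbol_def)
  show ?thesis using assms lin by (simp add: const_op_def eq symbols_swap pds)
qed

lemma const_op_mult_beta: "const_op (mult_beta i)" and const_op_D_beta: "const_op (D_beta i)"
  using const_op_swap[OF const_op_mult_alpha[of i]] const_op_swap[OF const_op_D_alpha[of i]]
  by (simp_all add: swap_args_weyl(3,4)[symmetric])

lemma const_op_id: "const_op (\<lambda>p. p)"
  by (simp add: const_op_def ptw_def slice_def pd_def linear_id[unfolded id_def])

lemma const_op_comp: "const_op F \<Longrightarrow> const_op G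
    \<Longrightarrow> const_op (\<lambda>p. F (G p))"
proof -
  assume F: "const_op F" and G: "const_op G"
  have eq: "ptw (\<lambda>p. F (G p)) A = ptw F (ptw G A)" for A
    by (rule slice_eqI) (simp add: slice_ptw)
  show ?thesis using linear_compose[OF const_opD(1)[OF G] const_opD(1)[OF F]] F G
    by (simp add: const_op_def eq o_def)
qed

lemma const_op_add: "const_op F \<Longrightarrow> const_op G
    \<Longrightarrow> const_op (\<lambda>p. F p + G p)"
proof -
  assume F: "const_op F" and G: "const_op G"
  have eq: "ptw (\<lambda>p. F p + G p) A = ptw F A + ptw G A" for A
    by (rule slice_eqI) (simp only: slice_ptw slice_linear)
  show ?thesis using linear_compose_add[OF const_opD(1)[OF F] const_opD(1)[OF G]] F G
    by (simp add: const_op_def eq symbols_add pd_linear)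
qed

lemma const_op_scale: "const_op F \<Longrightarrow> const_op (\<lambda>p. c *\<^sub>R F p)"
proof -
  assume F: "const_op F"
  have eq: "ptw (\<lambda>p. c *\<^sub>R F p) A = c *\<^sub>R ptw F A" for A
    by (rule slice_eqI) (simp only: slice_ptw slice_linear)
  show ?thesis using linear_compose_scale_right[OF const_opD(1)[OF F]] F
    by (simp add: const_op_def eq symbols_scale pd_linear)
qed

lemma const_op_minus: "const_op F \<Longrightarrow> const_op (\<lambda>p. - F p)"
  using const_op_scale[of F "-1"] by simp

lemma const_op_diff: "const_op F \<Longrightarrow> const_op G
    \<Longrightarrow> const_op (\<lambda>p. F p - G p)"
  using const_op_add[OF _ const_op_minus, of F G] by simp

lemma const_op_sum: "finite K \<Longrightarrow> (\<And>k. k \<in> K \<Longrightarrow> const_op (F k))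
    \<Longrightarrow> const_op (\<lambda>p. \<Sum>k\<in>K. F k p)"
proof (induction K rule: finite_induct)
  case empty
  show ?case using const_op_scale[OF const_op_id, of 0] by (simp only: scaleR_zero_left sum.empty)
next
  case (insert k K)
  have "const_op (\<lambda>p. F k p + (\<Sum>k\<in>K. F k p))"
    by (rule const_op_add[OF insert.prems insert.IH]) (use insert.prems in auto)
  then show "const_op (\<lambda>p. \<Sum>k\<in>insert k K. F k p)"
    by (simp only: sum.insert[OF insert.hyps])
qed

lemmas const_op_intros = const_op_id const_op_mult_alpha const_op_D_alpha const_op_mult_beta const_op_D_beta
  const_op_add const_op_scale const_op_minus const_op_diff const_op_sum[OF finite]

lemma const_op_gl:
  "const_op (gl_unit i j)" "const_op euler_alpha" "const_op euler_beta" "const_op capelli"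
  "const_op euler_total" "const_op (corr w1 w2 j)" "const_op (casimir_symbol \<delta>)"
proof -
  show g: "const_op (gl_unit i j)" and a: "const_op euler_alpha" and b: "const_op euler_beta" and c:
      "const_op capelli"
    unfolding gl_unit_eq[abs_def] euler_alpha_def[abs_def] euler_beta_def[abs_def] capelli_def[abs_def]
    by (intro const_op_intros const_op_comp[OF const_op_mult_alpha] const_op_comp[OF const_op_mult_beta]
    const_op_comp[OF const_op_D_alpha] const_op_comp[OF const_op_D_beta])+
  show t: "const_op euler_total" unfolding euler_total_def[abs_def] by (intro const_op_add a b)
  show "const_op (corr w1 w2 j)" unfolding corr_def[abs_def]
    by (intro const_op_diff const_op_minus const_op_add const_op_scale const_op_comp[OF a]
        const_op_comp[OF b] const_op_D_alpha const_op_D_beta)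
  show "const_op (casimir_symbol \<delta>)" unfolding casimir_symbol_def[abs_def] Let_def
    by (intro const_op_diff const_op_add const_op_scale const_op_comp[OF t] t c const_op_id)
qed

section \<open>Lie derivatives along projective fields\<close>

definition proj_field :: "(real, 'n) vec \<Rightarrow> ((real, 'n) vec, 'n) vec \<Rightarrow>
    (real, 'n) vec \<Rightarrow> 'n::{finite,linorder} vfield" where
  "proj_field u M v = (\<lambda>x.
     (\<Sum>i\<in>UNIV. u $ i *\<^sub>R axis i 1)
     + (\<Sum>i\<in>UNIV. \<Sum>j\<in>UNIV. M $ i $ j *\<^sub>R (x $ j *\<^sub>R axis i 1))
     + (\<Sum>j\<in>UNIV. v $ j *\<^sub>R (x $ j *\<^sub>R (\<Sum>i\<in>UNIV. x $ i *\<^sub>R axis i 1))))"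

lemma sl_proj_iff: "X \<in> sl_proj \<longleftrightarrow> (\<exists>u M v. X = proj_field u M v)"
  by (simp add: sl_proj_def proj_field_def)

lemma sum_axis_nth: "(\<Sum>i\<in>UNIV. c i * (axis i 1 :: (real, 'n::finite) vec) $ k) = c k"
  by (simp add: axis_def if_distrib[of "\<lambda>y. _ * y"] cong: if_cong)

lemma proj_field_nth:
  "proj_field u M v x $ i = u $ i + (\<Sum>j\<in>UNIV. M $ i $ j * x $ j)
      + (\<Sum>j\<in>UNIV. v $ j * x $ j) * x $ i"
proof -
  have 1: "(\<Sum>k\<in>UNIV. \<Sum>j\<in>UNIV. M $ k $ j * (x $ j * (axis k 1 :: (real, 'a) vec) $ i))
      = (\<Sum>j\<in>UNIV. M $ i $ j * x $ j)"
    by (simp add: sum_axis_nth flip: mult.assoc sum_distrib_right)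
  show ?thesis
    by (simp add: proj_field_def 1 sum_axis_nth sum_distrib_right mult.assoc)
qed

lemma proj_field_component:
  "(\<lambda>y. proj_field u M v y $ i) = (\<lambda>x. u $ i)
      + (\<Sum>j\<in>UNIV. (M $ i $ j) *\<^sub>R coord j)
      + (\<Sum>j\<in>UNIV. v $ j *\<^sub>R coord j) * coord i"
  by (rule ext) (simp add: proj_field_nth coord_def)

text \<open>
  The entry \<open>\<partial>\<^sub>j X\<^sup>i\<close> of the Jacobian matrix.
\<close>

definition jac :: "((real, 'n) vec, 'n) vec \<Rightarrow> (real, 'n) vec \<Rightarrow>
    (real, 'n::{finite,linorder}) vec \<Rightarrow> 'n \<Rightarrow> 'n \<Rightarrow> real" where
  "jac M v x i j = M $ i $ j + v $ j * x $ i + of_bool (j = i) * (\<Sum>k\<in>UNIV. v $ k * x $ k)"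

lemma pderiv_proj_field: "pderiv_at j (\<lambda>y. proj_field u M v y $ i) = (\<lambda>x. jac M v x i j)"
  unfolding proj_field_component
proof (rule ext)
  fix x
  have s: "smooth (\<Sum>j\<in>UNIV. c j *\<^sub>R coord j :: 'a fn)" for c
    by (intro smooth_sum smooth_scale smooth_coord)
  have d: "pderiv_at j (\<Sum>j\<in>UNIV. c j *\<^sub>R coord j :: 'a fn) = (\<lambda>x. c j)" for c
    by (rule ext) (simp add: pderiv_sum_smooth smooth_scale smooth_coord pderiv_scale_smooth pderiv_coord)
  show "pderiv_at j ((\<lambda>x. u $ i) + (\<Sum>j\<in>UNIV. (M $ i $ j) *\<^sub>R coord j)
      + (\<Sum>j\<in>UNIV. v $ j *\<^sub>R coord j) * coord i) x = jac M v x i j"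
    by (simp add: pderiv_add_smooth pderiv_mult_smooth smooth_const s smooth_coord smooth_add
        smooth_mult d pderiv_const pderiv_coord jac_def)
       (simp add: coord_def)
qed

lemma smooth_proj_field: "smooth (\<lambda>y. proj_field u M v y $ i)"
  unfolding proj_field_component
  by (intro smooth_add smooth_const smooth_mult smooth_coord smooth_sum smooth_scale)

lemma diverg_proj_field:
  "diverg (proj_field u M v) x = (\<Sum>i\<in>UNIV. M $ i $ i)
      + (real CARD('n) + 1) * (\<Sum>k\<in>UNIV. v $ k * x $ k)"
  for x :: "(real, 'n::{finite,linorder}) vec"
  by (simp add: diverg_def pderiv_proj_field jac_def sum.distrib algebra_simps)

lemma lie_dens_proj:
  fixes f :: "'n::{finite,linorder} fn"
  shows "lie_dens w (proj_field u M v) f =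
    (\<Sum>i\<in>UNIV. u $ i *\<^sub>R pderiv_at i f)
        + (\<Sum>i\<in>UNIV. \<Sum>j\<in>UNIV. (M $ i $ j) *\<^sub>R (coord j * pderiv_at i f))
    + (\<Sum>i\<in>UNIV. \<Sum>j\<in>UNIV. v $ j *\<^sub>R (coord j * (coord i * pderiv_at i f)))
    + (w * (\<Sum>i\<in>UNIV. M $ i $ i)) *\<^sub>R f
        + (\<Sum>j\<in>UNIV. (w * (real CARD('n) + 1) * v $ j) *\<^sub>R (coord j * f))"
  by (rule ext) (simp add: lie_dens_def proj_field_nth diverg_proj_field coord_def sum.distrib
      sum_distrib_left
      sum_distrib_right algebra_simps)

lemma smooth_lie_dens: "smooth f \<Longrightarrow> smooth (lie_dens w (proj_field u M v) f)"
  unfolding lie_dens_proj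
  by (intro smooth_add smooth_mult smooth_coord smooth_sum smooth_scale smooth_pderiv)

text \<open>
  Leibniz rule: moving the coefficients of the field, of degree at most two, out of the
  operator costs their first derivatives, combined with \<open>D\<^bsub>\<alpha>\<^sub>j\<^esub>\<close>, and for the quadratic part
  their second derivatives, combined with \<open>D\<^bsub>\<alpha>\<^sub>i\<^esub> D\<^bsub>\<alpha>\<^sub>j\<^esub>\<close>. The latter, and the derivative of the
  divergence, are the sum with coefficients \<open>v\<close>.
\<close>

lemma pair_lie_dens:
  fixes p :: "'n::{finite,linorder} bipoly"
  assumes p: "finsupp p" and f: "smooth f"
  shows "pair p (lie_dens w (proj_field u M v) f) g x =
    (\<Sum>i\<in>UNIV. proj_field u M v x $ i * pair p (pderiv_at i f) g x)
    + pair (\<Sum>i\<in>UNIV. \<Sum>j\<in>UNIV. jac M v x i j *\<^sub>R mult_alpha i (D_alpha j p)) f g x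
    + pair (\<Sum>j\<in>UNIV. v $ j *\<^sub>R (euler_alpha (D_alpha j p)
        + ((real CARD('n) + 1) * w) *\<^sub>R D_alpha j p)) f g x
    + w * diverg (proj_field u M v) x * pair p f g x"
proof -
  \<comment> \<open>opaque abbreviations reduce the rest to linear algebra in the values \<open>P\<close>, \<open>P1\<close>, \<open>P2\<close>\<close>
  define P where "P h = pair p h g x" for h
  define P1 where "P1 j h = pair (D_alpha j p) h g x" for j h
  define P2 where "P2 i j h = pair (D_alpha i (D_alpha j p)) h g x" for i j h
  note sm = smooth_add smooth_mult smooth_coord smooth_sum smooth_scale smooth_pderiv f
  note fs = finsupp_intros p
  have c1: "P (coord j * h) = x $ j * P h + P1 j h" if "smooth h" for j h
    unfolding P_def P1_def using pair_coord[OF p that] .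
  have c2: "P1 j (coord i * h) = x $ i * P1 j h + P2 i j h" if "smooth h" for i j h
    unfolding P1_def P2_def using pair_coord[OF finsupp_D_alpha[OF p] that] .
  have L: "P (lie_dens w (proj_field u M v) f) =
    (\<Sum>i\<in>UNIV. u $ i * P (pderiv_at i f))
        + (\<Sum>i\<in>UNIV. \<Sum>j\<in>UNIV. (M $ i $ j) * P (coord j * pderiv_at i f))
    + (\<Sum>i\<in>UNIV. \<Sum>j\<in>UNIV. v $ j * P (coord j * (coord i * pderiv_at i f)))
    + (w * (\<Sum>i\<in>UNIV. M $ i $ i)) * P f
        + (\<Sum>j\<in>UNIV. (w * (real CARD('n) + 1) * v $ j) * P (coord j * f))"
    unfolding lie_dens_proj P_def
    by (simp add: pair_fun_linear(1) pair_fun_sum pair_fun_linear(2)[OF _ smooth_zero] sm)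
  have e1: "pair (\<Sum>i\<in>UNIV. \<Sum>j\<in>UNIV. jac M v x i j *\<^sub>R mult_alpha i
      (D_alpha j p)) f g x =
     (\<Sum>i\<in>UNIV. \<Sum>j\<in>UNIV. jac M v x i j * P1 j (pderiv_at i f))"
    unfolding P1_def by (simp add: pair_sum pair_scale pair_mult_alpha fs f)
  have e2: "pair (\<Sum>j\<in>UNIV. v $ j *\<^sub>R (euler_alpha (D_alpha j p)
      + ((real CARD('n) + 1) * w) *\<^sub>R D_alpha j p)) f g x =
     (\<Sum>j\<in>UNIV. v $ j * ((\<Sum>i\<in>UNIV. P2 i j (pderiv_at i f))
         + ((real CARD('n) + 1) * w) * P1 j f))"
    unfolding P1_def P2_def euler_alpha_def by (simp add: pair_sum pair_scale pair_add pair_mult_alpha fs f)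
  define s where "s = (\<Sum>k\<in>UNIV. v $ k * x $ k)"
  have s: "(\<Sum>j\<in>UNIV. v $ j * (x $ j * c + d j)) = s * c + (\<Sum>j\<in>UNIV. v $ j * d j)" for c d
    by (simp add: s_def sum.distrib sum_distrib_right distrib_left mult.assoc)
  have T1: "(\<Sum>i\<in>UNIV. \<Sum>j\<in>UNIV. (M $ i $ j) * P (coord j * pderiv_at i f)) =
    (\<Sum>i\<in>UNIV. (\<Sum>j\<in>UNIV. M $ i $ j * x $ j) * P (pderiv_at i f))
        + (\<Sum>i\<in>UNIV. \<Sum>j\<in>UNIV. M $ i $ j * P1 j (pderiv_at i f))"
    by (simp add: c1 sm distrib_left sum.distrib sum_distrib_right mult.assoc)
  have "P (coord j * (coord i * h)) = x $ j * (x $ i * P h + P1 i h) + (x $ i * P1 j h + P2 i j h)" if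
      "smooth h" for i j h
    by (simp add: c1 c2 that smooth_mult smooth_coord)
  then have T2: "(\<Sum>i\<in>UNIV. \<Sum>j\<in>UNIV. v $ j * P (coord j * (coord i * pderiv_at i f))) =
    (\<Sum>i\<in>UNIV. s * (x $ i * P (pderiv_at i f) + P1 i (pderiv_at i f)) +
      (\<Sum>j\<in>UNIV. v $ j * (x $ i * P1 j (pderiv_at i f) + P2 i j (pderiv_at i f))))"
    by (simp only: s smooth_pderiv[OF f])
  have T3: "(\<Sum>j\<in>UNIV. (w * (real CARD('n) + 1) * v $ j) * P (coord j * f)) =
     w * (real CARD('n) + 1) * (s * P f + (\<Sum>j\<in>UNIV. v $ j * P1 j f))"
    unfolding s[symmetric] by (simp only: c1[OF f] sum_distrib_left mult.assoc)
  have J: "(\<Sum>i\<in>UNIV. \<Sum>j\<in>UNIV. jac M v x i j * P1 j (pderiv_at i f)) =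
     (\<Sum>i\<in>UNIV. \<Sum>j\<in>UNIV. M $ i $ j * P1 j (pderiv_at i f))
         + (\<Sum>i\<in>UNIV. \<Sum>j\<in>UNIV. v $ j * (x $ i * P1 j (pderiv_at i f)))
     + (\<Sum>i\<in>UNIV. s * P1 i (pderiv_at i f))"
    by (simp add: jac_def s_def[symmetric] distrib_right sum.distrib mult.assoc)
  have X: "(\<Sum>i\<in>UNIV. proj_field u M v x $ i * P (pderiv_at i f))
      = (\<Sum>i\<in>UNIV. u $ i * P (pderiv_at i f))
    + (\<Sum>i\<in>UNIV. (\<Sum>j\<in>UNIV. M $ i $ j * x $ j) * P (pderiv_at i f))
        + (\<Sum>i\<in>UNIV. s * (x $ i * P (pderiv_at i f)))"
    by (simp add: proj_field_nth s_def[symmetric] distrib_right sum.distrib mult.assoc)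
  have swap: "(\<Sum>i\<in>UNIV. \<Sum>j\<in>UNIV. v $ j * P2 i j (pderiv_at i f))
      = (\<Sum>j\<in>UNIV. v $ j * (\<Sum>i\<in>UNIV. P2 i j (pderiv_at i f)))"
    unfolding sum_distrib_left by (rule sum.swap)
  show ?thesis unfolding P_def[symmetric] L e1 e2 T1 T2 T3 J X diverg_proj_field s_def[symmetric]
    by (simp add: distrib_left sum.distrib swap)
       (simp add: sum_distrib_left algebra_simps)
qed

lemma pair_lie_dens_right:
  fixes p :: "'n::{finite,linorder} bipoly"
  assumes p: "finsupp p" and g: "smooth g"
  shows "pair p f (lie_dens w (proj_field u M v) g) x =
    (\<Sum>i\<in>UNIV. proj_field u M v x $ i * pair p f (pderiv_at i g) x)
    + pair (\<Sum>i\<in>UNIV. \<Sum>j\<in>UNIV. jac M v x i j *\<^sub>R mult_beta i (D_beta j p)) f g x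
    + pair (\<Sum>j\<in>UNIV. v $ j *\<^sub>R (euler_beta (D_beta j p)
        + ((real CARD('n) + 1) * w) *\<^sub>R D_beta j p)) f g x
    + w * diverg (proj_field u M v) x * pair p f g x"
proof -
  show ?thesis
    unfolding pair_swap_args[of _ f] pair_lie_dens[OF finsupp_swap_args[OF p] g]
    by (simp add: swap_args_linear swap_args_weyl(1,2) swap_args_euler_polar)
qed

lemma pderiv_bidiff:
  assumes A: "A \<in> symbols" and f: "smooth f" and g: "smooth g"
  shows "pderiv_at i (bidiff A f g) x = pair (slice (pd i A) x) f g x
    + pair (slice A x) (pderiv_at i f) g x + pair (slice A x) f (pderiv_at i g) x"
proof -
  obtain I where I: "finite I" "\<And>a b. (a, b) \<notin> I \<Longrightarrow> A a b = 0"
      using A symbols_supp by blast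
  have I1: "(a, b) \<in> I" if "slice A x a b \<noteq> 0" for a b x
    using that by (rule_tac ccontr) (simp add: slice_def I(2))
  have I2: "(a, b) \<in> I" if "slice (pd i A) x a b \<noteq> 0" for a b
    using that by (rule_tac ccontr) (simp add: slice_def pd_def pderiv_zero I(2))
  let ?F = "\<lambda>ab. A (fst ab) (snd ab) * multi_deriv (fst ab) f * multi_deriv (snd ab) g"
  have "bidiff A f g = (\<Sum>ab\<in>I. ?F ab)"
    unfolding bidiff_eq_pair[OF A f g]
    by (rule ext) (subst pair_eq[OF I(1)], erule I1, simp add: slice_def case_prod_beta)
  then have "pderiv_at i (bidiff A f g) = (\<Sum>ab\<in>I. pderiv_at i (?F ab))"
    using symbols_smooth[OF A] smooth_multi_deriv[OF f] smooth_multi_deriv[OF g]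
    by (simp add: pderiv_sum_smooth smooth_mult)
  then have "pderiv_at i (bidiff A f g) x = (\<Sum>ab\<in>I. pderiv_at i (?F ab) x)" by simp
  also have "\<dots> = (\<Sum>ab\<in>I. slice (pd i A) x (fst ab) (snd ab) * multi_deriv (fst ab) f
      x * multi_deriv (snd ab) g x)
    + (\<Sum>ab\<in>I. slice A x (fst ab) (snd ab) * multi_deriv (fst ab) (pderiv_at i f)
        x * multi_deriv (snd ab) g x)
    + (\<Sum>ab\<in>I. slice A x (fst ab) (snd ab) * multi_deriv (fst ab) f x * multi_deriv (snd ab)
        (pderiv_at i g) x)"
    using symbols_smooth[OF A] smooth_multi_deriv[OF f] smooth_multi_deriv[OF g]
    by (simp add: pderiv_mult_smooth smooth_mult sum.distrib[symmetric] multi_deriv_pderiv f g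
        slice_def pd_def algebra_simps)
  finally show ?thesis
    by (simp add: pair_eq[OF I(1) I1] pair_eq[OF I(1) I2] case_prod_beta)
qed

lemma slice_mult: "slice (\<lambda>a b. h * A a b) x = h x *\<^sub>R slice A x"
  by (simp add: slice_def fun_eq_iff)

lemma slice_lie_symbol:
  "slice (lie_symbol \<delta> (proj_field u M v) A) x =
     (\<Sum>i\<in>UNIV. proj_field u M v x $ i *\<^sub>R slice (pd i A) x)
     - (\<Sum>i\<in>UNIV. \<Sum>j\<in>UNIV. jac M v x i j *\<^sub>R gl_unit i j (slice A x))
     + (\<delta> * diverg (proj_field u M v) x) *\<^sub>R slice A x"
  by (intro ext) (simp add: slice_def lie_symbol_def pd_def pderiv_proj_field)

lemma smooth_jac: "smooth (\<lambda>x. jac M v x i j)"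
  using smooth_pderiv[OF smooth_proj_field, of j "0" M v i] unfolding pderiv_proj_field .

lemma smooth_diverg: "smooth (diverg (proj_field u M v))"
proof -
  have "diverg (proj_field u M v) = (\<Sum>i\<in>UNIV. (\<lambda>x. jac M v x i i))"
    by (rule ext) (simp add: diverg_def pderiv_proj_field)
  then show ?thesis by (simp only:) (intro smooth_sum smooth_jac)
qed

lemma lie_symbol_eq:
  "lie_symbol \<delta> (proj_field u M v) A =
     (\<Sum>i\<in>UNIV. (\<lambda>a b. (\<lambda>x. proj_field u M v x $ i) * pd i A a b))
     - (\<Sum>i\<in>UNIV. \<Sum>j\<in>UNIV. (\<lambda>a b. (\<lambda>x. jac M v x i j) * ptw
         (gl_unit i j) A a b))
     + \<delta> *\<^sub>R (\<lambda>a b. diverg (proj_field u M v) * A a b)"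
  by (rule slice_eqI) (simp only: slice_lie_symbol slice_linear slice_mult slice_ptw scaleR_scaleR)

lemma symbols_lie_symbol: "A \<in> symbols \<Longrightarrow> lie_symbol \<delta> (proj_field u M v) A
    \<in> symbols"
  unfolding lie_symbol_eq
  by (intro symbols_add symbols_diff symbols_sum symbols_scale symbols_mult symbols_pd smooth_jac
      smooth_diverg smooth_proj_field const_opD(2) const_op_gl)

text \<open>
  The Lie derivative of operators, transported to polynomial forms. It depends on the field
  only, but writing the parameters of the field as arguments gives access to the quadratic
  part \<open>v\<close>.
\<close>

definition lie_form :: "real \<Rightarrow> real \<Rightarrow> real \<Rightarrow> (real, 'n) vec
    \<Rightarrow> ((real, 'n) vec, 'n) vec \<Rightarrow> (real, 'n) vec \<Rightarrow>
    'n::{finite,linorder} symbol \<Rightarrow> 'n symbol" where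
  "lie_form w1 w2 \<delta> u M v A = lie_symbol \<delta> (proj_field u M v) A
      + (\<Sum>j\<in>UNIV. v $ j *\<^sub>R ptw (corr w1 w2 j) A)"

lemma symbols_lie_form: "A \<in> symbols \<Longrightarrow> lie_form w1 w2 \<delta> u M v A \<in> symbols"
  unfolding lie_form_def
  by (intro symbols_add symbols_lie_symbol symbols_sum symbols_scale const_opD(2) const_op_gl)

lemma slice_lie_form:
  "slice (lie_form w1 w2 \<delta> u M v A) x =
     (\<Sum>i\<in>UNIV. proj_field u M v x $ i *\<^sub>R slice (pd i A) x)
     - (\<Sum>i\<in>UNIV. \<Sum>j\<in>UNIV. jac M v x i j *\<^sub>R gl_unit i j (slice A x))
     + (\<delta> * diverg (proj_field u M v) x) *\<^sub>R slice A x
     + (\<Sum>j\<in>UNIV. v $ j *\<^sub>R corr w1 w2 j (slice A x))"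
  unfolding lie_form_def by (simp only: slice_linear slice_lie_symbol slice_ptw)

text \<open>
  Differentiating the value of the operator gives terms in which a derivative falls on one
  of the arguments; they cancel against the transport terms of the arguments by
  \<open>pair_lie_dens\<close>. What is left is the Lie derivative of the symbol and the corrections.
\<close>

lemma lie_op_bidiff:
  fixes A :: "'n::{finite,linorder} symbol"
  assumes A: "A \<in> symbols"
  shows "lie_op w1 w2 \<mu> (proj_field u M v) (bidiff A)
      = bidiff (lie_form w1 w2 (\<mu> - w1 - w2) u M v A)"
proof (intro ext)
  fix f g x
  show "lie_op w1 w2 \<mu> (proj_field u M v) (bidiff A) f g x
      = bidiff (lie_form w1 w2 (\<mu> - w1 - w2) u M v A) f g x"
  proof (cases "smooth f \<and> smooth g")
    case False
    then show ?thesis by (auto simp: lie_op_def bidiff_def)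
  next
    case True
    then have f: "smooth f" and g: "smooth g" by auto
    let ?X = "proj_field u M v" and ?p = "slice A x"
    have p: "finsupp ?p" using finsupp_slice[OF A] .
    have pd: "finsupp (slice (pd i A) x)" for i using finsupp_slice[OF symbols_pd[OF A]] .
    have ga: "finsupp (gl_unit i j ?p)" for i j
      unfolding gl_unit_eq by (intro finsupp_intros p)
    define SA where "SA = (\<Sum>i\<in>UNIV. \<Sum>j\<in>UNIV. jac M v x i j *\<^sub>R mult_alpha i
        (D_alpha j ?p))"
    define SB where "SB = (\<Sum>i\<in>UNIV. \<Sum>j\<in>UNIV. jac M v x i j *\<^sub>R mult_beta i
        (D_beta j ?p))"
    define CA where "CA = (\<Sum>j\<in>UNIV. v $ j *\<^sub>R (euler_alpha (D_alpha j ?p)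
        + ((real CARD('n) + 1) * w1) *\<^sub>R D_alpha j ?p))"
    define CB where "CB = (\<Sum>j\<in>UNIV. v $ j *\<^sub>R (euler_beta (D_beta j ?p)
        + ((real CARD('n) + 1) * w2) *\<^sub>R D_beta j ?p))"
    have fin: "finsupp SA" "finsupp SB" "finsupp CA" "finsupp CB"
      unfolding SA_def SB_def CA_def CB_def euler_alpha_def euler_beta_def
      by (intro finsupp_intros p)+
    have S: "(\<Sum>i\<in>UNIV. \<Sum>j\<in>UNIV. jac M v x i j *\<^sub>R gl_unit i j ?p) = SA + SB"
      by (simp add: SA_def SB_def gl_unit_eq scaleR_add_right sum.distrib)
    have C: "(\<Sum>j\<in>UNIV. v $ j *\<^sub>R corr w1 w2 j ?p) = - CA - CB"
      unfolding CA_def CB_def corr_def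
      by (simp only: scaleR_diff_right scaleR_minus_right sum_subtractf sum_negf)
    have D: "lie_dens \<mu> ?X (bidiff A f g) x
        = (\<Sum>i\<in>UNIV. ?X x $ i * (pair (slice (pd i A) x) f g x
        + pair ?p (pderiv_at i f) g x + pair ?p f (pderiv_at i g) x))
            + \<mu> * diverg ?X x * bidiff A f g x"
      unfolding lie_dens_def by (simp only: pderiv_bidiff[OF A f g])
    have LO: "lie_op w1 w2 \<mu> ?X (bidiff A) f g x = lie_dens \<mu> ?X (bidiff A f g) x
        - bidiff A (lie_dens w1 ?X f) g x - bidiff A f (lie_dens w2 ?X g) x"
      using f g by (simp add: lie_op_def)
    have "lie_op w1 w2 \<mu> ?X (bidiff A) f g x =
       (\<Sum>i\<in>UNIV. ?X x $ i * pair (slice (pd i A) x) f g x)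
       + (\<mu> - w1 - w2) * diverg ?X x * pair ?p f g x - pair SA f g x - pair CA f g x
           - pair SB f g x - pair CB f g x"
      unfolding LO D using f g
      by (simp add: bidiff_eq_pair[OF A] smooth_lie_dens
         pair_lie_dens[OF p] pair_lie_dens_right[OF p] SA_def[symmetric] SB_def[symmetric]
             CA_def[symmetric] CB_def[symmetric])
         (simp add: sum.distrib algebra_simps)
    moreover have "pair (slice (lie_form w1 w2 (\<mu> - w1 - w2) u M v A) x) f g x =
       (\<Sum>i\<in>UNIV. ?X x $ i * pair (slice (pd i A) x) f g x)
       + (\<mu> - w1 - w2) * diverg ?X x * pair ?p f g x - pair SA f g x - pair CA f g x
           - pair SB f g x - pair CB f g x"
    proof -
      have e: "slice (lie_form w1 w2 (\<mu> - w1 - w2) u M v A) x =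
        (\<Sum>i\<in>UNIV. ?X x $ i *\<^sub>R slice (pd i A) x) - SA - SB
            + ((\<mu> - w1 - w2) * diverg ?X x) *\<^sub>R ?p - CA - CB"
        unfolding slice_lie_form S C by (simp add: algebra_simps)
      show ?thesis unfolding e
        by (simp add: pair_add pair_diff pair_scale pair_sum fin p pd finsupp_intros)
    qed
    ultimately show ?thesis
      using f g by (simp add: bidiff_eq_pair[OF symbols_lie_form[OF A]])
  qed
qed

section \<open>The Casimir operator on polynomial forms\<close>

lemma pderiv_jac:
  "pderiv_at k (\<lambda>x. jac M v x i j) = (\<lambda>x. of_bool (i = k) * v $ j
      + of_bool (j = i) * v $ k)"
proof -
  have eq: "(\<lambda>x. jac M v x i j) = (\<lambda>x. M $ i $ j) + v $ j *\<^sub>R coord i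
      + of_bool (j = i) *\<^sub>R (\<Sum>k\<in>UNIV. v $ k *\<^sub>R coord k)"
    by (rule ext) (simp add: jac_def coord_def)
  have s: "smooth (\<Sum>k\<in>UNIV. v $ k *\<^sub>R coord k :: 'a fn)"
    by (intro smooth_sum smooth_scale smooth_coord)
  have d: "pderiv_at k (\<Sum>j\<in>UNIV. v $ j *\<^sub>R coord j :: 'a fn) = (\<lambda>x. v $ k)"
    by (rule ext) (simp add: pderiv_sum_smooth smooth_scale smooth_coord pderiv_scale_smooth pderiv_coord)
  show ?thesis unfolding eq
    by (rule ext) (auto simp: pderiv_add_smooth pderiv_scale_smooth smooth_const s smooth_coord
        smooth_add smooth_scale d pderiv_const pderiv_coord)
qed

lemma pderiv_diverg: "pderiv_at k (diverg (proj_field u M v))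
    = (\<lambda>x::(real, 'n::{finite,linorder}) vec. (real CARD('n) + 1) * v $ k)"
proof -
  have "diverg (proj_field u M v) = (\<Sum>i\<in>UNIV. (\<lambda>x. jac M v x i i))"
    by (rule ext) (simp add: diverg_def pderiv_proj_field)
  then show ?thesis
    by (simp add: pderiv_sum_smooth smooth_jac pderiv_jac) (rule ext, simp add: sum.distrib algebra_simps)
qed

lemma slice_pd_mult:
  "A \<in> symbols \<Longrightarrow> smooth h \<Longrightarrow>
   slice (pd k (\<lambda>a b. h * A a b)) x = pderiv_at k h x *\<^sub>R slice A x
       + h x *\<^sub>R slice (pd k A) x"
  by (simp only: pd_mult slice_linear slice_mult)

lemma slice_pd_ptw: "A \<in> symbols \<Longrightarrow> const_op F
    \<Longrightarrow> slice (pd k (ptw F A)) x = F (slice (pd k A) x)"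
  by (simp only: const_opD(3) slice_ptw)

lemma pd_diff: "A \<in> symbols \<Longrightarrow> B \<in> symbols \<Longrightarrow> pd i (A - B)
    = pd i A - pd i B"
  using pd_linear(1)[of A "(-1) *\<^sub>R B" i] pd_linear(2)[of B i "-1"] symbols_scale[of B "-1"] by simp

text \<open>
  The commutator of \<open>\<partial>\<^sub>k\<close> with the Lie derivative is the Lie derivative along the linear
  field \<open>\<partial>\<^sub>k X\<close>, whose Jacobian matrix is constant and linear in \<open>v\<close>.
\<close>

lemma slice_pd_lie_form:
  fixes A :: "'n::{finite,linorder} symbol"
  assumes A: "A \<in> symbols"
  shows "slice (pd k (lie_form w1 w2 \<delta> u M v A)) x =
     (\<Sum>i\<in>UNIV. jac M v x i k *\<^sub>R slice (pd i A) x)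
         + (\<Sum>i\<in>UNIV. proj_field u M v x $ i *\<^sub>R slice (pd k (pd i A)) x)
     - (\<Sum>j\<in>UNIV. v $ j *\<^sub>R gl_unit k j (slice A x)) - v $ k *\<^sub>R euler_total (slice A x)
     - (\<Sum>i\<in>UNIV. \<Sum>j\<in>UNIV. jac M v x i j *\<^sub>R gl_unit i j (slice (pd k A) x))
     + (\<delta> * ((real CARD('n) + 1) * v $ k)) *\<^sub>R slice A x
         + (\<delta> * diverg (proj_field u M v) x) *\<^sub>R slice (pd k A) x
     + (\<Sum>j\<in>UNIV. v $ j *\<^sub>R corr w1 w2 j (slice (pd k A) x))"
proof -
  have X: "pderiv_at k (\<lambda>x. proj_field u M v x $ i) = (\<lambda>x. jac M v x i k)" for i
    by (rule pderiv_proj_field)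
  have H: "(\<Sum>i\<in>UNIV. \<Sum>j\<in>UNIV.
      (of_bool (i = k) * v $ j + of_bool (j = i) * v $ k) *\<^sub>R gl_unit i j p) =
     (\<Sum>j\<in>UNIV. v $ j *\<^sub>R gl_unit k j p) + v $ k *\<^sub>R euler_total p" for p
    by (simp add: scaleR_add_left sum.distrib sum_gl_unit_diag[symmetric] scaleR_sum_right
       flip: scaleR_scaleR)
  have t1: "pd k (\<Sum>i\<in>UNIV. (\<lambda>a b. (\<lambda>x. proj_field u M v x $ i) * pd i A a b))
      = (\<Sum>i\<in>UNIV. pd k (\<lambda>a b. (\<lambda>x. proj_field u M v x $ i) * pd i A a b))"
    by (intro pd_sum symbols_mult symbols_pd smooth_proj_field A)
  have t2: "pd k (\<Sum>i\<in>UNIV. \<Sum>j\<in>UNIV.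
      (\<lambda>a b. (\<lambda>x. jac M v x i j) * ptw (gl_unit i j) A a b)) =
     (\<Sum>i\<in>UNIV. \<Sum>j\<in>UNIV. pd k
         (\<lambda>a b. (\<lambda>x. jac M v x i j) * ptw (gl_unit i j) A a b))"
    by (subst pd_sum; (intro sum.cong refl pd_sum symbols_sum symbols_mult smooth_jac const_opD(2)
        const_op_gl A))+
  have t3: "pd k (\<Sum>j\<in>UNIV. v $ j *\<^sub>R ptw (corr w1 w2 j) A)
      = (\<Sum>j\<in>UNIV. v $ j *\<^sub>R pd k (ptw (corr w1 w2 j) A))"
    by (subst pd_sum; (intro sum.cong refl pd_linear(2) symbols_scale const_opD(2) const_op_gl A))+
  note mem = symbols_add symbols_diff symbols_sum symbols_scale symbols_mult symbols_pd smooth_jac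
      smooth_diverg smooth_proj_field const_opD(2) const_op_gl A
  have "pd k (lie_form w1 w2 \<delta> u M v A) =
     (\<Sum>i\<in>UNIV. pd k (\<lambda>a b. (\<lambda>x. proj_field u M v x $ i) * pd i A a b))
     - (\<Sum>i\<in>UNIV. \<Sum>j\<in>UNIV. pd k
         (\<lambda>a b. (\<lambda>x. jac M v x i j) * ptw (gl_unit i j) A a b))
     + \<delta> *\<^sub>R pd k (\<lambda>a b. diverg (proj_field u M v) * A a b)
     + (\<Sum>j\<in>UNIV. v $ j *\<^sub>R pd k (ptw (corr w1 w2 j) A))"
    unfolding lie_form_def lie_symbol_eq t1[symmetric] t2[symmetric] t3[symmetric]
    by (subst pd_linear(1) pd_diff pd_linear(2); (intro mem)?)+ (rule refl)
  then show ?thesis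
    by (simp only: slice_linear slice_pd_mult[OF symbols_pd[OF A] smooth_proj_field]
       slice_pd_mult[OF const_opD(2)[OF const_op_gl(1) A] smooth_jac]
       slice_pd_mult[OF A smooth_diverg] slice_pd_ptw[OF A const_op_gl(1)] slice_pd_ptw[OF A const_op_gl(6)]
       X pderiv_jac pderiv_diverg slice_ptw sum.distrib H scaleR_add_right scaleR_scaleR)
      (simp add: algebra_simps)
qed

text \<open>
  The Casimir operator, transported to polynomial forms (\<open>casimir_op_bidiff\<close>).
\<close>

definition casimir_form :: "real \<Rightarrow> real \<Rightarrow> real \<Rightarrow>
    'n::{finite,linorder} symbol \<Rightarrow> 'n symbol" where
  "casimir_form w1 w2 \<delta> A = ptw (casimir_symbol \<delta>) A
      - 2 *\<^sub>R (\<Sum>k\<in>UNIV. ptw (corr w1 w2 k) (pd k A))"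

lemma symbols_casimir_form: "A \<in> symbols \<Longrightarrow> casimir_form w1 w2 \<delta> A \<in> symbols"
  unfolding casimir_form_def
  by (intro symbols_diff symbols_scale symbols_sum const_opD(2) const_op_gl symbols_pd)

lemma slice_casimir_form:
  "slice (casimir_form w1 w2 \<delta> A) x = casimir_symbol \<delta> (slice A x)
      - 2 *\<^sub>R (\<Sum>k\<in>UNIV. corr w1 w2 k (slice (pd k A) x))"
  by (simp only: casimir_form_def slice_linear slice_ptw)

lemma slice_pd_casimir_form:
  assumes A: "A \<in> symbols"
  shows "slice (pd i (casimir_form w1 w2 \<delta> A)) x = casimir_symbol \<delta> (slice (pd i A) x)
     - 2 *\<^sub>R (\<Sum>k\<in>UNIV. corr w1 w2 k (slice (pd i (pd k A)) x))"
proof -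
  have m: "ptw (corr w1 w2 k) (pd k A) \<in> symbols" for k
    by (intro const_opD(2) const_op_gl symbols_pd A)
  have "pd i (casimir_form w1 w2 \<delta> A) = pd i (ptw (casimir_symbol \<delta>) A)
      - 2 *\<^sub>R (\<Sum>k\<in>UNIV. pd i (ptw (corr w1 w2 k) (pd k A)))"
    unfolding casimir_form_def
    using A m by (simp add: pd_diff pd_linear(2) pd_sum symbols_scale symbols_sum const_opD(2)
        const_op_gl(7))
  then show ?thesis
    by (simp only: slice_linear slice_pd_ptw[OF A const_op_gl(7)]
        slice_pd_ptw[OF symbols_pd[OF A] const_op_gl(6)])
qed

lemmas casimir_symbol_linear = linear_add[OF linear_casimir_symbol] linear_diff[OF linear_casimir_symbol]
  linear_scale[OF linear_casimir_symbol] linear_sum[OF linear_casimir_symbol]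

text \<open>
  Casimir elements are central; here it is checked by comparing both sides at a point, as
  expressions in the values of the symbol and of its first and second derivatives. The terms
  without \<open>v\<close> match because \<open>casimir_symbol\<close> commutes with gl(n) and the family \<open>corr\<close> is
  gl(n)-covariant. The terms with \<open>v\<close> match because of \<open>casimir_symbol_corr\<close> and
  \<open>corr_commute\<close>.
\<close>

theorem casimir_form_lie_form:
  fixes A :: "'n::{finite,linorder} symbol"
  assumes A: "A \<in> symbols"
  shows "casimir_form w1 w2 \<delta> (lie_form w1 w2 \<delta> u M v A)
      = lie_form w1 w2 \<delta> u M v (casimir_form w1 w2 \<delta> A)"
proof (rule slice_eqI)
  fix x
  let ?p = "slice A x" and ?p1 = "\<lambda>i. slice (pd i A) x" and ?p2 =
      "\<lambda>i j. slice (pd i (pd j A)) x"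
  let ?C = "corr w1 w2" and ?X = "proj_field u M v" and ?G = "casimir_symbol \<delta>" and ?J = "jac M v x"
  have p2: "?p2 i j = ?p2 j i" for i j using pd_commute[OF A, of i j] by simp
  \<comment> \<open>reorderings of double and triple sums; \<open>s2\<close> uses the symmetry of second derivatives,
      \<open>s3\<close> the covariance of \<open>corr\<close>, and \<open>s6\<close> its commutativity\<close>
  have s1: "(\<Sum>k\<in>UNIV. \<Sum>i\<in>UNIV. ?J i k *\<^sub>R ?C k (?p1 i))
      = (\<Sum>k\<in>UNIV. \<Sum>j\<in>UNIV. ?J k j *\<^sub>R ?C j (?p1 k))"
    by (rule sum.swap)
  have s2: "(\<Sum>k\<in>UNIV. \<Sum>i\<in>UNIV. ?X x $ i *\<^sub>R ?C k (?p2 k i))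
      = (\<Sum>i\<in>UNIV. \<Sum>k\<in>UNIV. ?X x $ i *\<^sub>R ?C k (?p2 i k))"
    unfolding p2 by (subst sum.swap) (simp add: p2)
  have s3: "(\<Sum>k\<in>UNIV. \<Sum>i\<in>UNIV. \<Sum>j\<in>UNIV. ?J i j *\<^sub>R ?C k
      (gl_unit i j (?p1 k))) =
     (\<Sum>k\<in>UNIV. \<Sum>i\<in>UNIV. \<Sum>j\<in>UNIV. ?J i j *\<^sub>R gl_unit i j
         (?C k (?p1 k))) + (\<Sum>k\<in>UNIV. \<Sum>j\<in>UNIV. ?J k j *\<^sub>R ?C j (?p1 k))"
  proof -
    have "(\<Sum>i\<in>UNIV. \<Sum>j\<in>UNIV. ?J i j *\<^sub>R of_bool (i = k) *\<^sub>R ?C j (?p1 k))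
        = (\<Sum>j\<in>UNIV. ?J k j *\<^sub>R ?C j (?p1 k))" for k
      by (simp only: scaleR_left_commute[of _ "of_bool _"] sum_sum_delta_scaleR)
    then show ?thesis by (simp add: corr_gl_unit scaleR_add_right sum.distrib)
  qed
  have s4: "(\<Sum>k\<in>UNIV. \<Sum>i\<in>UNIV. \<Sum>j\<in>UNIV. ?J i j *\<^sub>R gl_unit i j
      (?C k (?p1 k))) =
     (\<Sum>i\<in>UNIV. \<Sum>j\<in>UNIV. \<Sum>k\<in>UNIV. ?J i j *\<^sub>R gl_unit i j (?C k (?p1 k)))"
    by (subst sum.swap, rule sum.cong[OF refl], rule sum.swap)
  have s5: "(\<Sum>k\<in>UNIV. \<Sum>j\<in>UNIV. v $ j *\<^sub>R ?C k (gl_unit k j ?p))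
      = (\<Sum>j\<in>UNIV. \<Sum>k\<in>UNIV. v $ j *\<^sub>R ?C k (gl_unit k j ?p))"
    by (rule sum.swap)
  have s6: "(\<Sum>k\<in>UNIV. \<Sum>j\<in>UNIV. v $ j *\<^sub>R ?C k (?C j (?p1 k)))
      = (\<Sum>j\<in>UNIV. \<Sum>k\<in>UNIV. v $ j *\<^sub>R ?C j (?C k (?p1 k)))"
    by (subst sum.swap) (simp add: corr_commute[of w1 w2])
  have L: "slice (casimir_form w1 w2 \<delta> (lie_form w1 w2 \<delta> u M v A)) x =
    (\<Sum>i\<in>UNIV. ?X x $ i *\<^sub>R ?G (?p1 i))
        - (\<Sum>i\<in>UNIV. \<Sum>j\<in>UNIV. ?J i j *\<^sub>R gl_unit i j (?G ?p))
    + (\<delta> * diverg ?X x) *\<^sub>R ?G ?p + (\<Sum>j\<in>UNIV. v $ j *\<^sub>R ?G (?C j ?p))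
    - 2 *\<^sub>R ((\<Sum>k\<in>UNIV. \<Sum>i\<in>UNIV. ?J i k *\<^sub>R ?C k (?p1 i))
        + (\<Sum>k\<in>UNIV. \<Sum>i\<in>UNIV. ?X x $ i *\<^sub>R ?C k (?p2 k i))
     - (\<Sum>k\<in>UNIV. \<Sum>j\<in>UNIV. v $ j *\<^sub>R ?C k (gl_unit k j ?p))
         - (\<Sum>k\<in>UNIV. v $ k *\<^sub>R ?C k (euler_total ?p))
     - (\<Sum>k\<in>UNIV. \<Sum>i\<in>UNIV. \<Sum>j\<in>UNIV. ?J i j *\<^sub>R ?C k (gl_unit i j (?p1 k)))
     + (\<Sum>k\<in>UNIV. (\<delta> * ((real CARD('n) + 1) * v $ k)) *\<^sub>R ?C k ?p)
         + (\<Sum>k\<in>UNIV. (\<delta> * diverg ?X x) *\<^sub>R ?C k (?p1 k))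
     + (\<Sum>k\<in>UNIV. \<Sum>j\<in>UNIV. v $ j *\<^sub>R ?C k (?C j (?p1 k))))"
    unfolding slice_casimir_form slice_pd_lie_form[OF A] slice_lie_form casimir_symbol_linear corr_linear
      gl_unit_commute_casimir[symmetric] sum.distrib sum_subtractf ..
  have G: "(\<Sum>j\<in>UNIV. v $ j *\<^sub>R ?G (?C j ?p))
      = (\<Sum>j\<in>UNIV. v $ j *\<^sub>R ?C j (?G ?p))
     - 2 *\<^sub>R (\<Sum>j\<in>UNIV. \<Sum>k\<in>UNIV. v $ j *\<^sub>R ?C k (gl_unit k j ?p))
         - 2 *\<^sub>R (\<Sum>k\<in>UNIV. v $ k *\<^sub>R ?C k (euler_total ?p))
     + 2 *\<^sub>R (\<Sum>k\<in>UNIV. (\<delta> * ((real CARD('n) + 1) * v $ k)) *\<^sub>R ?C k ?p)"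
    by (simp add: casimir_symbol_corr sum.distrib sum_subtractf scaleR_sum_right scaleR_add_right
        scaleR_diff_right mult_ac)
  have R: "slice (lie_form w1 w2 \<delta> u M v (casimir_form w1 w2 \<delta> A)) x =
    (\<Sum>i\<in>UNIV. ?X x $ i *\<^sub>R ?G (?p1 i))
        - 2 *\<^sub>R (\<Sum>i\<in>UNIV. \<Sum>k\<in>UNIV. ?X x $ i *\<^sub>R ?C k (?p2 i k))
    - (\<Sum>i\<in>UNIV. \<Sum>j\<in>UNIV. ?J i j *\<^sub>R gl_unit i j (?G ?p))
        + 2 *\<^sub>R (\<Sum>i\<in>UNIV. \<Sum>j\<in>UNIV. \<Sum>k\<in>UNIV. ?J i j *\<^sub>R gl_unit i
        j (?C k (?p1 k)))
    + (\<delta> * diverg ?X x) *\<^sub>R ?G ?p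
        - 2 *\<^sub>R (\<Sum>k\<in>UNIV. (\<delta> * diverg ?X x) *\<^sub>R ?C k (?p1 k))
    + (\<Sum>j\<in>UNIV. v $ j *\<^sub>R ?C j (?G ?p))
        - 2 *\<^sub>R (\<Sum>j\<in>UNIV. \<Sum>k\<in>UNIV. v $ j *\<^sub>R ?C j (?C k (?p1 k)))"
    unfolding slice_lie_form slice_casimir_form slice_pd_casimir_form[OF A]
    by (simp add: gl_linear corr_linear scaleR_diff_right sum_subtractf scaleR_sum_right mult_ac)
  show "slice (casimir_form w1 w2 \<delta> (lie_form w1 w2 \<delta> u M v A)) x
      = slice (lie_form w1 w2 \<delta> u M v (casimir_form w1 w2 \<delta> A)) x"
    unfolding L R G s1 s2 s3 s4[symmetric] s5 s6
    by (simp add: algebra_simps)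
qed

lemma proj_field_eqI:
  "(\<And>x i. X x $ i = u $ i + (\<Sum>j\<in>UNIV. M $ i $ j * x $ j)
      + (\<Sum>j\<in>UNIV. v $ j * x $ j) * x $ i) \<Longrightarrow> X = proj_field u M v"
  by (rule ext) (simp add: vec_eq_iff proj_field_nth)

lemma sum_scale_axis: "(\<Sum>k\<in>UNIV. x $ k *\<^sub>R axis k 1) = (x :: (real, 'n::finite) vec)"
  by (simp add: vec_eq_iff sum_axis_nth)

definition unit_matrix :: "'n \<Rightarrow> 'n \<Rightarrow> ((real, 'n::finite) vec, 'n) vec" where
  "unit_matrix i j = (\<chi> k l. of_bool (k = i \<and> l = j))"

lemma unit_matrix_nth: "unit_matrix i j $ k $ l = of_bool (k = i) * of_bool (l = j)"
  by (simp add: unit_matrix_def of_bool_conj)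

lemma delta_sums:
  fixes c :: "'n::finite \<Rightarrow> real"
  shows "(\<Sum>l\<in>UNIV. of_bool (l = j) * c l) = c j" "(\<Sum>l\<in>UNIV. of_bool (j = l) * c l) = c j"
  using sum_delta_scaleR[of j c] by (simp_all only: real_scaleR_def)

lemma e_mat_eq: "i \<noteq> j \<Longrightarrow> e_mat i j = proj_field 0 (- unit_matrix i j) 0"
  by (rule proj_field_eqI)
    (simp add: e_mat_def unit_matrix_nth mult.assoc sum_negf delta_sums axis_def flip: sum_distrib_left)

lemma e_mat_diag_eq: "e_mat i i = proj_field 0 (- unit_matrix i i - mat 1) 0"
  unfolding e_mat_def sum_scale_axis
  by (rule proj_field_eqI)
    (simp add: unit_matrix_nth sum_subtractf left_diff_distrib mat_def mult.assoc sum_negf delta_sums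
        axis_def
       if_distrib[of "\<lambda>y. y * _"] cong: if_cong flip: sum_distrib_left)

lemma e_mat_dual_eq: "e_mat_dual i j = proj_field 0 (- unit_matrix j i) 0"
  by (cases "i = j", rule proj_field_eqI)
    (simp_all add: e_mat_dual_def e_mat_eq unit_matrix_nth mult.assoc sum_negf delta_sums axis_def
        flip: sum_distrib_left)

lemma e_vec_eq: "e_vec i = proj_field (- axis i 1) 0 0"
  by (rule proj_field_eqI) (simp add: e_vec_def)

lemma eps_eq: "eps i = proj_field 0 0 (axis i 1)"
  unfolding eps_def sum_scale_axis
  by (rule proj_field_eqI)
    (simp add: axis_def if_distrib[of "\<lambda>y. y * _"] cong: if_cong)

text \<open>
  The Lie derivative along \<open>- x\<^sup>j \<partial>\<^sub>i\<close>, also for \<open>i = j\<close>. The basis field \<open>e\<^bsub>ii\<^esub>\<close> differs from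
  this one by the sum of all diagonal fields, see \<open>e_mat_diag_form\<close>.
\<close>

definition mat_form :: "real \<Rightarrow> real \<Rightarrow> real \<Rightarrow> 'n \<Rightarrow> 'n
    \<Rightarrow> 'n::{finite,linorder} symbol \<Rightarrow> 'n symbol" where
  "mat_form w1 w2 \<delta> i j = lie_form w1 w2 \<delta> 0 (- unit_matrix i j) 0"

lemma unit_matrix_sum:
  fixes F :: "'n::finite \<Rightarrow> 'n \<Rightarrow> 'v::real_vector"
  shows "(\<Sum>k\<in>UNIV. \<Sum>l\<in>UNIV. (unit_matrix i j $ k $ l) *\<^sub>R F k l) = F i j"
  by (simp add: unit_matrix_nth flip: scaleR_scaleR scaleR_sum_right)

lemma jac_linear: "jac M 0 x i j = M $ i $ j"
  by (simp add: jac_def)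

lemma proj_unit_nth: "proj_field 0 (- unit_matrix i j) 0 x $ k = - (of_bool (k = i) * x $ j)"
  by (simp add: proj_field_nth unit_matrix_nth sum_negf mult.assoc delta_sums flip: sum_distrib_left)

lemma diverg_unit: "diverg (proj_field 0 (- unit_matrix i j) 0) x = - of_bool (i = j)"
  by (simp add: diverg_proj_field unit_matrix_nth sum_negf delta_sums)

lemma slice_mat_form:
  "slice (mat_form w1 w2 \<delta> i j A) x = - (x $ j *\<^sub>R slice (pd i A) x) + gl_unit i j (slice A x)
     - (\<delta> * of_bool (i = j)) *\<^sub>R slice A x"
  unfolding mat_form_def slice_lie_form proj_unit_nth diverg_unit jac_linear
  by (simp add: sum_negf unit_matrix_sum) (simp flip: scaleR_scaleR)

lemma slice_pd_mat_form:
  assumes "A \<in> symbols"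
  shows "slice (pd k (mat_form w1 w2 \<delta> i j A)) x =
     - (of_bool (k = j) *\<^sub>R slice (pd i A) x) - x $ j *\<^sub>R slice (pd k (pd i A)) x
     + gl_unit i j (slice (pd k A) x) - (\<delta> * of_bool (i = j)) *\<^sub>R slice (pd k A) x"
  unfolding mat_form_def slice_pd_lie_form[OF assms] proj_unit_nth diverg_unit jac_linear
  by (simp add: sum_negf unit_matrix_sum unit_matrix_nth) (simp flip: scaleR_scaleR)

lemma symbols_mat_form: "A \<in> symbols \<Longrightarrow> mat_form w1 w2 \<delta> i j A \<in> symbols"
  unfolding mat_form_def by (rule symbols_lie_form)

lemma e_mat_diag_form:
  "lie_form w1 w2 \<delta> 0 (- unit_matrix i i - mat 1) 0 A = mat_form w1 w2 \<delta> i i A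
      + (\<Sum>k\<in>UNIV. mat_form w1 w2 \<delta> k k A)"
proof (rule slice_eqI)
  fix x
  have X: "proj_field 0 (- unit_matrix i i - mat 1) 0 x $ k = - (of_bool (k = i) * x $ i) - x $ k" for k
    unfolding e_mat_diag_eq[symmetric] e_mat_def sum_scale_axis by (simp add: axis_def)
  have D: "diverg (proj_field 0 (- unit_matrix i i - mat 1) 0) x = - 1 - real CARD('a)"
    by (simp add: diverg_proj_field unit_matrix_nth sum_subtractf sum_negf delta_sums mat_def)
  have J: "(\<Sum>k\<in>UNIV. \<Sum>l\<in>UNIV. jac (- unit_matrix i i - mat 1) 0 x k
      l *\<^sub>R gl_unit k l p) = - gl_unit i i p - euler_total p" for p
    by (simp add: jac_linear scaleR_diff_left sum_subtractf sum_negf unit_matrix_sum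
        sum_gl_unit_diag[symmetric] mat_def
      if_distrib[of "\<lambda>c. c *\<^sub>R _"] cong: if_cong)
  show "slice (lie_form w1 w2 \<delta> 0 (- unit_matrix i i - mat 1) 0 A) x
      = slice (mat_form w1 w2 \<delta> i i A + (\<Sum>k\<in>UNIV. mat_form w1 w2 \<delta> k k A)) x"
    unfolding slice_lie_form slice_linear slice_mat_form J D X
    by (simp add: sum.distrib sum_subtractf sum_negf sum_gl_unit_diag scaleR_diff_left flip: scaleR_scaleR)
       (simp add: fun_eq_iff algebra_simps)
qed

lemma slice_translation_form:
  "slice (lie_form w1 w2 \<delta> (- axis i 1) 0 0 A) x = - slice (pd i A) x"
proof -
  have X: "proj_field (- axis i 1) 0 0 x $ k = - of_bool (k = i)" for k
    by (simp add: proj_field_nth axis_def)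
  show ?thesis unfolding slice_lie_form X by (simp add: jac_def diverg_proj_field sum_negf)
qed

lemma slice_pd_translation_form:
  assumes "A \<in> symbols"
  shows "slice (pd k (lie_form w1 w2 \<delta> (- axis i 1) 0 0 A)) x = - slice (pd k (pd i A)) x"
proof -
  have X: "proj_field (- axis i 1) 0 0 x $ k = - of_bool (k = i)" for k
    by (simp add: proj_field_nth axis_def)
  show ?thesis unfolding slice_pd_lie_form[OF assms] X by (simp add: jac_def diverg_proj_field sum_negf)
qed

lemma axis_delta: "(axis i 1 :: (real, 'n::finite) vec) $ k = of_bool (k = i)"
  by (simp add: axis_def)

lemma eps_nth: "proj_field 0 0 (axis i 1) x $ k = x $ i * x $ k"
  by (simp add: proj_field_nth axis_delta delta_sums)

lemma eps_diverg: "diverg (proj_field 0 0 (axis i 1)) x = (real CARD('n) + 1) * x $ i"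
  for x :: "(real, 'n::{finite,linorder}) vec"
  by (simp add: diverg_proj_field axis_delta delta_sums)

lemma eps_jac_sum:
  "(\<Sum>k\<in>UNIV. \<Sum>l\<in>UNIV. jac 0 (axis i 1) x k l *\<^sub>R gl_unit k l p) =
     (\<Sum>k\<in>UNIV. x $ k *\<^sub>R gl_unit k i p) + x $ i *\<^sub>R euler_total p"
  by (simp add: jac_def axis_delta delta_sums scaleR_add_left sum.distrib sum_gl_unit_diag[symmetric]
      scaleR_sum_right
      flip: scaleR_scaleR)

lemma slice_eps_form:
  fixes A :: "'n::{finite,linorder} symbol"
  shows "slice (lie_form w1 w2 \<delta> 0 0 (axis i 1) A) x =
    x $ i *\<^sub>R (\<Sum>k\<in>UNIV. x $ k *\<^sub>R slice (pd k A) x)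
        - (\<Sum>k\<in>UNIV. x $ k *\<^sub>R gl_unit k i (slice A x))
    - x $ i *\<^sub>R euler_total (slice A x) + (\<delta> * (real CARD('n) + 1) * x $ i) *\<^sub>R slice A x
    + corr w1 w2 i (slice A x)"
  unfolding slice_lie_form eps_nth eps_diverg eps_jac_sum
  by (simp add: axis_delta scaleR_sum_right mult.assoc)

lemma slice_pd_eps_form:
  fixes A :: "'n::{finite,linorder} symbol"
  assumes "A \<in> symbols"
  shows "slice (pd i (lie_form w1 w2 \<delta> 0 0 (axis i 1) A)) x =
    (\<Sum>k\<in>UNIV. x $ k *\<^sub>R slice (pd k A) x) + x $ i *\<^sub>R slice (pd i A) x
    + x $ i *\<^sub>R (\<Sum>k\<in>UNIV. x $ k *\<^sub>R slice (pd i (pd k A)) x)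
        - gl_unit i i (slice A x) - euler_total (slice A x)
    - (\<Sum>k\<in>UNIV. x $ k *\<^sub>R gl_unit k i (slice (pd i A) x))
        - x $ i *\<^sub>R euler_total (slice (pd i A) x)
    + (\<delta> * (real CARD('n) + 1)) *\<^sub>R slice A x
        + (\<delta> * (real CARD('n) + 1) * x $ i) *\<^sub>R slice (pd i A) x
    + corr w1 w2 i (slice (pd i A) x)"
proof -
  have J: "(\<Sum>k\<in>UNIV. jac 0 (axis i 1) x k i *\<^sub>R slice (pd k A) x) =
     (\<Sum>k\<in>UNIV. x $ k *\<^sub>R slice (pd k A) x) + x $ i *\<^sub>R slice (pd i A) x"
    by (simp add: jac_def axis_delta delta_sums scaleR_add_left sum.distrib flip: scaleR_scaleR)
  show ?thesis
    unfolding slice_pd_lie_form[OF assms] eps_nth eps_diverg eps_jac_sum J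
    by (simp add: axis_delta scaleR_sum_right mult.assoc)
qed

text \<open>
  Besides \<open>casimir_symbol\<close> and the corrections, the sum contains terms in which the
  coordinates \<open>x\<close> occur explicitly; these cancel between the linear fields and the pairs of
  translations and quadratic fields. The constant terms combine with the Casimir element of
  gl(n) computed in \<open>sum_gl_unit_gl_unit\<close>.
\<close>

theorem casimir_op_bidiff:
  fixes A :: "'n::{finite,linorder} symbol"
  assumes A: "A \<in> symbols" and \<delta>: "\<delta> = \<mu> - w1 - w2"
  shows "casimir_op w1 w2 \<mu> (bidiff A) = bidiff (casimir_form w1 w2 \<delta> A)"
proof -
  define N where "N = real CARD('n)"
  let ?L = "lie_op w1 w2 \<mu> :: 'n vfield \<Rightarrow> 'n biop \<Rightarrow> 'n biop"
  let ?M = "mat_form w1 w2 \<delta> :: 'n \<Rightarrow> 'n \<Rightarrow> 'n symbol \<Rightarrow> 'n symbol"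
  define S where "S B = (\<Sum>k\<in>UNIV. ?M k k B)" for B
  let ?E = "\<lambda>i. lie_form w1 w2 \<delta> 0 0 (axis i 1) :: 'n symbol \<Rightarrow> 'n symbol"
  let ?D = "\<lambda>i. lie_form w1 w2 \<delta> (- axis i 1) 0 0 :: 'n symbol \<Rightarrow> 'n symbol"
  note mem = symbols_add symbols_sum symbols_mat_form symbols_lie_form A
  have S_mem: "S B \<in> symbols" if "B \<in> symbols" for B
    unfolding S_def by (intro symbols_sum symbols_mat_form that)
  have 1: "?L (e_mat i j) (?L (e_mat_dual i j) (bidiff A)) = bidiff (?M i j (?M j i A))" if
      "i \<noteq> j" for i j
    unfolding e_mat_eq[OF that] e_mat_dual_eq lie_op_bidiff[OF A] mat_form_def \<delta>
    by (rule lie_op_bidiff) (intro mem)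
  have 2: "?L (e_mat i i) (?L (e_mat_dual i i) (bidiff A)) = bidiff (?M i i (?M i i A))
      + bidiff (S (?M i i A))" for i
  proof -
    have "?L (e_mat i i) (?L (e_mat_dual i i) (bidiff A))
        = bidiff (lie_form w1 w2 \<delta> 0 (- unit_matrix i i - mat 1) 0 (?M i i A))"
      unfolding e_mat_diag_eq e_mat_dual_eq lie_op_bidiff[OF A] mat_form_def \<delta>
      by (rule lie_op_bidiff) (intro mem)
    then show ?thesis unfolding e_mat_diag_form S_def[symmetric]
      by (simp only: bidiff_add[OF symbols_mat_form[OF symbols_mat_form[OF A]]
          S_mem[OF symbols_mat_form[OF A]]])
  qed
  have 3: "?L (e_vec i) (?L (eps i) (bidiff A)) = bidiff (?D i (?E i A))" for i
    unfolding e_vec_eq eps_eq lie_op_bidiff[OF A] \<delta> by (rule lie_op_bidiff) (intro mem)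
  have 4: "?L (eps i) (?L (e_vec i) (bidiff A)) = bidiff (?E i (?D i A))" for i
    unfolding e_vec_eq eps_eq lie_op_bidiff[OF A] \<delta> by (rule lie_op_bidiff) (intro mem)
  \<comment> \<open>the Casimir operator on the level of symbols, with the diagonal pairs split into the
      part that completes the sum over \<open>i \<noteq> j\<close> and the rest \<open>S\<close>\<close>
  define T where "T = (\<Sum>i\<in>UNIV. \<Sum>j\<in>UNIV. ?M i j (?M j i A))
      + (\<Sum>i\<in>UNIV. S (?M i i A) + ?D i (?E i A) + ?E i (?D i A))"
  have off: "(\<Sum>(i, j) | i \<noteq> j. F i j) + (\<Sum>i\<in>UNIV. F i i)
      = (\<Sum>i\<in>UNIV. \<Sum>j\<in>UNIV. F i j)" for F :: "'n \<Rightarrow> 'n \<Rightarrow> real"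
  proof -
    have "(\<Sum>i\<in>UNIV. \<Sum>j\<in>UNIV. F i j) = (\<Sum>(i, j)\<in>UNIV. F i j)"
      by (simp add: sum.cartesian_product)
    also have "\<dots> = (\<Sum>(i, j)\<in>{(i, j). i \<noteq> j} \<union> {(i, j). i = j}. F i j)"
      by (rule sum.cong) auto
    also have "\<dots> = (\<Sum>(i, j) | i \<noteq> j. F i j) + (\<Sum>(i, j) | i = j. F i j)"
      by (rule sum.union_disjoint) auto
    also have "(\<Sum>(i, j) | i = j. F i j) = (\<Sum>i\<in>UNIV. F i i)"
      by (rule sum.reindex_bij_witness[where i = "\<lambda>i. (i, i)" and j = fst]) auto
    finally show ?thesis by simp
  qed
  have cas: "casimir_op w1 w2 \<mu> (bidiff A) f g x = bidiff T f g x" for f g x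
  proof -
    have "(\<Sum>(i, j) | i \<noteq> j. ?L (e_mat i j) (?L (e_mat_dual i j) (bidiff A)) f g x) =
       (\<Sum>(i, j) | i \<noteq> j. bidiff (?M i j (?M j i A)) f g x)"
      by (rule sum.cong) (auto simp: 1)
    then have "casimir_op w1 w2 \<mu> (bidiff A) f g x =
      (\<Sum>(i, j) | i \<noteq> j. bidiff (?M i j (?M j i A)) f g x)
          + (\<Sum>i\<in>UNIV. bidiff (?M i i (?M i i A)) f g x)
      + (\<Sum>i\<in>UNIV. bidiff (S (?M i i A)) f g x + bidiff (?D i (?E i A)) f g x
          + bidiff (?E i (?D i A)) f g x)"
      unfolding casimir_op_def Let_def 2 3 4
      by (simp add: sum.distrib add_ac)
    also have "\<dots> = bidiff T f g x"
      unfolding T_def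
      by (simp add: bidiff_add bidiff_sum mem S_mem
          off[of "\<lambda>i j. bidiff (?M i j (?M j i A)) f g x"])
    finally show ?thesis .
  qed
  have "T = casimir_form w1 w2 \<delta> A"
  proof (rule slice_eqI)
    fix x
    let ?p = "slice A x" and ?p1 = "\<lambda>i. slice (pd i A) x" and ?p2 =
        "\<lambda>i j. slice (pd i (pd j A)) x"
    \<comment> \<open>the expressions with explicit coordinates, which cancel between \<open>M\<close>, \<open>B\<close> and \<open>D\<close>\<close>
    define xp where "xp = (\<Sum>k\<in>UNIV. x $ k *\<^sub>R ?p1 k)"
    define xxp where "xxp = (\<Sum>i\<in>UNIV. \<Sum>k\<in>UNIV. x $ i *\<^sub>R x $ k *\<^sub>R ?p2 i k)"
    define xgp where "xgp = (\<Sum>i\<in>UNIV. \<Sum>k\<in>UNIV. x $ k *\<^sub>R gl_unit k i (?p1 i))"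
    define Cp where "Cp = (\<Sum>k\<in>UNIV. corr w1 w2 k (?p1 k))"
    define E where "E = (euler_total :: 'n bipoly \<Rightarrow> 'n bipoly)"
    have p2: "?p2 i j = ?p2 j i" for i j using pd_commute[OF A, of i j] by simp
    have m: "slice (?M i j (?M j i A)) x = x $ j *\<^sub>R ?p1 j
        + x $ i *\<^sub>R x $ j *\<^sub>R ?p2 i j - x $ j *\<^sub>R gl_unit j i (?p1 i)
       - x $ i *\<^sub>R gl_unit i j (?p1 j) + gl_unit i j (gl_unit j i ?p)
           + of_bool (i = j) *\<^sub>R ((2 * \<delta>) *\<^sub>R x $ i *\<^sub>R ?p1 i
           - (2 * \<delta>) *\<^sub>R gl_unit i i ?p + \<delta>\<^sup>2 *\<^sub>R ?p)" for i j
      unfolding slice_mat_form slice_pd_mat_form[OF A]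
      by (cases "i = j") (simp_all add: fun_eq_iff gl_linear algebra_simps power2_eq_square)
    have swap: "(\<Sum>i\<in>UNIV. \<Sum>k\<in>UNIV. x $ i *\<^sub>R gl_unit i k (?p1 k)) = xgp"
      unfolding xgp_def by (rule sum.swap)
    have M: "(\<Sum>i\<in>UNIV. \<Sum>j\<in>UNIV. slice (?M i j (?M j i A)) x) = N *\<^sub>R xp + xxp
        - 2 *\<^sub>R xgp
       + (E (E ?p) + (N - 1) *\<^sub>R E ?p - 2 *\<^sub>R capelli ?p)
       + (2 * \<delta>) *\<^sub>R xp - (2 * \<delta>) *\<^sub>R E ?p + (N * \<delta>\<^sup>2) *\<^sub>R ?p"
    proof -
      have c: "(\<Sum>i::'n\<in>UNIV. \<Sum>j\<in>UNIV. x $ j *\<^sub>R ?p1 j) = N *\<^sub>R xp"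
        by (simp add: xp_def N_def bipoly_mult)
      have d: "(\<Sum>i\<in>UNIV. (2 * \<delta>) *\<^sub>R x $ i *\<^sub>R ?p1 i)
          = (2 * \<delta>) *\<^sub>R xp"
        "(\<Sum>i\<in>UNIV. (2 * \<delta>) *\<^sub>R gl_unit i i ?p) = (2 * \<delta>) *\<^sub>R E ?p"
        "(\<Sum>i::'n\<in>UNIV. \<delta>\<^sup>2 *\<^sub>R ?p) = (N * \<delta>\<^sup>2) *\<^sub>R ?p"
        unfolding xp_def E_def N_def scaleR_sum_right[symmetric] sum_gl_unit_diag
        by (simp_all add: bipoly_mult mult_ac)
      show ?thesis unfolding m sum.distrib sum_subtractf c swap xxp_def[symmetric] sum_gl_unit_gl_unit
          E_def[symmetric] N_def[symmetric] xgp_def[symmetric] sum_delta_scaleR d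
        by (simp add: fun_eq_iff)
    qed
    have SS: "slice (S B) x = - (\<Sum>k\<in>UNIV. x $ k *\<^sub>R slice (pd k B) x) + E (slice B x)
        - (N * \<delta>) *\<^sub>R slice B x" for B
      unfolding S_def slice_linear slice_mat_form
      by (simp add: sum.distrib sum_subtractf sum_negf sum_gl_unit_diag E_def N_def bipoly_mult mult_ac)
    have B: "(\<Sum>i\<in>UNIV. slice (S (?M i i A)) x) = xp + xxp
        - 2 *\<^sub>R (\<Sum>k\<in>UNIV. x $ k *\<^sub>R E (?p1 k)) + (2 * N * \<delta>) *\<^sub>R xp
        + E (E ?p) - (2 * N * \<delta>) *\<^sub>R E ?p + (N\<^sup>2 * \<delta>\<^sup>2) *\<^sub>R ?p"
    proof -
      have sl: "(\<Sum>i\<in>UNIV. slice (?M i i A) x) = - xp + E ?p - (N * \<delta>) *\<^sub>R ?p"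
        using SS[of A] unfolding S_def slice_linear xp_def .
      have sp: "(\<Sum>i\<in>UNIV. slice (pd k (?M i i A)) x) = - ?p1 k
          - (\<Sum>l\<in>UNIV. x $ l *\<^sub>R ?p2 k l) + E (?p1 k) - (N * \<delta>) *\<^sub>R ?p1 k" for k
        unfolding slice_pd_mat_form[OF A]
        by (simp add: sum.distrib sum_subtractf sum_negf sum_gl_unit_diag E_def N_def bipoly_mult mult_ac)
      have "(\<Sum>i\<in>UNIV. slice (S (?M i i A)) x) =
          - (\<Sum>k\<in>UNIV. x $ k *\<^sub>R (\<Sum>i\<in>UNIV. slice (pd k (?M i i A)) x))
         + E (\<Sum>i\<in>UNIV. slice (?M i i A) x)
             - (N * \<delta>) *\<^sub>R (\<Sum>i\<in>UNIV. slice (?M i i A) x)"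
        unfolding SS sum.distrib sum_subtractf sum_negf scaleR_sum_right E_def euler_total_linear
        by (subst sum.swap) (rule refl)
      also have "\<dots> = xp + xxp - 2 *\<^sub>R (\<Sum>k\<in>UNIV. x $ k *\<^sub>R E (?p1 k))
          + (2 * N * \<delta>) *\<^sub>R xp
        + E (E ?p) - (2 * N * \<delta>) *\<^sub>R E ?p + (N\<^sup>2 * \<delta>\<^sup>2) *\<^sub>R ?p"
        unfolding sl sp
        by (simp add: xp_def xxp_def E_def euler_total_linear scaleR_diff_right scaleR_add_right
            sum.distrib sum_subtractf sum_negf scaleR_sum_right)
           (simp add: fun_eq_iff sum_distrib_left algebra_simps power2_eq_square)
      finally show ?thesis .
    qed
    have D: "(\<Sum>i\<in>UNIV. slice (?D i (?E i A)) x) + (\<Sum>i\<in>UNIV. slice (?E i (?D i A)) x) =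
       - (N + 1) *\<^sub>R xp - 2 *\<^sub>R xxp + (N + 1) *\<^sub>R E ?p + 2 *\<^sub>R xgp
           + 2 *\<^sub>R (\<Sum>k\<in>UNIV. x $ k *\<^sub>R E (?p1 k))
       - (N * (\<delta> * (N + 1))) *\<^sub>R ?p - (2 * \<delta> * (N + 1)) *\<^sub>R xp - 2 *\<^sub>R Cp"
    proof -
      have xxp: "(\<Sum>i\<in>UNIV. x $ i *\<^sub>R (\<Sum>k\<in>UNIV. x $ k *\<^sub>R ?p2 i k)) = xxp"
        unfolding xxp_def scaleR_sum_right ..
      have g: "(\<Sum>i\<in>UNIV. gl_unit i i ?p) = E ?p" by (simp add: sum_gl_unit_diag E_def)
      have t: "slice (?D i (?E i A)) x + slice (?E i (?D i A)) x =
         - xp - x $ i *\<^sub>R ?p1 i - 2 *\<^sub>R (\<Sum>k\<in>UNIV.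
             x $ i *\<^sub>R x $ k *\<^sub>R ?p2 i k) + gl_unit i i ?p + E ?p
         + 2 *\<^sub>R (\<Sum>k\<in>UNIV. x $ k *\<^sub>R gl_unit k i (?p1 i))
             + 2 *\<^sub>R x $ i *\<^sub>R E (?p1 i)
         - (\<delta> * (N + 1)) *\<^sub>R ?p - (2 * \<delta> * (N + 1)) *\<^sub>R x $ i *\<^sub>R ?p1 i
             - 2 *\<^sub>R corr w1 w2 i (?p1 i)" for i
        unfolding slice_translation_form slice_pd_eps_form[OF A] slice_eps_form
            slice_pd_translation_form[OF A]
          gl_linear corr_linear euler_total_linear
        by (simp add: fun_eq_iff xp_def N_def E_def p2[of i] sum_negf sum_distrib_left algebra_simps)
      have "(\<Sum>i\<in>UNIV. slice (?D i (?E i A)) x) + (\<Sum>i\<in>UNIV. slice (?E i (?D i A)) x) =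
         (\<Sum>i\<in>UNIV. slice (?D i (?E i A)) x + slice (?E i (?D i A)) x)"
        by (simp only: sum.distrib)
      also have "\<dots> = - (\<Sum>i::'n\<in>UNIV. xp) - xp - 2 *\<^sub>R xxp + E ?p
          + (\<Sum>i::'n\<in>UNIV. E ?p) + 2 *\<^sub>R xgp
         + 2 *\<^sub>R (\<Sum>k\<in>UNIV. x $ k *\<^sub>R E (?p1 k))
             - (\<Sum>i::'n\<in>UNIV. (\<delta> * (N + 1)) *\<^sub>R ?p)
         - (2 * \<delta> * (N + 1)) *\<^sub>R xp - 2 *\<^sub>R Cp"
        unfolding t sum.distrib sum_subtractf sum_negf scaleR_sum_right[symmetric] g
         xp_def[symmetric] xxp xgp_def[symmetric] Cp_def[symmetric] ..
      finally show ?thesis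
        by (simp add: bipoly_mult N_def[symmetric]) (simp add: fun_eq_iff algebra_simps)
    qed
    have "slice T x = (\<Sum>i\<in>UNIV. \<Sum>j\<in>UNIV. slice (?M i j (?M j i A)) x)
        + (\<Sum>i\<in>UNIV. slice (S (?M i i A)) x)
       + ((\<Sum>i\<in>UNIV. slice (?D i (?E i A)) x) + (\<Sum>i\<in>UNIV. slice (?E i (?D i A)) x))"
      unfolding T_def slice_linear sum.distrib by (simp add: add_ac)
    also have "\<dots> = slice (casimir_form w1 w2 \<delta> A) x"
      unfolding M B D slice_casimir_form casimir_symbol_def Let_def E_def[symmetric] N_def[symmetric]
          Cp_def[symmetric]
      by (simp add: fun_eq_iff algebra_simps power2_eq_square)
    finally show "slice T x = slice (casimir_form w1 w2 \<delta> A) x" .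
  qed
  then show ?thesis using cas by (intro ext) simp
qed

section \<open>Eigenspaces of an operator with a known annihilating polynomial\<close>

text \<open>
  The monic polynomial with the given roots, evaluated at the operator \<open>T\<close>.
\<close>

fun op_prod :: "('v \<Rightarrow> 'v) \<Rightarrow> real list \<Rightarrow> 'v::real_vector
    \<Rightarrow> 'v" where
  "op_prod T [] v = v"
| "op_prod T (c # cs) v = op_prod T cs (T v - c *\<^sub>R v)"

lemma op_prod_append: "op_prod T (cs @ ds) v = op_prod T ds (op_prod T cs v)"
  by (induction cs arbitrary: v) auto

lemma op_prod_in_subspace:
  "subspace Y \<Longrightarrow> (\<And>v. v \<in> Y \<Longrightarrow> T v \<in> Y) \<Longrightarrow> v
      \<in> Y \<Longrightarrow> op_prod T cs v \<in> Y"
proof (induction cs arbitrary: v)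
  case (Cons c cs)
  have "T v - c *\<^sub>R v \<in> Y"
    by (rule subspace_diff[OF Cons.prems(1) _ subspace_scale[OF Cons.prems(1)]]; (rule Cons.prems(2))?;
        rule Cons.prems(3))
  with Cons.IH[OF Cons.prems(1,2)] show ?case by simp
qed simp

lemma linear_op_prod: "linear T \<Longrightarrow> linear (op_prod T cs)"
proof (induction cs)
  case Nil
  then show ?case by (simp add: linear_iff)
next
  case (Cons c cs)
  then have 1: "linear (op_prod T cs)" by simp
  have "linear (\<lambda>v. T v - c *\<^sub>R v)"
    using Cons.prems by (auto simp: linear_iff algebra_simps)
  from linear_compose[OF this 1] show ?case by (simp add: o_def)
qed

lemma op_prod_commute:
  assumes T: "linear T" and F: "linear F" "\<And>v. F (T v) = T (F v)"
  shows "op_prod T cs (F v) = F (op_prod T cs v)"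
proof (induction cs arbitrary: v)
  case (Cons c cs)
  have "T (F v) - c *\<^sub>R F v = F (T v - c *\<^sub>R v)"
    by (simp add: linear_diff[OF F(1)] linear_scale[OF F(1)] F(2))
  then show ?case using Cons.IH by simp
qed simp

lemma op_prod_eigen:
  assumes "linear T" "T v = c *\<^sub>R v"
  shows "op_prod T cs v = (\<Prod>d\<leftarrow>cs. c - d) *\<^sub>R v"
proof (induction cs)
  case (Cons d cs)
  have "op_prod T (d # cs) v = (c - d) *\<^sub>R op_prod T cs v"
    using linear_scale[OF linear_op_prod[OF assms(1)]] by (simp add: assms(2) flip: scaleR_diff_left)
  also have "\<dots> = (c - d) *\<^sub>R (\<Prod>d\<leftarrow>cs. c - d) *\<^sub>R v" by (simp only: Cons)
  finally show "op_prod T (d # cs) v = (\<Prod>d\<leftarrow>d # cs. c - d) *\<^sub>R v" by simp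
qed simp

lemma op_prod_eigen_zero:
  assumes "linear T" "T v = c *\<^sub>R v" "op_prod T cs v = 0" "c \<notin> set cs"
  shows "v = 0"
proof -
  have "(\<Prod>d\<leftarrow>cs. c - d) \<noteq> 0" using assms(4) by (induction cs) auto
  then show ?thesis using op_prod_eigen[OF assms(1,2), of cs] assms(3) by simp
qed

text \<open>
  Lagrange interpolation: if a product of distinct factors \<open>T - c\<close> annihilates \<open>v\<close>, the
  product of all factors but the one with \<open>c\<close> maps \<open>v\<close> to an eigenvector for \<open>c\<close>, and
  subtracting a multiple of it leaves a vector that the shorter product annihilates.
\<close>

lemma eigen_decomposition:
  assumes T: "linear T" and Y: "subspace Y" "\<And>v. v \<in> Y \<Longrightarrow> T v \<in> Y"
    and "distinct cs" "v \<in> Y" "op_prod T cs v = 0"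
  shows "\<exists>w. (\<forall>c\<in>set cs. w c \<in> Y \<and> T (w c) = c *\<^sub>R w c) \<and> v
      = (\<Sum>c\<in>set cs. w c)"
  using assms(4-)
proof (induction cs arbitrary: v)
  case Nil
  then show ?case by simp
next
  case (Cons c cs)
  define u where "u = op_prod T cs v"
  \<comment> \<open>\<open>u\<close> is an eigenvector, on which the remaining factors act as \<open>d\<close>\<close>
  define d where "d = (\<Prod>e\<leftarrow>cs. c - e)"
  have "d \<noteq> 0" using Cons.prems(1) unfolding d_def by (induction cs) auto
  have "T u - c *\<^sub>R u = op_prod T cs (T v - c *\<^sub>R v)"
    unfolding u_def linear_diff[OF linear_op_prod[OF T]] linear_scale[OF linear_op_prod[OF T]]
    by (simp add: op_prod_commute[OF T T refl])
  then have u: "T u = c *\<^sub>R u" using Cons.prems(3) by simp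
  have uY: "u \<in> Y" unfolding u_def by (rule op_prod_in_subspace[OF Y(1)]) (fact Y(2) Cons.prems)+
  define v' where "v' = v - (1 / d) *\<^sub>R u"
  have "op_prod T cs v' = u - (1 / d) *\<^sub>R op_prod T cs u"
    unfolding v'_def u_def linear_diff[OF linear_op_prod[OF T]] linear_scale[OF linear_op_prod[OF T]] ..
  also have "\<dots> = 0" using op_prod_eigen[OF T u, of cs] \<open>d \<noteq> 0\<close> by (simp add: d_def)
  finally have "op_prod T cs v' = 0" .
  moreover have "v' \<in> Y" unfolding v'_def using Y(1) Cons.prems(2) uY
      by (intro subspace_diff subspace_scale)
  ultimately obtain w where w: "\<And>e. e \<in> set cs \<Longrightarrow> w e \<in> Y \<and> T (w e)
      = e *\<^sub>R w e" "v' = (\<Sum>e\<in>set cs. w e)"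
    using Cons.IH[of v'] Cons.prems(1) by auto
  let ?w = "w(c := (1 / d) *\<^sub>R u)"
  have "(\<Sum>e\<in>set (c # cs). ?w e) = (1 / d) *\<^sub>R u + (\<Sum>e\<in>set cs. w e)"
    using Cons.prems(1) by (auto intro: sum.cong)
  also have "\<dots> = v" unfolding w(2)[symmetric] v'_def by simp
  finally have "v = (\<Sum>e\<in>set (c # cs). ?w e)" ..
  moreover have "\<forall>e\<in>set (c # cs). ?w e \<in> Y \<and> T (?w e) = e *\<^sub>R ?w e"
    using w(1) uY u Y(1) by (auto simp: subspace_scale linear_scale[OF T])
  ultimately show ?case by blast
qed

lemma eigen_independent:
  assumes T: "linear T"
  assumes "finite Q" "\<And>q. q \<in> Q \<Longrightarrow> T (w q) = c q *\<^sub>R w q" "inj_on c Q"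
      "(\<Sum>q\<in>Q. w q) = 0" "q \<in> Q"
  shows "w q = 0"
  using assms(2-)
proof (induction Q arbitrary: w q rule: finite_induct)
  case (insert r Q)
  have sum: "w r + (\<Sum>q\<in>Q. w q) = 0" using insert by simp
  have "(\<Sum>q\<in>Q. (c q - c r) *\<^sub>R w q) = T (\<Sum>q\<in>Q. w q)
      - c r *\<^sub>R (\<Sum>q\<in>Q. w q)"
    using insert.prems(1) by (simp add: linear_sum[OF T] scaleR_sum_right scaleR_diff_left sum_subtractf)
  also have "(\<Sum>q\<in>Q. w q) = - w r" using sum by (simp add: eq_neg_iff_add_eq_0 add.commute)
  also have "T (- w r) - c r *\<^sub>R (- w r) = 0" using insert.prems(1)[of r]
      by (simp add: linear_neg[OF T])
  finally have z: "(\<Sum>q\<in>Q. (c q - c r) *\<^sub>R w q) = 0" .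
  have wz: "w q = 0" if "q \<in> Q" for q
  proof -
    have "(c q - c r) *\<^sub>R w q = 0"
      using z that insert.prems(1,2) by (intro insert.IH[of "\<lambda>q. (c q - c r) *\<^sub>R w q"])
          (auto simp: linear_scale[OF T])
    moreover have "c q \<noteq> c r" using insert that by (auto simp: inj_on_def)
    ultimately show ?thesis by simp
  qed
  then have "w r = 0" using sum by simp
  then show ?case using wz insert.prems(4) by auto
qed simp

section \<open>Decomposition of symbols into types\<close>

definition kappa :: "nat \<Rightarrow> nat \<Rightarrow> real" where
  "kappa i q = real q * (real i + 1 - real q)"

lemma kappa_diff: "kappa i q - kappa i r = (real q - real r) * (real i + 1 - real q - real r)"
  by (simp add: kappa_def algebra_simps)

text \<open>
  The values of \<open>\<kappa>\<^sub>i\<close> are symmetric about \<open>(i + 1) / 2\<close>, so two of them agree only if their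
  arguments add up to \<open>i + 1\<close>; for \<open>q \<le> i div 2\<close> they are distinct.
\<close>

lemma kappa_inj: "q + r \<le> i \<Longrightarrow> kappa i q = kappa i r \<Longrightarrow> q = r"
  using kappa_diff[of i q r] by auto

lemma msize_upd_Suc: "msize (a(i := Suc m)) \<noteq> 0"
  by (auto simp: msize_def intro!: exI[of _ i])

text \<open>
  On bidegree \<open>(k, l)\<close> one has \<open>K - \<kappa> l = - (\<beta> \<cdot> D\<^sub>\<alpha>) (\<alpha> \<cdot> D\<^sub>\<beta>)\<close>. The inner polarization leads
  to bidegree \<open>(k + 1, l - 1)\<close>, where the remaining factors vanish by induction; they are
  the same factors, because \<open>\<kappa>\<close> depends on the total degree only, and they commute with the
  outer polarization.
\<close>

lemma op_prod_capelli_right: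
  "p \<in> bihomogeneous k l \<Longrightarrow> op_prod capelli (map (kappa (k + l)) (rev [0..<Suc l]))
      p = 0"
proof (induction l arbitrary: k p)
  case 0
  then have h: "euler_beta p = 0" "euler_alpha p = real k *\<^sub>R p" by (simp_all add: bihomogeneous_iff)
  have "D_beta i p = 0" for i
  proof -
    have "p a (b(i := b i + 1)) = 0" for a b
      using msize_upd_Suc[of b i "b i"] by (intro bihomogeneous_zero[OF 0] disjI2) (simp del: fun_upd_apply)
    then show ?thesis by (simp add: D_beta_def fun_eq_iff)
  qed
  then have "polar_up p = 0" by (simp add: polar_up_def weyl_linear)
  then have "capelli p = 0" by (simp add: capelli_polar_down_up h gl_linear)
  then show ?case by (simp add: kappa_def)
next
  case (Suc l)
  have h: "euler_beta p = real (Suc l) *\<^sub>R p" "euler_alpha p = real k *\<^sub>R p"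
      using Suc.prems by (simp_all add: bihomogeneous_iff)
  have "capelli p - kappa (k + Suc l) (Suc l) *\<^sub>R p = - polar_down (polar_up p)"
    unfolding capelli_polar_down_up h gl_linear by (simp add: fun_eq_iff kappa_def algebra_simps)
  moreover have "op_prod capelli (map (kappa (k + Suc l)) (rev [0..<Suc l])) (polar_down (polar_up p)) = 0"
  proof -
    have "polar_up p \<in> bihomogeneous (Suc k) l"
      using polar_euler(1,2)[of p] unfolding bihomogeneous_iff h gl_linear
          by (simp add: fun_eq_iff algebra_simps)
    then have "op_prod capelli (map (kappa (Suc k + l)) (rev [0..<Suc l])) (polar_up p) = 0"
        by (rule Suc.IH)
    then show ?thesis
      by (simp only: op_prod_commute[OF linear_capelli linear_polar_down polar_down_capelli] add_Suc
          add_Suc_right gl_linear)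
  qed
  moreover have "rev [0..<Suc (Suc l)] = Suc l # rev [0..<Suc l]" by simp
  ultimately show "op_prod capelli (map (kappa (k + Suc l)) (rev [0..<Suc (Suc l)])) p = 0"
    by (simp only: list.map op_prod.simps linear_neg[OF linear_op_prod[OF linear_capelli]]
        neg_equal_0_iff_equal)
qed

lemma op_prod_capelli_left:
  assumes "p \<in> bihomogeneous k l"
  shows "op_prod capelli (map (kappa (k + l)) (rev [0..<Suc k])) p = 0"
proof -
  have "swap_args p \<in> bihomogeneous l k" using assms by (auto simp: bihomogeneous_def swap_args_def)
  from op_prod_capelli_right[OF this]
  have "swap_args (op_prod capelli (map (kappa (k + l)) (rev [0..<Suc k])) p) = 0"
    by (simp only: op_prod_commute[OF linear_capelli linear_swap_args capelli_swap_args[symmetric]]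
        add.commute)
  then show ?thesis using swap_args_swap_args linear_0[OF linear_swap_args] by metis
qed

lemma op_prod_capelli_min:
  "p \<in> bihomogeneous k l \<Longrightarrow> op_prod capelli
      (map (kappa (k + l)) (rev [0..<Suc (min k l)])) p = 0"
  using op_prod_capelli_left[of p k l] op_prod_capelli_right[of p k l] by (simp add: min_def)

lemma op_prod_capelli_bihomogeneous:
  assumes p: "p \<in> bihomogeneous k l" and m: "min k l \<le> m"
  shows "op_prod capelli (map (kappa (k + l)) (rev [0..<Suc m])) p = 0"
proof -
  have sub: "subspace (bihomogeneous k l)" "\<And>p. p \<in> bihomogeneous k l
      \<Longrightarrow> capelli p \<in> bihomogeneous k l"
    by (auto simp: subspace_def bihomogeneous_iff gl_linear scaleR_add_right
        simp flip: capelli_commute_euler)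
  have "[0..<Suc m] = [0..<Suc (min k l)] @ [Suc (min k l)..<Suc m]"
    using m upt_add_eq_append[of 0 "Suc (min k l)" "m - min k l"] by simp
  then have "op_prod capelli (map (kappa (k + l)) (rev [0..<Suc m])) p =
    op_prod capelli (map (kappa (k + l)) (rev [0..<Suc (min k l)]))
        (op_prod capelli (map (kappa (k + l)) (rev [Suc (min k l)..<Suc m])) p)"
    by (simp only: rev_append map_append op_prod_append)
  also have "\<dots> = 0"
    by (rule op_prod_capelli_min) (rule op_prod_in_subspace[OF sub p])
  finally show ?thesis .
qed

lemma isotypic_kappa: "p \<in> isotypic k l q \<longleftrightarrow> p \<in> bihomogeneous k l
    \<and> capelli p = kappa (k + l) q *\<^sub>R p"
  by (simp add: isotypic_def kappa_def)

text \<open>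
  The reason why the index \<open>k\<close> in the definition of \<open>S_ip i p\<close> runs from \<open>p\<close> to \<open>i - p\<close>
  only.
\<close>

lemma isotypic_zero:
  assumes "p \<in> isotypic k l q" "q \<le> (k + l) div 2" "min k l < q"
  shows "p = 0"
proof (rule op_prod_eigen_zero[OF linear_capelli])
  show "capelli p = kappa (k + l) q *\<^sub>R p" using assms by (simp add: isotypic_kappa)
  show "op_prod capelli (map (kappa (k + l)) (rev [0..<Suc (min k l)])) p = 0"
    using assms by (intro op_prod_capelli_min) (simp add: isotypic_kappa)
  show "kappa (k + l) q \<notin> set (map (kappa (k + l)) (rev [0..<Suc (min k l)]))"
  proof
    assume "kappa (k + l) q \<in> set (map (kappa (k + l)) (rev [0..<Suc (min k l)]))"
    then obtain r where "r \<le> min k l" "kappa (k + l) q = kappa (k + l) r"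
      by (auto simp: less_Suc_eq_le simp del: upt_Suc)
    moreover from this(1) assms(3) have "r < q" by (rule le_less_trans)
    moreover from this assms(2) have "q + r \<le> k + l" by linarith
    ultimately show False using kappa_inj[of q r "k + l"] by simp
  qed
qed

definition bipart :: "nat \<Rightarrow> nat \<Rightarrow> 'n::{finite,linorder} bipoly \<Rightarrow> 'n
    bipoly" where
  "bipart k l p = (\<lambda>a b. if msize a = k \<and> msize b = l then p a b else 0)"

lemma linear_bipart: "linear (bipart k l)"
  by (auto intro!: linearI simp: bipart_def fun_eq_iff)

lemma bipart_bihomogeneous: "bipart k l p \<in> bihomogeneous k l"
  by (auto simp: bipart_def bihomogeneous_def)

lemma homogeneous_zero: "euler_total p = real i *\<^sub>R p \<Longrightarrow> msize a
    + msize b \<noteq> i \<Longrightarrow> p a b = 0"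
proof -
  assume h: "euler_total p = real i *\<^sub>R p" and n: "msize a + msize b \<noteq> i"
  have "real (msize a + msize b) * p a b = real i * p a b"
    using fun_cong[OF fun_cong[OF h], of a b] by (simp add: euler_total_apply)
  with n show ?thesis by (metis mult_cancel_right of_nat_eq_iff)
qed

lemma sum_bipart:
  assumes "euler_total p = real i *\<^sub>R p"
  shows "p = (\<Sum>k\<le>i. bipart k (i - k) p)"
proof (intro ext)
  fix a b
  show "p a b = (\<Sum>k\<le>i. bipart k (i - k) p) a b"
  proof (cases "msize a + msize b = i")
    case False
    then have "(\<Sum>k\<le>i. bipart k (i - k) p a b) = 0"
      by (intro sum.neutral) (auto simp: bipart_def)
    then show ?thesis using homogeneous_zero[OF assms False] by simp
  next
    case True
    have "(\<Sum>k\<le>i. bipart k (i - k) p a b) = (\<Sum>k\<le>i. if k = msize a then p a b else 0)"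
      by (rule sum.cong) (use True in \<open>auto simp: bipart_def\<close>)
    then show ?thesis using True by simp
  qed
qed

lemma capelli_bipart:
  assumes h: "euler_total p = real i *\<^sub>R p" and "k \<le> i"
  shows "capelli (bipart k (i - k) p) = bipart k (i - k) (capelli p)"
proof -
  have bh: "capelli (bipart k' l' p) \<in> bihomogeneous k' l'" for k' l'
    using bipart_bihomogeneous[of k' l' p] by (auto simp: bihomogeneous_iff gl_linear
        simp flip: capelli_commute_euler)
  have "bipart k (i - k) r = (if k' = k then r else 0)" if "r \<in> bihomogeneous k' (i - k')" for k'
      and r :: "'a bipoly"
    using that by (auto simp: bipart_def bihomogeneous_def fun_eq_iff)
  from this[OF bh] have z: "bipart k (i - k) (capelli (bipart k' (i - k') p))
      = (if k' = k then capelli (bipart k' (i - k') p) else 0)" for k' .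
  have "bipart k (i - k) (capelli p) = (\<Sum>k'\<le>i. bipart k (i - k) (capelli (bipart k' (i - k') p)))"
    by (subst (1) sum_bipart[OF h]) (simp only: linear_sum[OF linear_capelli] linear_sum[OF linear_bipart])
  also have "\<dots> = capelli (bipart k (i - k) p)" unfolding z using \<open>k \<le> i\<close> by simp
  finally show ?thesis ..
qed

lemma bipart_isotypic:
  assumes "euler_total p = real i *\<^sub>R p" "capelli p = kappa i q *\<^sub>R p" "k \<le> i"
  shows "bipart k (i - k) p \<in> isotypic k (i - k) q"
  using assms by (simp add: isotypic_kappa bipart_bihomogeneous capelli_bipart
      linear_scale[OF linear_bipart])

lemma op_prod_capelli_homogeneous:
  assumes "euler_total p = real i *\<^sub>R p"
  shows "op_prod capelli (map (kappa i) (rev [0..<Suc (i div 2)])) p = 0"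
proof -
  have "op_prod capelli (map (kappa i) (rev [0..<Suc (i div 2)])) p =
      (\<Sum>k\<le>i. op_prod capelli (map (kappa i) (rev [0..<Suc (i div 2)])) (bipart k (i - k) p))"
    by (subst sum_bipart[OF assms], subst linear_sum[OF linear_op_prod[OF linear_capelli]]) (rule refl)
  also have "\<dots> = 0"
  proof (rule sum.neutral, rule ballI)
    fix k assume k: "k \<in> {..i}"
    have "min k (i - k) \<le> i div 2" by auto
    from op_prod_capelli_bihomogeneous[OF bipart_bihomogeneous this]
    show "op_prod capelli (map (kappa i) (rev [0..<Suc (i div 2)])) (bipart k (i - k) p) = 0" using k
        by simp
  qed
  finally show ?thesis .
qed

lemma const_op_bipart: "const_op (bipart k l :: 'n::{finite,linorder} bipoly \<Rightarrow> 'n bipoly)"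
proof -
  have eq: "ptw (bipart k l) A a b = (if msize a = k \<and> msize b = l then A a b else 0)" for A ::
      "'n symbol" and a b
    by (auto simp: fun_eq_iff ptw_def bipart_def slice_def)
  have "ptw (bipart k l) A \<in> symbols" if A: "A \<in> symbols" for A :: "'n symbol"
  proof -
    obtain I where I: "finite I" "\<And>a b. (a, b) \<notin> I \<Longrightarrow> A a b = 0"
        using A symbols_supp by blast
    show ?thesis
      by (rule symbolsI[of _ I]) (use I in \<open>auto simp: eq intro!: smooth_zero symbols_smooth[OF A]\<close>)
  qed
  moreover have "pd j (ptw (bipart k l) A) = ptw (bipart k l) (pd j A)" for A :: "'n symbol" and j
    by (intro ext) (simp add: pd_def eq pderiv_zero)
  ultimately show ?thesis by (simp add: const_op_def linear_bipart)
qed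

lemma linear_ptw: "linear F \<Longrightarrow> linear (ptw F)"
proof (rule linearI)
  fix A B c assume F: "linear F"
  show "ptw F (A + B) = ptw F A + ptw F B"
    by (rule slice_eqI) (simp only: slice_ptw slice_linear linear_add[OF F])
  show "ptw F (c *\<^sub>R A) = c *\<^sub>R ptw F A"
    by (rule slice_eqI) (simp only: slice_ptw slice_linear linear_scale[OF F])
qed

lemma slice_op_prod: "slice (op_prod (ptw F) cs A) x = op_prod F cs (slice A x)"
proof (induction cs arbitrary: A)
  case (Cons c cs)
  show "slice (op_prod (ptw F) (c # cs) A) x = op_prod F (c # cs) (slice A x)"
    by (simp only: op_prod.simps Cons slice_linear slice_ptw)
qed simp

text \<open>
  Another description of \<open>S_ip i q\<close> by two eigenvalue equations, see \<open>S_ip_eq_Sym\<close>; all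
  bidegrees are treated at once.
\<close>

definition Sym :: "nat \<Rightarrow> nat \<Rightarrow> 'n::{finite,linorder} symbol set" where
  "Sym i q = {A \<in> symbols. ptw euler_total A = real i *\<^sub>R A \<and> ptw capelli A
      = kappa i q *\<^sub>R A}"

lemma Sym_slice: "A \<in> Sym i q \<longleftrightarrow> A \<in> symbols \<and>
    (\<forall>x. euler_total (slice A x) = real i *\<^sub>R slice A x \<and> capelli (slice A x)
        = kappa i q *\<^sub>R slice A x)"
proof -
  have "ptw F A = c *\<^sub>R A \<longleftrightarrow>
      (\<forall>x. F (slice A x) = c *\<^sub>R slice A x)" for F c
    by (metis slice_eqI slice_linear(3) slice_ptw)
  then show ?thesis by (auto simp: Sym_def)
qed

lemma subspace_Sym: "subspace (Sym i q)"
  by (auto simp: subspace_def Sym_slice symbols_zero symbols_add symbols_scale slice_linear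
      euler_total_linear gl_linear scaleR_add_right)

lemma Sym_symbols: "A \<in> Sym i q \<Longrightarrow> A \<in> symbols"
  by (simp add: Sym_def)

lemma Sym_pd: "A \<in> Sym i q \<Longrightarrow> pd j A \<in> Sym i q"
  using const_opD(3)[OF const_op_gl(5), of A j] const_opD(3)[OF const_op_gl(4), of A j]
  by (auto simp: Sym_def symbols_pd pd_linear)

lemma Sym_decompose:
  assumes A: "A \<in> symbols" and h: "ptw euler_total A = real i *\<^sub>R A"
  shows "\<exists>w. (\<forall>q\<le>i div 2. w q \<in> Sym i q) \<and> A = (\<Sum>q\<le>i div 2. w q)"
proof -
  let ?Y = "{A \<in> symbols. ptw euler_total A = real i *\<^sub>R A}" and ?cs =
      "map (kappa i) (rev [0..<Suc (i div 2)])"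
  have lin: "linear (ptw capelli)" by (rule linear_ptw[OF linear_capelli])
  have le: "linear (ptw euler_total)" by (rule linear_ptw[OF linear_euler_total])
  have "subspace ?Y"
    using subspace_symbols by (auto simp: subspace_def linear_add[OF le] linear_scale[OF le]
        linear_0[OF le] scaleR_add_right)
  moreover have "ptw capelli B \<in> ?Y" if "B \<in> ?Y" for B
  proof -
    have "ptw euler_total (ptw capelli B) = ptw capelli (ptw euler_total B)"
      by (rule slice_eqI) (simp only: slice_ptw capelli_commute_euler_total)
    then show ?thesis using that const_opD(2)[OF const_op_gl(4), of B] by (simp add: linear_scale[OF lin])
  qed
  moreover have inj: "inj_on (kappa i) {..i div 2}"
    by (rule inj_onI) (rule kappa_inj[of _ _ i], auto)
  have set: "set ?cs = kappa i ` {..i div 2}" by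
      (auto simp: atLeast0LessThan lessThan_Suc_atMost simp del: upt_Suc)
  have "distinct ?cs"
    using inj by (simp add: distinct_map atLeast0LessThan lessThan_Suc_atMost del: upt_Suc)
  moreover have "op_prod (ptw capelli) ?cs A = 0"
  proof (rule slice_eqI)
    fix x
    have "euler_total (slice A x) = real i *\<^sub>R slice A x" using h by (metis slice_linear(3) slice_ptw)
    from op_prod_capelli_homogeneous[OF this]
    show "slice (op_prod (ptw capelli) ?cs A) x = slice 0 x" by (simp only: slice_op_prod slice_linear)
  qed
  ultimately obtain w where w: "\<And>c. c \<in> set ?cs \<Longrightarrow> w c \<in> ?Y
      \<and> ptw capelli (w c) = c *\<^sub>R w c" "A = (\<Sum>c\<in>set ?cs. w c)"
    using eigen_decomposition[OF lin, of ?Y ?cs A] A h by blast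
  have "A = (\<Sum>q\<le>i div 2. w (kappa i q))" unfolding w(2) set by (simp add: sum.reindex[OF inj])
  moreover have "\<forall>q\<le>i div 2. w (kappa i q) \<in> Sym i q"
    using w(1) unfolding set by (auto simp: Sym_def)
  ultimately show ?thesis by (intro exI[of _ "\<lambda>q. w (kappa i q)"]) simp
qed

lemma Sym_independent:
  assumes w: "\<And>q. q \<le> i div 2 \<Longrightarrow> w q \<in> Sym i q" and s:
      "(\<Sum>q\<in>Q. w q) = 0" and Q: "Q \<subseteq> {..i div 2}" and q: "q \<in> Q"
  shows "w q = 0"
proof (rule eigen_independent[OF linear_ptw[OF linear_capelli], where Q = Q and c = "kappa i"])
  show "finite Q" using Q finite_subset by blast
  show "ptw capelli (w q) = kappa i q *\<^sub>R w q" if "q \<in> Q" for q using w[of q] that Q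
      by (auto simp: Sym_def)
  show "inj_on (kappa i) Q"
  proof (rule inj_onI)
    fix q r assume "q \<in> Q" "r \<in> Q" "kappa i q = kappa i r"
    moreover from this Q have "q \<le> i div 2" "r \<le> i div 2" by auto
    then have "q + r \<le> i" by linarith
    ultimately show "q = r" using kappa_inj by blast
  qed
qed fact+

text \<open>
  The bihomogeneous parts of an eigenvector of the Capelli operator are eigenvectors, with
  values in \<open>V k l q\<close> by \<open>V_eq_isotypic\<close>, and they vanish for \<open>min k l < q\<close>.
\<close>

theorem S_ip_eq_Sym:
  assumes card2: "CARD('n::{finite,linorder}) \<ge> 2" and q: "q \<le> i div 2"
  shows "S_ip i q = (Sym i q :: 'n symbol set)"
proof
  have kl: "slice A x \<in> isotypic k (i - k) q" if "k \<in> {q..i - q}" "A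
      \<in> S_klq k (i - k) q" for A :: "'n symbol" and k x
    using that V_eq_isotypic[OF card2, of q k "i - k"] by (auto simp: S_klq_def slice_def)
  show "S_ip i q \<subseteq> (Sym i q :: 'n symbol set)"
  proof
    fix P :: "'n symbol" assume "P \<in> S_ip i q"
    then obtain R where R: "\<forall>k\<in>{q..i - q}. R k \<in> S_klq k (i - k) q" "P
        = (\<lambda>a b x. \<Sum>k\<in>{q..i - q}. R k a b x)"
      unfolding S_ip_def by blast
    have "R k \<in> Sym i q" if k: "k \<in> {q..i - q}" for k
    proof -
      have "slice (R k) x \<in> isotypic k (i - k) q" for x using kl R k by blast
      moreover have "R k \<in> symbols" using R k by (simp add: S_klq_def)
      ultimately show ?thesis using k
        by (auto simp: Sym_slice isotypic_kappa bihomogeneous_iff euler_total_def of_nat_diff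
            scaleR_left_distrib[symmetric])
    qed
    moreover have "P = (\<Sum>k\<in>{q..i - q}. R k)" unfolding R(2) by (simp add: fun_eq_iff)
    ultimately show "P \<in> Sym i q" using subspace_sum[OF subspace_Sym, of "{q..i - q}" R i q] by simp
  qed
  show "(Sym i q :: 'n symbol set) \<subseteq> S_ip i q"
  proof
    fix P :: "'n symbol" assume P: "P \<in> Sym i q"
    define R where "R k = ptw (bipart k (i - k)) P" for k
    have iso: "slice (R k) x \<in> isotypic k (i - k) q" if "k \<le> i" for k x
    proof -
      show ?thesis using P that
        by (simp add: R_def slice_ptw bipart_isotypic Sym_slice)
    qed
    have Rs: "R k \<in> symbols" for k unfolding R_def
        using const_opD(2)[OF const_op_bipart] Sym_symbols[OF P] by blast
    have mem: "R k \<in> S_klq k (i - k) q" if "k \<in> {q..i - q}" for k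
      using that Rs iso[of k] V_eq_isotypic[OF card2, of q k "i - k"] by (auto simp: S_klq_def slice_def)
    have zero: "R k = 0" if "k \<le> i" "k \<notin> {q..i - q}" for k
    proof (rule slice_eqI)
      fix x
      show "slice (R k) x = slice 0 x"
        unfolding slice_linear by (rule isotypic_zero[OF iso[OF that(1)]]) (use that q in auto)
    qed
    have "P = (\<Sum>k\<le>i. R k)"
    proof (rule slice_eqI)
      fix x
      have "euler_total (slice P x) = real i *\<^sub>R slice P x" using P by (simp add: Sym_slice)
      from sum_bipart[OF this] show "slice P x = slice (\<Sum>k\<le>i. R k) x"
          by (simp only: slice_linear R_def slice_ptw)
    qed
    also have "\<dots> = (\<Sum>k\<in>{q..i - q}. R k)"
      using zero by (intro sum.mono_neutral_right) auto
    finally have "P = (\<lambda>a b x. \<Sum>k\<in>{q..i - q}. R k a b x)" by (simp add: fun_eq_iff)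
    then show "P \<in> S_ip i q" unfolding S_ip_def using mem by blast
  qed
qed

section \<open>The types reached by the correction operators\<close>

lemma capelli_D_quadratic:
  fixes p :: "'n::{finite,linorder} bipoly"
  assumes h: "euler_total p = real i *\<^sub>R p" and c: "capelli p = kappa i q *\<^sub>R p"
    and F: "F = D_alpha j \<or> F = D_beta j"
  defines "c1 \<equiv> real q * (real i - real q)" and "c2 \<equiv> (real q - 1) * (real i + 1 - real q)"
  shows "capelli (capelli (F p)) = (c1 + c2) *\<^sub>R capelli (F p) - (c1 * c2) *\<^sub>R F p"
proof -
  have lin: "linear F" using F linear_weyl by auto
  let ?b = "\<lambda>k. bipart k (i - k) p"
  have b: "capelli (capelli (F (?b k))) = (c1 + c2) *\<^sub>R capelli (F (?b k))
      - (c1 * c2) *\<^sub>R F (?b k)" if "k \<le> i" for k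
  proof -
    have iso: "?b k \<in> isotypic k (i - k) q" by (rule bipart_isotypic[OF h c that])
    have ki: "real k + real (i - k) = real i" using that by simp
    have "euler_alpha (?b k) = real k *\<^sub>R ?b k" "euler_beta (?b k) = real (i - k) *\<^sub>R ?b k"
      "capelli (?b k) = (real q * (real k + real (i - k) + 1 - real q)) *\<^sub>R ?b k"
      using iso that by (simp_all add: isotypic_kappa bihomogeneous_iff kappa_def)
    from capelli_D_alpha_quadratic[OF this, of j] capelli_D_beta_quadratic[OF this, of j] F show
        ?thesis unfolding ki c1_def c2_def by auto
  qed
  have p: "p = (\<Sum>k\<le>i. ?b k)" by (rule sum_bipart[OF h])
  have "capelli (capelli (F (\<Sum>k\<le>i. ?b k)))
      = (c1 + c2) *\<^sub>R capelli (F (\<Sum>k\<le>i. ?b k)) - (c1 * c2) *\<^sub>R F (\<Sum>k\<le>i. ?b k)"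
    using b by (simp add: linear_sum[OF lin] linear_sum[OF linear_capelli] scaleR_sum_right sum_subtractf)
  then show ?thesis using p by simp
qed

lemma D_homogeneous:
  assumes h: "euler_total p = real i *\<^sub>R p" and F: "F = D_alpha j \<or> F = D_beta j"
  shows "euler_total (F p) = (real i - 1) *\<^sub>R F p"
proof -
  have "F (euler_total p) = euler_total (F p) + F p"
    using F by (auto simp: euler_total_def weyl_linear euler_commute_weyl)
  moreover have "F (euler_total p) = real i *\<^sub>R F p" unfolding h using F by (auto simp: weyl_linear)
  ultimately show ?thesis by (simp add: algebra_simps)
qed

text \<open>
  The polynomial of degree two in the Capelli operator that annihilates \<open>D\<^bsub>\<alpha>\<^sub>j\<^esub> A\<close> and \<open>D\<^bsub>\<beta>\<^sub>j\<^esub> A\<close>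
  has the eigenvalues of the types \<open>(i - 1, q)\<close> and \<open>(i - 1, q - 1)\<close> as its roots; the
  components of all other types are multiplied by nonzero numbers and so must vanish.

  The conditions on \<open>r\<close> keep the truncated subtraction \<open>i - 1\<close> harmless: for \<open>i = 0\<close> the
  index set is empty and the span is zero.
\<close>

lemma Sym_D:
  fixes A :: "'n::{finite,linorder} symbol"
  assumes A: "A \<in> Sym i q" and q: "q \<le> i div 2" and F: "F = D_alpha j \<or> F = D_beta j"
  shows "ptw F A \<in> span (\<Union>r\<in>{r. r \<le> (i - 1) div 2 \<and> 0 < i
      \<and> (r = q \<or> Suc r = q)}. Sym (i - 1) r)"
proof (cases "i = 0")
  case True
  have "ptw F A = 0"
  proof (rule slice_eqI)
    fix x
    have h: "euler_total (slice A x) = real 0 *\<^sub>R slice A x" using A True by (simp add: Sym_slice)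
    have "slice A x (a(j := Suc m)) b = 0" "slice A x a (b(j := Suc m)) = 0" for a b m
      using msize_upd_Suc[of a j m] msize_upd_Suc[of b j m]
          by (auto intro!: homogeneous_zero[OF h] simp del: fun_upd_apply)
    then have "F (slice A x) = 0" using F by (auto simp: D_alpha_def D_beta_def fun_eq_iff)
    then show "slice (ptw F A) x = slice 0 x" by (simp only: slice_ptw slice_linear)
  qed
  then show ?thesis by (simp add: span_zero)
next
  case False
  define c1 c2 where "c1 = real q * (real i - real q)" and "c2 = (real q - 1) * (real i + 1 - real q)"
  have "const_op F" using F const_op_D_alpha const_op_D_beta by auto
  then have B: "ptw F A \<in> symbols" using const_opD(2) Sym_symbols[OF A] by blast
  have "ptw euler_total (ptw F A) = real (i - 1) *\<^sub>R ptw F A"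
    using D_homogeneous[OF _ F] A False by (intro slice_eqI)
        (simp add: Sym_slice slice_ptw slice_linear of_nat_diff)
  then obtain w where w: "\<And>r. r \<le> (i - 1) div 2 \<Longrightarrow> w r \<in> Sym (i - 1) r"
      "ptw F A = (\<Sum>r\<le>(i - 1) div 2. w r)"
    using Sym_decompose[OF B] by blast
  let ?K = "ptw (capelli :: 'n bipoly \<Rightarrow> _)"
  have lin: "linear ?K" by (rule linear_ptw[OF linear_capelli])
  have K: "?K (w r) = kappa (i - 1) r *\<^sub>R w r" if "r \<le> (i - 1) div 2" for r
      using w(1)[OF that] by (simp add: Sym_def)
  have "?K (?K (ptw F A)) - (c1 + c2) *\<^sub>R ?K (ptw F A) + (c1 * c2) *\<^sub>R ptw F A = 0"
  proof (rule slice_eqI)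
    fix x
    have "euler_total (slice A x) = real i *\<^sub>R slice A x" "capelli (slice A x)
        = kappa i q *\<^sub>R slice A x"
      using A by (simp_all add: Sym_slice)
    note lb = capelli_D_quadratic[OF this F, folded c1_def c2_def]
    show "slice (?K (?K (ptw F A)) - (c1 + c2) *\<^sub>R ?K (ptw F A) + (c1 * c2) *\<^sub>R ptw F A) x
        = slice 0 x"
      unfolding slice_linear slice_ptw lb by (simp add: fun_eq_iff)
  qed
  moreover have "?K (?K (ptw F A)) - (c1 + c2) *\<^sub>R ?K (ptw F A) + (c1 * c2) *\<^sub>R ptw F A =
     (\<Sum>r\<le>(i - 1) div 2. ((kappa (i - 1) r - c1) * (kappa (i - 1) r - c2)) *\<^sub>R w r)"
  proof -
    have "?K (ptw F A) = (\<Sum>r\<le>(i - 1) div 2. kappa (i - 1) r *\<^sub>R w r)"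
      unfolding w(2) linear_sum[OF lin] using K by (intro sum.cong) auto
    moreover from this have "?K (?K (ptw F A))
        = (\<Sum>r\<le>(i - 1) div 2. kappa (i - 1) r *\<^sub>R kappa (i - 1) r *\<^sub>R w r)"
      using K by (simp add: linear_sum[OF lin] linear_scale[OF lin])
    ultimately show ?thesis unfolding w(2)
      by (simp only: scaleR_sum_right sum.distrib[symmetric] sum_subtractf[symmetric])
        (intro sum.cong refl, simp add: fun_eq_iff algebra_simps)
  qed
  ultimately have s: "(\<Sum>r\<le>(i - 1) div 2.
      ((kappa (i - 1) r - c1) * (kappa (i - 1) r - c2)) *\<^sub>R w r) = 0" by simp
  have w0: "w r = 0" if r: "r \<le> (i - 1) div 2" and ne: "\<not> (r = q \<or> Suc r = q)" for r
  proof -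
    have "((kappa (i - 1) r - c1) * (kappa (i - 1) r - c2)) *\<^sub>R w r = 0"
      by (rule Sym_independent[OF _ s]) (use w(1) r in \<open>auto intro: subspace_scale[OF subspace_Sym]\<close>)
    moreover have e: "kappa (i - 1) r - c1 = (real r - real q) * (real i - real r - real q)"
      "kappa (i - 1) r - c2 = (real r - (real q - 1)) * (real i + 1 - real r - real q)"
      using False by (simp_all add: kappa_def c1_def c2_def of_nat_diff algebra_simps)
    have "r + q < i" using r q False by linarith
    then have "real i - real r - real q \<noteq> 0" "real i + 1 - real r - real q \<noteq> 0" by linarith+
    moreover have "real r - real q \<noteq> 0" "real r - (real q - 1) \<noteq> 0" using ne by auto
    ultimately have "(kappa (i - 1) r - c1) * (kappa (i - 1) r - c2) \<noteq> 0"
        unfolding e mult_eq_0_iff by blast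
    with \<open>((kappa (i - 1) r - c1) * (kappa (i - 1) r - c2)) *\<^sub>R w r = 0\<close> show ?thesis
      unfolding scaleR_eq_0_iff by blast
  qed
  show ?thesis unfolding w(2)
  proof (rule span_sum)
    fix r assume "r \<in> {..(i - 1) div 2}"
    then show "w r \<in> span (\<Union>r\<in>{r. r \<le> (i - 1) div 2 \<and> 0 < i
        \<and> (r = q \<or> Suc r = q)}. Sym (i - 1) r)"
      using w0[of r] w(1)[of r] False by (cases "r = q \<or> Suc r = q") (auto intro!: span_base span_zero)
  qed
qed

lemma euler_total_euler:
  "euler_total (euler_alpha p) = euler_alpha (euler_total p)"
  "euler_total (euler_beta p) = euler_beta (euler_total p)"
  by (simp_all add: fun_eq_iff euler_total_apply euler_alpha_apply euler_beta_apply)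

lemma Sym_euler:
  assumes "A \<in> Sym i q" shows "ptw euler_alpha A \<in> Sym i q" "ptw euler_beta A \<in> Sym i q"
  using assms
  by (auto simp: Sym_slice slice_ptw const_opD(2) const_op_gl capelli_commute_euler gl_linear
      euler_total_euler)

text \<open>
  The Euler operators preserve the types, so \<open>corr\<close> moves them exactly as the derivatives
  do.
\<close>

lemma Sym_corr:
  fixes A :: "'n::{finite,linorder} symbol"
  assumes A: "A \<in> Sym i q" and q: "q \<le> i div 2"
  shows "ptw (corr w1 w2 j) A \<in> span (\<Union>r\<in>{r. r \<le> (i - 1) div 2 \<and> 0 < i
      \<and> (r = q \<or> Suc r = q)}. Sym (i - 1) r)"
proof -
  define N where "N = real CARD('n) + 1"
  have "ptw (corr w1 w2 j) A = - ptw (D_alpha j) (ptw euler_alpha A)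
      + (1 - N * w1) *\<^sub>R ptw (D_alpha j) A
     - ptw (D_beta j) (ptw euler_beta A) + (1 - N * w2) *\<^sub>R ptw (D_beta j) A"
  proof (rule slice_eqI)
    fix x
    have neg: "slice (- B) x = - slice B x" for B :: "'n symbol" by (simp add: slice_def fun_eq_iff)
    show "slice (ptw (corr w1 w2 j) A) x = slice
        (- ptw (D_alpha j) (ptw euler_alpha A) + (1 - N * w1) *\<^sub>R ptw (D_alpha j) A
     - ptw (D_beta j) (ptw euler_beta A) + (1 - N * w2) *\<^sub>R ptw (D_beta j) A) x"
      unfolding slice_linear slice_ptw neg corr_def euler_commute_weyl N_def
      by (simp add: fun_eq_iff algebra_simps)
  qed
  then show ?thesis
    using Sym_D[OF Sym_euler(1)[OF A] q disjI1[OF refl], of j]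
        Sym_D[OF Sym_euler(2)[OF A] q disjI2[OF refl], of j]
      Sym_D[OF A q disjI1[OF refl], of j] Sym_D[OF A q disjI2[OF refl], of j]
    by (simp only:) (intro span_add span_diff span_neg span_scale)
qed

text \<open>
  Operators that differentiate coefficients are additive only where the coefficients are
  differentiable, which excludes linearity on the whole type.
\<close>

definition lin_on_symbols :: "('n::{finite,linorder} symbol \<Rightarrow> 'n symbol) \<Rightarrow>
    bool" where
  "lin_on_symbols F \<longleftrightarrow> (\<forall>A\<in>symbols. \<forall>B\<in>symbols. F (A + B)
      = F A + F B) \<and> (\<forall>A\<in>symbols. \<forall>c. F (c *\<^sub>R A) = c *\<^sub>R F A)"

lemma lin_on_symbolsD:
  assumes "lin_on_symbols F"
  shows "A \<in> symbols \<Longrightarrow> B \<in> symbols \<Longrightarrow> F (A + B) = F A + F B"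
    "A \<in> symbols \<Longrightarrow> F (c *\<^sub>R A) = c *\<^sub>R F A"
    "F 0 = 0"
proof -
  show "A \<in> symbols \<Longrightarrow> B \<in> symbols \<Longrightarrow> F (A + B) = F A + F B" "A
      \<in> symbols \<Longrightarrow> F (c *\<^sub>R A) = c *\<^sub>R F A" for A B c
    using assms by (auto simp: lin_on_symbols_def)
  from this(2)[OF symbols_zero, of 0] show "F 0 = 0" by simp
qed

lemma lin_on_symbols_sum:
  assumes F: "lin_on_symbols F" and K: "\<And>k. k \<in> K \<Longrightarrow> R k \<in> symbols"
  shows "F (\<Sum>k\<in>K. R k) = (\<Sum>k\<in>K. F (R k))"
  using K
proof (induction K rule: infinite_finite_induct)
  case (insert k K)
  have "F (R k + sum R K) = F (R k) + F (sum R K)"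
    using insert.prems by (intro lin_on_symbolsD(1)[OF F] symbols_sum) auto
  moreover have "F (sum R K) = (\<Sum>k\<in>K. F (R k))" by (rule insert.IH) (use insert.prems in auto)
  ultimately show "F (sum R (insert k K)) = (\<Sum>k\<in>insert k K. F (R k))"
    by (simp only: sum.insert[OF insert.hyps])
next
  case (infinite K)
  show "F (sum R K) = (\<Sum>k\<in>K. F (R k))"
      by (simp only: sum.infinite[OF infinite(1)] lin_on_symbolsD(3)[OF F])
next
  case empty
  show "F (sum R {}) = (\<Sum>k\<in>{}. F (R k))" by (simp only: sum.empty lin_on_symbolsD(3)[OF F])
qed

lemma lin_on_symbols_lie_symbol: "lin_on_symbols (lie_symbol \<delta> (proj_field u M v))"
  unfolding lin_on_symbols_def
  by (intro conjI ballI allI slice_eqI)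
    (simp_all add: slice_lie_symbol slice_linear pd_linear gl_linear scaleR_add_right sum.distrib
      scaleR_diff_right scaleR_sum_right mult.commute mult.left_commute)

lemma lin_on_symbols_lie_form: "lin_on_symbols (lie_form w1 w2 \<delta> u M v)"
  unfolding lin_on_symbols_def
  by (intro conjI ballI allI slice_eqI)
    (simp_all add: slice_lie_form slice_linear pd_linear gl_linear corr_linear scaleR_add_right sum.distrib
      scaleR_diff_right scaleR_sum_right mult.commute mult.left_commute)

lemma lin_on_symbols_casimir_form: "lin_on_symbols (casimir_form w1 w2 \<delta>)"
  unfolding lin_on_symbols_def
  by (intro conjI ballI allI slice_eqI)
    (simp_all add: slice_casimir_form slice_linear pd_linear casimir_symbol_linear corr_linear
        scaleR_add_right sum.distrib
      scaleR_diff_right scaleR_sum_right mult.commute mult.left_commute)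

lemma Sym_lie_symbol:
  assumes A: "A \<in> Sym i q"
  shows "lie_symbol \<delta> (proj_field u M v) A \<in> Sym i q"
proof -
  have pd: "euler_total (slice (pd k A) x) = real i *\<^sub>R slice (pd k A) x"
    "capelli (slice (pd k A) x) = kappa i q *\<^sub>R slice (pd k A) x" for k x
    using Sym_pd[OF A, of k] by (simp_all add: Sym_slice)
  have sl: "euler_total (slice A x) = real i *\<^sub>R slice A x" "capelli (slice A x)
      = kappa i q *\<^sub>R slice A x" for x
    using A by (simp_all add: Sym_slice)
  have g: "euler_total (gl_unit k l (slice A x)) = real i *\<^sub>R gl_unit k l (slice A x)"
    "capelli (gl_unit k l (slice A x)) = kappa i q *\<^sub>R gl_unit k l (slice A x)" for k l x
    unfolding gl_unit_commute_euler_total[symmetric] gl_unit_commute_capelli[symmetric] sl gl_linear by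
        simp_all
  show ?thesis
    using symbols_lie_symbol[OF Sym_symbols[OF A]]
    by (simp add: Sym_slice slice_lie_symbol euler_total_linear gl_linear pd sl g scaleR_diff_right
        scaleR_add_right
       scaleR_sum_right mult.commute mult.left_commute)
qed

lemma casimir_symbol_Sym:
  fixes A :: "'n::{finite,linorder} symbol"
  assumes "A \<in> Sym i q"
  shows "ptw (casimir_symbol \<delta>) A = gamma_ip CARD('n) \<delta> i q *\<^sub>R A"
proof (rule slice_eqI)
  fix x
  have "euler_total (slice A x) = real i *\<^sub>R slice A x" "capelli (slice A x)
      = (real q * (real i + 1 - real q)) *\<^sub>R slice A x"
    using assms by (simp_all add: Sym_slice kappa_def)
  from casimir_symbol_eigen[OF this]
  show "slice (ptw (casimir_symbol \<delta>) A) x = slice (gamma_ip CARD('n) \<delta> i q *\<^sub>R A) x"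
    by (simp only: slice_ptw slice_linear)
qed

lemma span_Union_subspaces:
  assumes "finite I" "\<And>k. k \<in> I \<Longrightarrow> subspace (Vs k)"
  shows "x \<in> span (\<Union>k\<in>I. Vs k) \<longleftrightarrow>
      (\<exists>R. (\<forall>k\<in>I. R k \<in> Vs k) \<and> x = (\<Sum>k\<in>I. R k))"
proof
  assume "x \<in> span (\<Union>k\<in>I. Vs k)"
  then show "\<exists>R. (\<forall>k\<in>I. R k \<in> Vs k) \<and> x = (\<Sum>k\<in>I. R k)"
  proof (induction rule: span_induct_alt)
    case base
    show ?case using assms(2) by (intro exI[of _ "\<lambda>_. 0"]) (auto intro: subspace_0)
  next
    case (step c y z)
    then obtain k R where k: "k \<in> I" "y \<in> Vs k" and R: "\<forall>k\<in>I. R k \<in> Vs k" "z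
        = (\<Sum>k\<in>I. R k)" by auto
    let ?R = "R(k := c *\<^sub>R y + R k)"
    have "(\<Sum>k\<in>I. ?R k) = c *\<^sub>R y + z"
      using k assms(1) unfolding R(2) by (simp add: sum.remove[of I k])
    moreover have "\<forall>k\<in>I. ?R k \<in> Vs k"
      using k R assms(2) by (auto intro!: subspace_add subspace_scale)
    ultimately show ?case by (intro exI[of _ ?R]) auto
  qed
next
  assume "\<exists>R. (\<forall>k\<in>I. R k \<in> Vs k) \<and> x = (\<Sum>k\<in>I. R k)"
  then show "x \<in> span (\<Union>k\<in>I. Vs k)" by (auto intro!: span_sum intro: span_base)
qed

definition hpart :: "nat \<Rightarrow> 'n::{finite,linorder} symbol \<Rightarrow> 'n symbol" where
  "hpart d A = (\<lambda>a b. if msize a + msize b = d then A a b else 0)"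

lemma linear_hpart: "linear (hpart d)"
  by (auto intro!: linearI simp: hpart_def fun_eq_iff)

lemma Sym_degree: "A \<in> Sym i q \<Longrightarrow> msize a + msize b \<noteq> i
    \<Longrightarrow> A a b = 0"
proof (rule ext)
  fix x assume "A \<in> Sym i q" "msize a + msize b \<noteq> i"
  then show "A a b x = 0 x" using homogeneous_zero[of "slice A x" i a b] by (auto simp: Sym_slice slice_def)
qed

lemma hpart_Sym: "A \<in> Sym i q \<Longrightarrow> hpart d A = (if d = i then A else 0)"
  by (intro ext) (auto simp: hpart_def Sym_degree)

section \<open>The triangular form of the Casimir operator\<close>

lemma tilde_indexD:
  assumes "(j, q) \<in> tilde_index i p" shows "j \<le> i" "q \<le> p" "q \<le> j div 2" "p - q \<le> i - j"
  using assms by (auto simp: tilde_index_def)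

lemma finite_tilde_index: "finite (tilde_index i p)"
  by (rule finite_subset[of _ "{..i} \<times> {..p}"]) (auto dest: tilde_indexD)

text \<open>
  The filtration of \<open>S_tilde i p\<close> by the degree: \<open>d = i + 1\<close> gives the whole space
  (\<open>S_tilde_eq\<close>), and \<open>d = i\<close> gives all components but the top one of type \<open>(i, p)\<close>.
\<close>

definition tilde_below :: "nat \<Rightarrow> nat \<Rightarrow> nat \<Rightarrow> 'n::{finite,linorder}
    symbol set" where
  "tilde_below i p d = span (\<Union>jq\<in>{jq \<in> tilde_index i p. fst jq < d}. Sym (fst jq) (snd jq))"

lemma subspace_tilde_below: "subspace (tilde_below i p d)"
  by (simp add: tilde_below_def)

lemma Sym_tilde_below: "(j, q) \<in> tilde_index i p \<Longrightarrow> j < d \<Longrightarrow> A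
    \<in> Sym j q \<Longrightarrow> A \<in> tilde_below i p d"
  unfolding tilde_below_def by (rule span_base) force

lemma tilde_below_mono: "d \<le> d' \<Longrightarrow> tilde_below i p d \<subseteq> tilde_below i p d'"
  unfolding tilde_below_def by (rule span_mono) auto

lemma tilde_below_monoD: "A \<in> tilde_below i p d \<Longrightarrow> d \<le> d' \<Longrightarrow> A
    \<in> tilde_below i p d'"
  using tilde_below_mono by blast

lemma tilde_below_induct [consumes 1, case_names subspace Sym]:
  assumes "A \<in> tilde_below i p d" "subspace Y"
    "\<And>j q A. (j, q) \<in> tilde_index i p \<Longrightarrow> j < d \<Longrightarrow> A
        \<in> Sym j q \<Longrightarrow> A \<in> Y"
  shows "A \<in> Y"
proof -
  have "tilde_below i p d \<subseteq> Y"
    unfolding tilde_below_def using assms(2,3) by (intro span_minimal) auto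
  with assms(1) show ?thesis by blast
qed

lemma tilde_below_symbols: "A \<in> tilde_below i p d \<Longrightarrow> A \<in> symbols"
  by (erule tilde_below_induct) (auto intro: subspace_symbols Sym_symbols)

lemma tilde_below_hpart: "A \<in> tilde_below i p d \<Longrightarrow> d \<le> e
    \<Longrightarrow> hpart e A = 0"
proof -
  assume A: "A \<in> tilde_below i p d" and "d \<le> e"
  have "A \<in> {A. hpart e A = 0}"
    using A
  proof (rule tilde_below_induct)
    show "subspace {A :: 'a symbol. hpart e A = 0}"
      by (auto simp: subspace_def linear_0[OF linear_hpart] linear_add[OF linear_hpart]
          linear_scale[OF linear_hpart])
    fix j q and B :: "'a symbol" assume "j < d" "B \<in> Sym j q"
    then show "B \<in> {A. hpart e A = 0}" using \<open>d \<le> e\<close> hpart_Sym[of B j q e] by simp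
  qed
  then show ?thesis by simp
qed

lemma tilde_below_0: "tilde_below i p 0 = {0}"
  by (simp add: tilde_below_def)

lemma tilde_below_Suc:
  fixes A :: "'n::{finite,linorder} symbol"
  assumes "A \<in> tilde_below i p (Suc d)"
  obtains R A' where "\<And>q. (d, q) \<in> tilde_index i p \<Longrightarrow> R q \<in> Sym d q" "A'
      \<in> tilde_below i p d"
    "A = (\<Sum>q | (d, q) \<in> tilde_index i p. R q) + A'"
proof -
  let ?Q = "{q. (d, q) \<in> tilde_index i p}"
  have Q: "finite ?Q" by (rule finite_subset[of _ "{..p}"]) (auto dest: tilde_indexD)
  have "(\<Union>jq\<in>{jq \<in> tilde_index i p. fst jq < Suc d}. Sym (fst jq) (snd jq)) =
    (\<Union>q\<in>?Q. Sym d q :: 'n symbol set) \<union>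
        (\<Union>jq\<in>{jq \<in> tilde_index i p. fst jq < d}. Sym (fst jq) (snd jq))"
    by (auto simp: less_Suc_eq intro: rev_bexI)
  then have "A \<in> span ((\<Union>q\<in>?Q. Sym d q) \<union>
      (\<Union>jq\<in>{jq \<in> tilde_index i p. fst jq < d}. Sym (fst jq) (snd jq)))"
    using assms by (simp add: tilde_below_def)
  then obtain A1 A2 where A: "A = A1 + A2" "A1 \<in> span (\<Union>q\<in>?Q. Sym d q)" "A2
      \<in> tilde_below i p d"
    unfolding span_Un tilde_below_def by blast
  from A(2) obtain R where "\<forall>q\<in>?Q. R q \<in> Sym d q" "A1 = (\<Sum>q\<in>?Q. R q)"
    unfolding span_Union_subspaces[OF Q subspace_Sym] by blast
  then show ?thesis using A(1,3) by (intro that[of R A2]) auto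
qed

lemma lin_on_symbols_preserves_tilde_below:
  fixes F :: "'n::{finite,linorder} symbol \<Rightarrow> 'n symbol"
  assumes F: "lin_on_symbols F" and A: "A \<in> tilde_below i p d"
    and gen: "\<And>j q A. (j, q) \<in> tilde_index i p \<Longrightarrow> A \<in> Sym j q
        \<Longrightarrow> F A \<in> tilde_below i p (Suc j)"
  shows "F A \<in> tilde_below i p d"
proof -
  let ?Y = "{A \<in> symbols. F A \<in> tilde_below i p d}"
  have "A \<in> ?Y" using A
  proof (rule tilde_below_induct)
    show "subspace ?Y"
      using subspace_symbols subspace_tilde_below[of i p d] lin_on_symbolsD[OF F]
      by (auto simp: subspace_def)
    fix j q and B :: "'n symbol" assume B: "(j, q) \<in> tilde_index i p" "j < d" "B \<in> Sym j q"
    then show "B \<in> ?Y"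
      using tilde_below_monoD[OF gen[OF B(1,3)], of d] Sym_symbols[OF B(3)] by simp
  qed
  then show ?thesis by simp
qed

text \<open>
  The inequalities \<open>0 \<le> p - q \<le> i - j\<close> survive the moves to \<open>(j - 1, q)\<close> and
  \<open>(j - 1, q - 1)\<close>: both increase \<open>i - j\<close> by one and \<open>p - q\<close> by at most one.
\<close>

lemma corr_tilde_below:
  fixes A :: "'n::{finite,linorder} symbol"
  assumes jq: "(j, q) \<in> tilde_index i p" and A: "A \<in> Sym j q"
  shows "ptw (corr w1 w2 k) A \<in> tilde_below i p j"
proof -
  have "(\<Union>r\<in>{r. r \<le> (j - 1) div 2 \<and> 0 < j \<and> (r = q \<or> Suc r = q)}. Sym
      (j - 1) r :: 'n symbol set) \<subseteq> tilde_below i p j"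
  proof (rule subsetI)
    fix B :: "'n symbol" assume "B \<in> (\<Union>r\<in>{r. r \<le> (j - 1) div 2 \<and> 0 < j
        \<and> (r = q \<or> Suc r = q)}. Sym (j - 1) r)"
    then obtain r where r: "r \<le> (j - 1) div 2" "0 < j" "r = q \<or> Suc r = q" and B: "B
        \<in> Sym (j - 1) r" by auto
    have "(j - 1, r) \<in> tilde_index i p" using jq r by (auto simp: tilde_index_def)
    then show "B \<in> tilde_below i p j" using B r(2) by (intro Sym_tilde_below) auto
  qed
  then have "span (\<Union>r\<in>{r. r \<le> (j - 1) div 2 \<and> 0 < j
      \<and> (r = q \<or> Suc r = q)}. Sym (j - 1) r :: 'n symbol set) \<subseteq> tilde_below i p j"
    by (intro span_minimal subspace_tilde_below)
  with Sym_corr[OF A tilde_indexD(3)[OF jq]] show ?thesis by blast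
qed

text \<open>
  The triangular form: \<open>\<gamma>\<^bsub>j,q\<^esub>\<close> on the diagonal, strictly lower degrees off the diagonal.
\<close>

lemma casimir_form_Sym:
  fixes A :: "'n::{finite,linorder} symbol"
  assumes jq: "(j, q) \<in> tilde_index i p" and A: "A \<in> Sym j q"
  shows "casimir_form w1 w2 \<delta> A - gamma_ip CARD('n) \<delta> j q *\<^sub>R A \<in> tilde_below i p j"
proof -
  have "(\<Sum>k\<in>UNIV. ptw (corr w1 w2 k) (pd k A)) \<in> tilde_below i p j"
    by (intro subspace_sum[OF subspace_tilde_below] corr_tilde_below[OF jq Sym_pd[OF A]])
  then show ?thesis
    unfolding casimir_form_def casimir_symbol_Sym[OF A]
    using subspace_scale[OF subspace_tilde_below, of _ i p j "-2"] by simp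
qed

lemma Sym_casimir_tilde_below:
  fixes A :: "'n::{finite,linorder} symbol"
  assumes jq: "(j, q) \<in> tilde_index i p" and A: "A \<in> Sym j q"
  shows "casimir_form w1 w2 \<delta> A \<in> tilde_below i p (Suc j)"
proof -
  have "casimir_form w1 w2 \<delta> A - gamma_ip CARD('n) \<delta> j q *\<^sub>R A
      \<in> tilde_below i p (Suc j)"
    by (rule tilde_below_monoD[OF casimir_form_Sym[OF jq A]]) simp
  moreover have "gamma_ip CARD('n) \<delta> j q *\<^sub>R A \<in> tilde_below i p (Suc j)"
    by (intro subspace_scale[OF subspace_tilde_below] Sym_tilde_below[OF jq _ A]) simp
  ultimately show ?thesis using subspace_add[OF subspace_tilde_below] by force
qed

lemma casimir_form_tilde_below: "A \<in> tilde_below i p d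
    \<Longrightarrow> casimir_form w1 w2 \<delta> A \<in> tilde_below i p d"
  by (rule lin_on_symbols_preserves_tilde_below[OF lin_on_symbols_casimir_form _ Sym_casimir_tilde_below])

lemma lie_form_Sym:
  assumes jq: "(j, q) \<in> tilde_index i p" and A: "A \<in> Sym j q"
  shows "lie_form w1 w2 \<delta> u M v A - lie_symbol \<delta> (proj_field u M v) A \<in> tilde_below i p j"
proof -
  have "(\<Sum>k\<in>UNIV. v $ k *\<^sub>R ptw (corr w1 w2 k) A) \<in> tilde_below i p j"
    by (intro subspace_sum[OF subspace_tilde_below] subspace_scale[OF subspace_tilde_below]
        corr_tilde_below[OF jq A])
  then show ?thesis unfolding lie_form_def by simp
qed

lemma Sym_lie_form_tilde_below:
  assumes jq: "(j, q) \<in> tilde_index i p" and A: "A \<in> Sym j q"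
  shows "lie_form w1 w2 \<delta> u M v A \<in> tilde_below i p (Suc j)"
proof -
  have "lie_form w1 w2 \<delta> u M v A - lie_symbol \<delta> (proj_field u M v) A
      \<in> tilde_below i p (Suc j)"
    by (rule tilde_below_monoD[OF lie_form_Sym[OF jq A]]) simp
  moreover have "lie_symbol \<delta> (proj_field u M v) A \<in> tilde_below i p (Suc j)"
    by (intro Sym_tilde_below[OF jq _ Sym_lie_symbol[OF A]]) simp
  ultimately show ?thesis using subspace_add[OF subspace_tilde_below] by force
qed

lemma lie_form_tilde_below: "A \<in> tilde_below i p d
    \<Longrightarrow> lie_form w1 w2 \<delta> u M v A \<in> tilde_below i p d"
  by (rule lin_on_symbols_preserves_tilde_below[OF lin_on_symbols_lie_form _ Sym_lie_form_tilde_below])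

lemma noncritical_gamma:
  assumes "\<not> critical n \<delta>" "p \<le> i div 2" "(j, q) \<in> tilde_index i p" "j < i"
  shows "gamma_ip n \<delta> j q \<noteq> gamma_ip n \<delta> i p"
  using assms unfolding critical_def tilde_index_def by force

text \<open>
  Solve for the component of highest degree by dividing by the difference of the diagonal
  entries, and apply the induction hypothesis to the error, which has lower degree.
\<close>

lemma casimir_form_solvable:
  fixes B :: "'n::{finite,linorder} symbol"
  assumes nc: "\<not> critical CARD('n) \<delta>" and p: "p \<le> i div 2" and "d \<le> i" "B
      \<in> tilde_below i p d"
  shows "\<exists>A\<in>tilde_below i p d. casimir_form w1 w2 \<delta> A
      - gamma_ip CARD('n) \<delta> i p *\<^sub>R A = B"
  using assms(3,4)
proof (induction d arbitrary: B)
  case 0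
  then have "B = 0" using tilde_below_0 by blast
  moreover have "casimir_form w1 w2 \<delta> 0 - gamma_ip CARD('n) \<delta> i p *\<^sub>R 0
      = (0 :: 'n symbol)"
    by (simp only: lin_on_symbolsD(3)[OF lin_on_symbols_casimir_form] scaleR_zero_right diff_self)
  ultimately show ?case using subspace_0[OF subspace_tilde_below] by blast
next
  case (Suc d)
  let ?T = "\<lambda>A. casimir_form w1 w2 \<delta> A - gamma_ip CARD('n) \<delta> i p *\<^sub>R A"
  let ?W = "tilde_below i p (Suc d) :: 'n symbol set"
  let ?Y = "{B. \<exists>A\<in>?W. ?T A = B}"
  note cas = lin_on_symbolsD[OF lin_on_symbols_casimir_form]
  note W = subspace_tilde_below[of i p "Suc d"]
  have T_add: "?T (A + A') = ?T A + ?T A'" if "A \<in> ?W" "A' \<in> ?W" for A A'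
    using that[THEN tilde_below_symbols] by (simp add: cas scaleR_add_right)
  have T_scale: "?T (c *\<^sub>R A) = c *\<^sub>R ?T A" if "A \<in> ?W" for A c
    using that[THEN tilde_below_symbols] by (simp add: cas scaleR_diff_right mult.commute)
  have sub: "subspace ?Y"
    unfolding subspace_def
  proof safe
    show "\<exists>A\<in>?W. ?T A = 0" by (rule bexI[OF _ subspace_0[OF W]]) (simp add: cas)
    show "\<exists>C\<in>?W. ?T C = ?T A + ?T A'" if "A \<in> ?W" "A' \<in> ?W" for A A'
      using T_add[OF that] subspace_add[OF W that] by blast
    show "\<exists>C\<in>?W. ?T C = c *\<^sub>R ?T A" if "A \<in> ?W" for A c
      using T_scale[OF that] subspace_scale[OF W that] by blast
  qed
  \<comment> \<open>the solvable right-hand sides form a subspace, so a single type \<open>(j, q)\<close> suffices\<close>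
  have "B \<in> ?Y" using Suc.prems(2)
  proof (rule tilde_below_induct[OF _ sub])
    fix j q and C :: "'n symbol" assume jq: "(j, q) \<in> tilde_index i p" "j < Suc d" and C: "C
        \<in> Sym j q"
    define g where "g = gamma_ip CARD('n) \<delta> j q - gamma_ip CARD('n) \<delta> i p"
    have g: "g \<noteq> 0" using noncritical_gamma[OF nc p jq(1)] jq(2) Suc.prems(1) by (simp add: g_def)
    define A1 where "A1 = (1 / g) *\<^sub>R C"
    have A1: "A1 \<in> Sym j q" unfolding A1_def by (intro subspace_scale[OF subspace_Sym] C)
    define E where "E = casimir_form w1 w2 \<delta> A1 - gamma_ip CARD('n) \<delta> j q *\<^sub>R A1"
    have "E \<in> tilde_below i p d"
      using tilde_below_monoD[OF casimir_form_Sym[OF jq(1) A1], of d] jq(2) unfolding E_def by simp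
    then have "- E \<in> tilde_below i p d" by (rule subspace_neg[OF subspace_tilde_below])
    moreover have "d \<le> i" using Suc.prems(1) by simp
    ultimately have "\<exists>A2\<in>tilde_below i p d. ?T A2 = - E" by (rule Suc.IH[rotated])
    then obtain A2 where A2: "A2 \<in> tilde_below i p d" "?T A2 = - E" by blast
    have A2': "A2 \<in> ?W" using tilde_below_monoD[OF A2(1), of "Suc d"] by simp
    have A1': "A1 \<in> ?W" by (rule Sym_tilde_below[OF jq A1])
    have "?T A1 = g *\<^sub>R A1 + E" by (simp add: E_def g_def scaleR_diff_left)
    then have "?T (A1 + A2) = g *\<^sub>R A1" using T_add[OF A1' A2'] A2(2) by simp
    also have "\<dots> = C" using g by (simp add: A1_def)
    finally show "C \<in> ?Y" using subspace_add[OF W A1' A2'] by blast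
  qed
  then show ?case by blast
qed

text \<open>
  In the component of highest degree an eigenvector for \<open>\<gamma>\<^bsub>i,p\<^esub>\<close> satisfies
  \<open>\<Sum>\<^sub>q (\<gamma>\<^bsub>d,q\<^esub> - \<gamma>\<^bsub>i,p\<^esub>) R\<^sub>q = 0\<close>; types are independent and the factors do not vanish.
\<close>

lemma casimir_form_unique:
  fixes A :: "'n::{finite,linorder} symbol"
  assumes nc: "\<not> critical CARD('n) \<delta>" and p: "p \<le> i div 2"
    and "d \<le> i" "A \<in> tilde_below i p d" "casimir_form w1 w2 \<delta> A
        = gamma_ip CARD('n) \<delta> i p *\<^sub>R A"
  shows "A = 0"
  using assms(3,4)
proof (induction d)
  case 0
  then show ?case by (simp add: tilde_below_0)
next
  case (Suc d)
  let ?g = "gamma_ip CARD('n) \<delta>" and ?Q = "{q. (d, q) \<in> tilde_index i p}"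
  obtain R A' where R: "\<And>q. (d, q) \<in> tilde_index i p \<Longrightarrow> R q \<in> Sym d q"
      and A': "A' \<in> tilde_below i p d"
    and A: "A = (\<Sum>q\<in>?Q. R q) + A'"
    using tilde_below_Suc[OF Suc.prems(2)] by blast
  have Rs: "R q \<in> symbols" if "q \<in> ?Q" for q using R that Sym_symbols by blast
  \<comment> \<open>\<open>?S\<close> has degree \<open>d\<close> and \<open>?E\<close> has lower degree, so \<open>?S + ?E = 0\<close> forces \<open>?S = 0\<close>\<close>
  let ?S = "\<Sum>q\<in>?Q. (?g d q - ?g i p) *\<^sub>R R q"
  let ?E = "(\<Sum>q\<in>?Q. casimir_form w1 w2 \<delta> (R q) - ?g d q *\<^sub>R R q)
      + (casimir_form w1 w2 \<delta> A' - ?g i p *\<^sub>R A')"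
  have "casimir_form w1 w2 \<delta> A = (\<Sum>q\<in>?Q. casimir_form w1 w2 \<delta> (R q))
      + casimir_form w1 w2 \<delta> A'"
  proof -
    have "(\<Sum>q\<in>?Q. R q) \<in> symbols" by (rule symbols_sum) (rule Rs)
    then have "casimir_form w1 w2 \<delta> A = casimir_form w1 w2 \<delta> (\<Sum>q\<in>?Q. R q)
        + casimir_form w1 w2 \<delta> A'"
      unfolding A by (rule lin_on_symbolsD(1)[OF lin_on_symbols_casimir_form _ tilde_below_symbols[OF A']])
    moreover have "casimir_form w1 w2 \<delta> (\<Sum>q\<in>?Q. R q)
        = (\<Sum>q\<in>?Q. casimir_form w1 w2 \<delta> (R q))"
      by (rule lin_on_symbols_sum[OF lin_on_symbols_casimir_form]) (rule Rs)
    ultimately show ?thesis by simp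
  qed
  then have "?S + ?E = casimir_form w1 w2 \<delta> A - ?g i p *\<^sub>R A"
    unfolding A by (simp add: scaleR_diff_left sum_subtractf scaleR_add_right scaleR_sum_right)
  then have SE: "?S + ?E = 0" using assms(5) by simp
  have "?E \<in> tilde_below i p d"
    by (intro subspace_add[OF subspace_tilde_below] subspace_sum[OF subspace_tilde_below]
      subspace_diff[OF subspace_tilde_below] subspace_scale[OF subspace_tilde_below] A'
          casimir_form_tilde_below
      casimir_form_Sym R) auto
  then have "hpart d ?E = 0" using tilde_below_hpart by blast
  moreover have "hpart d ?S = ?S"
    unfolding linear_sum[OF linear_hpart] linear_scale[OF linear_hpart]
    by (rule sum.cong) (use hpart_Sym[OF R] in auto)
  moreover have "hpart d (?S + ?E) = hpart d ?S + hpart d ?E" by (rule linear_add[OF linear_hpart])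
  ultimately have S: "?S = 0" unfolding SE linear_0[OF linear_hpart] by simp
  have "R q = 0" if q: "q \<in> ?Q" for q
  proof -
    have "(\<lambda>q. if q \<in> ?Q then (?g d q - ?g i p) *\<^sub>R R q else 0) q = 0"
    proof (rule Sym_independent[where Q = ?Q and i = d])
      show "(if q \<in> ?Q then (?g d q - ?g i p) *\<^sub>R R q else 0) \<in> Sym d q" for q
        using R by (auto intro: subspace_scale[OF subspace_Sym] subspace_0[OF subspace_Sym])
      show "(\<Sum>q\<in>?Q. if q \<in> ?Q then (?g d q - ?g i p) *\<^sub>R R q else 0) = 0" using S by simp
      show "?Q \<subseteq> {..d div 2}" by (auto dest: tilde_indexD)
    qed (rule q)
    moreover have "?g d q \<noteq> ?g i p" using noncritical_gamma[OF nc p, of d q] q Suc.prems(1) by auto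
    ultimately show ?thesis using q by simp
  qed
  then have "A = A'" unfolding A by simp
  then show ?case using Suc.IH Suc.prems(1) A' by simp
qed

section \<open>Eigenvectors with a given principal symbol\<close>

lemma tilde_top:
  assumes p: "p \<le> i div 2" and A: "A \<in> tilde_below i p (Suc i)"
  shows "hpart i A \<in> Sym i p" "A - hpart i A \<in> tilde_below i p i"
proof -
  obtain R A' where R: "\<And>q. (i, q) \<in> tilde_index i p \<Longrightarrow> R q \<in> Sym i q"
      and A': "A' \<in> tilde_below i p i"
    and A: "A = (\<Sum>q | (i, q) \<in> tilde_index i p. R q) + A'"
    using tilde_below_Suc[OF A] by blast
  have ii: "{q. (i, q) \<in> tilde_index i p} = {p}" using p by (auto simp: tilde_index_def)
  then have ip: "R p \<in> Sym i p" using R by blast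
  have A: "A = R p + A'" using A unfolding ii by simp
  have "hpart i A = R p"
    unfolding A linear_add[OF linear_hpart] using hpart_Sym[OF ip, of i] tilde_below_hpart[OF A', of i]
        by simp
  then show "hpart i A \<in> Sym i p" "A - hpart i A \<in> tilde_below i p i" using ip A' A by simp_all
qed

lemma tilde_index_self: "p \<le> i div 2 \<Longrightarrow> (i, p) \<in> tilde_index i p"
  by (simp add: tilde_index_def)

text \<open>
  The conditions on the polynomial form of \<open>Q(P)\<close>, with the eigenvalue and the degree made
  explicit; \<open>is_eigen_lift_iff\<close> shows that they are forced.
\<close>

definition is_symbol_lift :: "real \<Rightarrow> real \<Rightarrow> real \<Rightarrow> nat
    \<Rightarrow> nat \<Rightarrow> 'n symbol \<Rightarrow> 'n::{finite,linorder} symbol \<Rightarrow>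
    bool" where
  "is_symbol_lift w1 w2 \<delta> i p P A \<longleftrightarrow> A \<in> tilde_below i p (Suc i)
      \<and> hpart i A = P \<and>
     casimir_form w1 w2 \<delta> A = gamma_ip CARD('n) \<delta> i p *\<^sub>R A"

text \<open>
  The error of \<open>P\<close> as an eigenvector has lower degree and can be corrected there.
\<close>

lemma symbol_lift_exists:
  fixes P :: "'n::{finite,linorder} symbol"
  assumes nc: "\<not> critical CARD('n) \<delta>" and p: "p \<le> i div 2" and P: "P \<in> Sym i p"
  shows "\<exists>A. is_symbol_lift w1 w2 \<delta> i p P A"
proof -
  let ?g = "gamma_ip CARD('n) \<delta> i p"
  note ip = tilde_index_self[OF p]
  define E where "E = casimir_form w1 w2 \<delta> P - ?g *\<^sub>R P"
  have "- E \<in> tilde_below i p i"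
    unfolding E_def by (intro subspace_neg[OF subspace_tilde_below] casimir_form_Sym[OF ip P])
  then obtain A2 where A2: "A2 \<in> tilde_below i p i" "casimir_form w1 w2 \<delta> A2
      - ?g *\<^sub>R A2 = - E"
    using casimir_form_solvable[OF nc p order_refl] by blast
  have "P + A2 \<in> tilde_below i p (Suc i)"
    by (intro subspace_add[OF subspace_tilde_below] Sym_tilde_below[OF ip _ P]
        tilde_below_monoD[OF A2(1)]) auto
  moreover have "hpart i (P + A2) = P"
    unfolding linear_add[OF linear_hpart] using hpart_Sym[OF P, of i] tilde_below_hpart[OF A2(1), of i]
        by simp
  moreover have "casimir_form w1 w2 \<delta> (P + A2) = ?g *\<^sub>R (P + A2)"
  proof -
    have "casimir_form w1 w2 \<delta> (P + A2) = casimir_form w1 w2 \<delta> P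
        + casimir_form w1 w2 \<delta> A2"
      by (rule lin_on_symbolsD(1)[OF lin_on_symbols_casimir_form Sym_symbols[OF P]
          tilde_below_symbols[OF A2(1)]])
    also have "casimir_form w1 w2 \<delta> A2 = ?g *\<^sub>R A2 - E" using A2(2)
        by (simp add: algebra_simps)
    also have "casimir_form w1 w2 \<delta> P + (?g *\<^sub>R A2 - E) = ?g *\<^sub>R (P + A2)"
    proof -
      have "X + (Y - (X - Z)) = Z + Y" for X Y Z :: "'n symbol" by simp
      then show ?thesis by (simp only: E_def scaleR_add_right)
    qed
    finally show ?thesis .
  qed
  ultimately show ?thesis unfolding is_symbol_lift_def by blast
qed

lemma symbol_lift_unique:
  fixes A B :: "'n::{finite,linorder} symbol"
  assumes nc: "\<not> critical CARD('n) \<delta>" and p: "p \<le> i div 2"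
    and A: "is_symbol_lift w1 w2 \<delta> i p P A" and B: "is_symbol_lift w1 w2 \<delta> i p P B"
  shows "A = B"
proof -
  let ?g = "gamma_ip CARD('n) \<delta> i p"
  have s: "A \<in> symbols" "B \<in> symbols" using A B tilde_below_symbols
      unfolding is_symbol_lift_def by blast+
  note cas = lin_on_symbolsD[OF lin_on_symbols_casimir_form[of w1 w2 \<delta>]]
  have "hpart i (A - B) = 0"
    using A B unfolding is_symbol_lift_def linear_diff[OF linear_hpart] by simp
  moreover have "A - B \<in> tilde_below i p (Suc i)"
    using A B unfolding is_symbol_lift_def by (intro subspace_diff[OF subspace_tilde_below]) auto
  ultimately have "A - B \<in> tilde_below i p i" using tilde_top(2)[OF p, of "A - B"] by simp
  moreover have "casimir_form w1 w2 \<delta> (A - B) = ?g *\<^sub>R (A - B)"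
  proof -
    have "casimir_form w1 w2 \<delta> (A + (-1) *\<^sub>R B) = casimir_form w1 w2 \<delta> A
        + (-1) *\<^sub>R casimir_form w1 w2 \<delta> B"
      using cas(1)[OF s(1) symbols_scale[OF s(2)], of "-1"] cas(2)[OF s(2), of "-1"] by simp
    then show ?thesis using A B unfolding is_symbol_lift_def by (simp add: scaleR_diff_right)
  qed
  ultimately have "A - B = 0" using casimir_form_unique[OF nc p order_refl] by blast
  then show ?thesis by simp
qed

text \<open>
  The Lie derivative commutes with the Casimir operator, preserves \<open>S_tilde i p\<close>, and acts
  on the top component as on symbols. By uniqueness this is the equivariance of \<open>Q\<close> on a
  single type.
\<close>

lemma symbol_lift_lie_form:
  fixes A :: "'n::{finite,linorder} symbol"
  assumes p: "p \<le> i div 2" and A: "is_symbol_lift w1 w2 \<delta> i p P A"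
  shows "is_symbol_lift w1 w2 \<delta> i p (lie_symbol \<delta> (proj_field u M v) P)
      (lie_form w1 w2 \<delta> u M v A)"
proof -
  let ?L = "lie_form w1 w2 \<delta> u M v" and ?l = "lie_symbol \<delta> (proj_field u M v)"
  have A': "A \<in> tilde_below i p (Suc i)" "hpart i A = P" "casimir_form w1 w2 \<delta> A
      = gamma_ip CARD('n) \<delta> i p *\<^sub>R A"
    using A by (auto simp: is_symbol_lift_def)
  have P: "P \<in> Sym i p" and A2: "A - P \<in> tilde_below i p i" using tilde_top[OF p A'(1)] A'(2)
      by auto
  note L = lin_on_symbolsD[OF lin_on_symbols_lie_form[of w1 w2 \<delta> u M v]]
  have sA: "A \<in> symbols" using A'(1) tilde_below_symbols by blast
  have "?L A = ?L (P + (A - P))" by simp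
  also have "\<dots> = ?L P + ?L (A - P)" by (rule L(1)[OF Sym_symbols[OF P] tilde_below_symbols[OF A2]])
  finally have e: "?L A = ?l P + ((?L P - ?l P) + ?L (A - P))" by simp
  have "(?L P - ?l P) + ?L (A - P) \<in> tilde_below i p i"
    by (intro subspace_add[OF subspace_tilde_below] lie_form_Sym[OF tilde_index_self[OF p] P]
        lie_form_tilde_below A2)
  then have "hpart i (?L A) = ?l P"
    unfolding e linear_add[OF linear_hpart, of i "?l P"]
    using hpart_Sym[OF Sym_lie_symbol[OF P], of i] tilde_below_hpart[of _ i p i i] by simp
  moreover have "casimir_form w1 w2 \<delta> (?L A) = gamma_ip CARD('n) \<delta> i p *\<^sub>R ?L A"
    unfolding casimir_form_lie_form[OF sA] A'(3) by (rule L(2)[OF sA])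
  ultimately show ?thesis using lie_form_tilde_below[OF A'(1)] by (simp add: is_symbol_lift_def)
qed

lemma S_tilde_eq:
  assumes card2: "CARD('n::{finite,linorder}) \<ge> 2"
  shows "S_tilde i p = (tilde_below i p (Suc i) :: 'n symbol set)"
proof (rule set_eqI)
  fix P :: "'n symbol"
  have I: "{jq \<in> tilde_index i p. fst jq < Suc i} = tilde_index i p"
    by (auto dest: tilde_indexD)
  have "P \<in> tilde_below i p (Suc i) \<longleftrightarrow>
      (\<exists>R. (\<forall>jq\<in>tilde_index i p. R jq \<in> Sym (fst jq) (snd jq)) \<and> P
          = (\<Sum>jq\<in>tilde_index i p. R jq))"
    unfolding tilde_below_def I by (rule span_Union_subspaces[OF finite_tilde_index subspace_Sym])
  also have "\<dots> \<longleftrightarrow> (\<exists>R.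
      (\<forall>(j, q)\<in>tilde_index i p. R j q \<in> S_ip j q) \<and>
      P = (\<lambda>a b x. \<Sum>(j, q)\<in>tilde_index i p. R j q a b x))"
  proof safe
    fix R assume R: "\<forall>jq\<in>tilde_index i p. R jq \<in> (Sym (fst jq) (snd jq) :: 'n symbol set)"
    have "R (j, q) \<in> S_ip j q" if "(j, q) \<in> tilde_index i p" for j q
      using R that S_ip_eq_Sym[OF card2 tilde_indexD(3)[OF that]] by force
    then show "\<exists>R'. (\<forall>(j, q)\<in>tilde_index i p. R' j q \<in> S_ip j q) \<and>
      (\<Sum>jq\<in>tilde_index i p. R jq) = (\<lambda>a b x. \<Sum>(j, q)\<in>tilde_index i p. R' j q
          a b x)"
      by (intro exI[of _ "\<lambda>j q. R (j, q)"]) (auto simp: fun_eq_iff case_prod_beta)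
  next
    fix R assume R: "\<forall>(j, q)\<in>tilde_index i p. R j q \<in> (S_ip j q :: 'n symbol set)"
    have "R j q \<in> Sym j q" if "(j, q) \<in> tilde_index i p" for j q
      using R that S_ip_eq_Sym[OF card2 tilde_indexD(3)[OF that]] by force
    then show "\<exists>R'. (\<forall>jq\<in>tilde_index i p. R' jq \<in> Sym (fst jq) (snd jq)) \<and>
      (\<lambda>a b x. \<Sum>(j, q)\<in>tilde_index i p. R j q a b x)
          = (\<Sum>jq\<in>tilde_index i p. R' jq)"
      by (intro exI[of _ "\<lambda>jq. R (fst jq) (snd jq)"]) (auto simp: fun_eq_iff case_prod_beta)
  qed
  finally show "P \<in> S_tilde i p \<longleftrightarrow> P \<in> tilde_below i p (Suc i)"
      by (simp add: S_tilde_def)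
qed

lemma principal_symbol_bidiff:
  "A \<in> symbols \<Longrightarrow> principal_symbol (bidiff A) = hpart (total_order (bidiff A)) A"
  by (intro ext) (simp add: principal_symbol_def hpart_def polynomial_form_bidiff)

lemma hpart_eq_0_iff: "hpart d A = 0 \<longleftrightarrow>
    (\<forall>a b. msize a + msize b = d \<longrightarrow> A a b = 0)"
  by (auto simp: hpart_def fun_eq_iff)

lemma finite_degrees:
  assumes "A \<in> symbols" shows "finite {msize a + msize b | a b. A a b \<noteq> (\<lambda>x. 0)}"
proof -
  have "{msize a + msize b | a b. A a b \<noteq> (\<lambda>x. 0)}
      = (\<lambda>(a, b). msize a + msize b) ` {(a, b). A a b \<noteq> (\<lambda>x. 0)}"
    by auto
  then show ?thesis using assms by (simp add: symbols_def)
qed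

lemma total_order_eqI:
  assumes A: "A \<in> symbols" and d: "hpart d A \<noteq> 0" and e: "\<And>e. d < e
      \<Longrightarrow> hpart e A = 0"
  shows "total_order (bidiff A) = d"
  unfolding total_order_def polynomial_form_bidiff[OF A]
proof (rule Max_eqI[OF finite_degrees[OF A]])
  show "d \<in> {msize a + msize b | a b. A a b \<noteq> (\<lambda>x. 0)}"
    using d unfolding hpart_eq_0_iff zero_fun_eq by auto
  fix c assume "c \<in> {msize a + msize b | a b. A a b \<noteq> (\<lambda>x. 0)}"
  then have "hpart c A \<noteq> 0" unfolding hpart_eq_0_iff zero_fun_eq by auto
  then show "c \<le> d" using e[of c] by (cases "c \<le> d") auto
qed

lemma hpart_total_order_nonzero:
  assumes A: "A \<in> symbols" and "A \<noteq> 0"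
  shows "hpart (total_order (bidiff A)) A \<noteq> 0"
proof -
  have "{msize a + msize b | a b. A a b \<noteq> (\<lambda>x. 0)} \<noteq> {}"
    using \<open>A \<noteq> 0\<close> by (auto simp: fun_eq_iff)
  from Max_in[OF finite_degrees[OF A] this] obtain a b where "A a b \<noteq> (\<lambda>x. 0)"
    "total_order (bidiff A) = msize a + msize b"
    unfolding total_order_def polynomial_form_bidiff[OF A] by auto
  then show ?thesis unfolding hpart_eq_0_iff zero_fun_eq by auto
qed

text \<open>
  If \<open>P \<noteq> 0\<close>, a principal symbol of type \<open>(i, p)\<close> fixes the order as \<open>i\<close>, and comparing top
  components fixes the eigenvalue as \<open>\<gamma>\<^bsub>i,p\<^esub>\<close>. If \<open>P = 0\<close>, only the zero operator qualifies,
  because the principal symbol of a nonzero operator does not vanish.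
\<close>

lemma is_eigen_lift_iff:
  fixes P :: "'n::{finite,linorder} symbol"
  assumes card2: "CARD('n) \<ge> 2" and \<delta>: "\<delta> = \<mu> - w1 - w2" and nc:
      "\<not> critical CARD('n) \<delta>"
    and p: "p \<le> i div 2" and P: "P \<in> Sym i p"
  shows "is_eigen_lift w1 w2 \<mu> i p P T \<longleftrightarrow>
      (\<exists>A. is_symbol_lift w1 w2 \<delta> i p P A \<and> T = bidiff A)"
proof
  let ?g = "gamma_ip CARD('n) \<delta> i p"
  note cas = lin_on_symbolsD[OF lin_on_symbols_casimir_form[of w1 w2 \<delta>]]
  assume "\<exists>A. is_symbol_lift w1 w2 \<delta> i p P A \<and> T = bidiff A"
  then obtain A where A: "A \<in> tilde_below i p (Suc i)" "hpart i A = P"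
      "casimir_form w1 w2 \<delta> A = ?g *\<^sub>R A"
    and T: "T = bidiff A" and lift: "is_symbol_lift w1 w2 \<delta> i p P A"
        by (auto simp: is_symbol_lift_def)
  have sA: "A \<in> symbols" using A(1) tilde_below_symbols by blast
  have "casimir_op w1 w2 \<mu> T = (\<lambda>f g x. ?g * T f g x)"
    unfolding T casimir_op_bidiff[OF sA \<delta>] A(3) bidiff_scale[OF sA] by (simp add: fun_eq_iff)
  moreover have "principal_symbol T = P"
  proof (cases "P = 0")
    case True
    have "is_symbol_lift w1 w2 \<delta> i p P 0"
      unfolding is_symbol_lift_def True linear_0[OF linear_hpart] cas(3)
      using subspace_0[OF subspace_tilde_below] by simp
    then have "A = 0" using symbol_lift_unique[OF nc p lift] by blast
    then show ?thesis unfolding T principal_symbol_bidiff[OF sA] True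
        by (simp only: linear_0[OF linear_hpart])
  next
    case False
    have "total_order (bidiff A) = i"
      using False A(2) tilde_below_hpart[OF A(1)] by (intro total_order_eqI sA) auto
    then show ?thesis unfolding T principal_symbol_bidiff[OF sA] using A(2) by simp
  qed
  ultimately show "is_eigen_lift w1 w2 \<mu> i p P T"
    unfolding is_eigen_lift_def using sA A(1)
    by (auto simp: T bidiff_ops_def polynomial_form_bidiff S_tilde_eq[OF card2])
next
  let ?g = "gamma_ip CARD('n) \<delta> i p"
  note cas = lin_on_symbolsD[OF lin_on_symbols_casimir_form[of w1 w2 \<delta>]]
  assume T: "is_eigen_lift w1 w2 \<mu> i p P T"
  then obtain A where sA: "A \<in> symbols" and TA: "T = bidiff A"
      by (auto simp: is_eigen_lift_def bidiff_ops_def)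
  from T obtain c where c: "casimir_op w1 w2 \<mu> T = (\<lambda>f g x. c * T f g x)"
      by (auto simp: is_eigen_lift_def)
  have A: "A \<in> tilde_below i p (Suc i)"
    using T S_tilde_eq[OF card2, of i p] by (simp add: is_eigen_lift_def TA polynomial_form_bidiff[OF sA])
  have ps: "hpart (total_order (bidiff A)) A = P"
    using T principal_symbol_bidiff[OF sA] by (simp add: is_eigen_lift_def TA)
  have "bidiff (casimir_form w1 w2 \<delta> A) = bidiff (c *\<^sub>R A)"
    using c unfolding TA casimir_op_bidiff[OF sA \<delta>] bidiff_scale[OF sA] by (simp add: fun_eq_iff)
  then have cA: "casimir_form w1 w2 \<delta> A = c *\<^sub>R A"
    by (rule bidiff_inj[OF symbols_casimir_form[OF sA] symbols_scale[OF sA]])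
  have "is_symbol_lift w1 w2 \<delta> i p P A"
  proof (cases "A = 0")
    case True
    then have "P = 0" using ps linear_0[OF linear_hpart] by blast
    then show ?thesis unfolding is_symbol_lift_def True linear_0[OF linear_hpart] cas(3)
      using subspace_0[OF subspace_tilde_below] by simp
  next
    case False
    then have "P \<noteq> 0" using hpart_total_order_nonzero[OF sA] ps by simp
    moreover have "hpart d (hpart d A) = hpart d A" for d by (simp add: hpart_def fun_eq_iff)
    then have "hpart (total_order (bidiff A)) P = P" using ps by metis
    ultimately have "hpart (total_order (bidiff A)) P \<noteq> 0" by simp
    then have "total_order (bidiff A) = i" using hpart_Sym[OF P, of "total_order (bidiff A)"]
        by (auto split: if_splits)
    then have h: "hpart i A = P" using ps by simp
    have A2: "A - P \<in> tilde_below i p i" using tilde_top(2)[OF p A] h by simp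
    note ip = tilde_index_self[OF p]
    have "casimir_form w1 w2 \<delta> (P + (A - P)) = casimir_form w1 w2 \<delta> P
        + casimir_form w1 w2 \<delta> (A - P)"
      by (rule cas(1)[OF Sym_symbols[OF P] tilde_below_symbols[OF A2]])
    then have e: "casimir_form w1 w2 \<delta> A = ?g *\<^sub>R P
        + ((casimir_form w1 w2 \<delta> P - ?g *\<^sub>R P) + casimir_form w1 w2 \<delta> (A - P))"
    proof -
      have "X + Y = Z + ((X - Z) + Y)" "P + (A - P) = A" for X Y Z :: "'n symbol" by simp_all
      then show ?thesis using \<open>casimir_form w1 w2 \<delta> (P + (A - P)) = _\<close> by metis
    qed
    have "(casimir_form w1 w2 \<delta> P - ?g *\<^sub>R P) + casimir_form w1 w2 \<delta> (A - P)
        \<in> tilde_below i p i"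
      by (intro subspace_add[OF subspace_tilde_below] casimir_form_Sym[OF ip P] casimir_form_tilde_below A2)
    from tilde_below_hpart[OF this order_refl]
    have "hpart i (casimir_form w1 w2 \<delta> A) = ?g *\<^sub>R P"
      unfolding e linear_add[OF linear_hpart, of i "?g *\<^sub>R P"] linear_scale[OF linear_hpart]
      using hpart_Sym[OF P, of i] by simp
    moreover have "hpart i (casimir_form w1 w2 \<delta> A) = c *\<^sub>R P"
      unfolding cA linear_scale[OF linear_hpart] h ..
    ultimately have "c = ?g" using \<open>P \<noteq> 0\<close> by (metis scaleR_cancel_right)
    then show ?thesis using A h cA by (simp add: is_symbol_lift_def)
  qed
  then show "\<exists>A. is_symbol_lift w1 w2 \<delta> i p P A \<and> T = bidiff A" using TA by blast
qed

section \<open>Decomposition of a symbol and equivariance\<close>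

text \<open>
  The property by which \<open>components P\<close> is defined, in terms of eigenspaces.
\<close>

definition is_components :: "'n::{finite,linorder} symbol \<Rightarrow>
    (nat \<Rightarrow> nat \<Rightarrow> 'n symbol) \<Rightarrow> bool" where
  "is_components P R \<longleftrightarrow> (\<forall>i p. if p \<le> i div 2 then R i p
      \<in> Sym i p else R i p = 0) \<and>
     finite {(i, p). R i p \<noteq> 0} \<and> P = (\<Sum>(i, p) | R i p \<noteq> 0. R i p)"

lemma is_componentsD:
  assumes "is_components P R"
  shows "p \<le> i div 2 \<Longrightarrow> R i p \<in> Sym i p" "\<not> p \<le> i div 2
      \<Longrightarrow> R i p = 0"
    "finite {(i, p). R i p \<noteq> 0}" "P = (\<Sum>(i, p) | R i p \<noteq> 0. R i p)"
proof -
  have "if p \<le> i div 2 then R i p \<in> Sym i p else R i p = 0" using assms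
      by (simp add: is_components_def)
  then show "p \<le> i div 2 \<Longrightarrow> R i p \<in> Sym i p" "\<not> p \<le> i div 2
      \<Longrightarrow> R i p = 0" by simp_all
  show "finite {(i, p). R i p \<noteq> 0}" "P = (\<Sum>(i, p) | R i p \<noteq> 0. R i p)" using assms
      by (simp_all add: is_components_def)
qed

lemma is_components_hpart:
  assumes R: "is_components P R"
  shows "hpart d P = (\<Sum>q\<le>d div 2. R d q)"
proof -
  let ?J = "{(i, p). R i p \<noteq> 0}" and ?Q = "{q. R d q \<noteq> 0}"
  note D = is_componentsD[OF R]
  have S: "hpart d (R i p) = (if d = i then R i p else 0)" for i p
    using D(1)[of p i] D(2)[of p i] hpart_Sym[of "R i p" i p d] linear_0[OF linear_hpart, of d]
    by (cases "p \<le> i div 2") auto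
  have "hpart d P = (\<Sum>ip\<in>?J. hpart d (R (fst ip) (snd ip)))"
    by (subst D(4)) (simp add: linear_sum[OF linear_hpart] case_prod_beta)
  also have "\<dots> = (\<Sum>ip\<in>?J. if d = fst ip then R (fst ip) (snd ip) else 0)" by (simp only: S)
  also have "\<dots> = (\<Sum>ip\<in>Pair d ` ?Q. R (fst ip) (snd ip))"
    by (rule sum.mono_neutral_cong_right[OF D(3)]) auto
  also have "\<dots> = (\<Sum>q\<in>?Q. R d q)"
    by (subst sum.reindex) (auto simp: inj_on_def)
  also have "\<dots> = (\<Sum>q\<le>d div 2. R d q)"
    by (rule sum.mono_neutral_left) (use D(2)[of _ d] in \<open>auto intro: ccontr\<close>)
  finally show ?thesis .
qed

lemma is_components_unique:
  assumes R: "is_components P R" and R': "is_components P R'"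
  shows "R = R'"
proof (intro ext[of R R'] ext[of "R _" "R' _"])
  fix d q
  show "R d q = R' d q"
  proof (cases "q \<le> d div 2")
    case False
    then show ?thesis using is_componentsD(2)[OF R] is_componentsD(2)[OF R'] by simp
  next
    case True
    have "(\<Sum>q\<le>d div 2. R d q - R' d q) = 0"
      using is_components_hpart[OF R, of d] is_components_hpart[OF R', of d]
          by (simp only: sum_subtractf diff_self)
    then have "R d q - R' d q = 0"
      by (rule Sym_independent[rotated]) (use True is_componentsD(1)[OF R] is_componentsD(1)[OF R']
         in \<open>auto intro: subspace_diff[OF subspace_Sym]\<close>)
    then show ?thesis by simp
  qed
qed

lemma symbols_hpart: "A \<in> symbols \<Longrightarrow> hpart d A \<in> symbols"
proof -
  assume A: "A \<in> symbols"
  obtain I where I: "finite I" "\<And>a b. (a, b) \<notin> I \<Longrightarrow> A a b = 0"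
      using A symbols_supp by blast
  show ?thesis
    by (rule symbolsI[of _ I]) (use I in \<open>auto simp: hpart_def intro!: smooth_zero symbols_smooth[OF A]\<close>)
qed

lemma hpart_homogeneous: "ptw euler_total (hpart d A) = real d *\<^sub>R hpart d A"
proof (rule slice_eqI)
  fix x
  have "euler_total (slice (hpart d A) x) = real d *\<^sub>R slice (hpart d A) x"
    by (intro ext) (auto simp: euler_total_apply slice_def hpart_def)
  then show "slice (ptw euler_total (hpart d A)) x = slice (real d *\<^sub>R hpart d A) x"
    by (simp only: slice_ptw slice_linear)
qed

lemma components_exist:
  assumes P: "P \<in> symbols"
  shows "\<exists>R. is_components P R"
proof -
  have "\<exists>w. (\<forall>q\<le>d div 2. w q \<in> Sym d q) \<and> hpart d P
      = (\<Sum>q\<le>d div 2. w q)" for d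
    by (rule Sym_decompose[OF symbols_hpart[OF P] hpart_homogeneous])
  then obtain w where w: "\<And>d q. q \<le> d div 2 \<Longrightarrow> w d q \<in> Sym d q"
      "\<And>d. hpart d P = (\<Sum>q\<le>d div 2. w d q)"
    by metis
  define R where "R d q = (if q \<le> d div 2 then w d q else 0)" for d q
  define D where "D = {msize a + msize b | a b. P a b \<noteq> (\<lambda>x. 0)}"
  have D: "finite D" unfolding D_def by (rule finite_degrees[OF P])
  have hp0: "hpart d P = 0" if "d \<notin> D" for d
    using that unfolding hpart_eq_0_iff D_def zero_fun_eq by auto
  have w0: "w d q = 0" if "d \<notin> D" "q \<le> d div 2" for d q
    by (rule Sym_independent[of d "w d" "{..d div 2}"]) (use w hp0 that in \<open>auto simp flip: w(2)\<close>)
  have sub: "{(i, p). R i p \<noteq> 0} \<subseteq> Sigma D (\<lambda>d. {..d div 2})"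
    using w0 by (auto simp: R_def split: if_splits)
  have fin: "finite (Sigma D (\<lambda>d. {..d div 2}))" using D by auto
  have "P = (\<Sum>d\<in>D. hpart d P)"
  proof (intro ext)
    fix a b x
    have "(\<Sum>d\<in>D. hpart d P) a b x = (\<Sum>d\<in>D. if d = msize a + msize b then P a b x else 0)"
      by (auto simp: hpart_def intro!: sum.cong)
    also have "\<dots> = P a b x"
      using D by (cases "P a b = (\<lambda>x. 0)") (auto simp: D_def)
    finally show "P a b x = (\<Sum>d\<in>D. hpart d P) a b x" ..
  qed
  also have "\<dots> = (\<Sum>d\<in>D. \<Sum>q\<le>d div 2. R d q)"
    by (simp add: w(2) R_def)
  also have "\<dots> = (\<Sum>(d, q)\<in>Sigma D (\<lambda>d. {..d div 2}). R d q)"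
    using D by (simp add: sum.Sigma)
  also have "\<dots> = (\<Sum>(d, q) | R d q \<noteq> 0. R d q)"
    using fin sub by (intro sum.mono_neutral_right) auto
  finally have "P = (\<Sum>(d, q) | R d q \<noteq> 0. R d q)" .
  moreover have "finite {(i, p). R i p \<noteq> 0}" using finite_subset[OF sub fin] .
  moreover have "\<forall>i p. if p \<le> i div 2 then R i p \<in> Sym i p else R i p = 0" using w(1)
      by (simp add: R_def)
  ultimately have "is_components P R" unfolding is_components_def by (intro conjI)
  then show ?thesis by blast
qed

lemma components_eqI:
  fixes P :: "'n::{finite,linorder} symbol"
  assumes card2: "CARD('n) \<ge> 2" and R: "is_components P R"
  shows "components P = R"
proof -
  have "((\<forall>i p. if p \<le> i div 2 then R i p \<in> S_ip i p else R i p = (\<lambda>a b x. 0))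
      \<and>
     finite {(i, p). R i p \<noteq> (\<lambda>a b x. 0)} \<and>
     P = (\<lambda>a b x. \<Sum>(i, p) | R i p \<noteq> (\<lambda>a b x. 0). R i p a b x))
         \<longleftrightarrow> is_components P R" for R
  proof -
    have z: "(\<lambda>a b x. 0) = (0 :: 'n symbol)" by (simp add: fun_eq_iff)
    have s: "(\<lambda>a b x. \<Sum>(i, p) | R i p \<noteq> 0. R i p a b x)
        = (\<Sum>(i, p) | R i p \<noteq> 0. R i p)"
      by (simp add: fun_eq_iff case_prod_beta)
    have c: "(if p \<le> i div 2 then R i p \<in> S_ip i p else R i p = 0)
        = (if p \<le> i div 2 then R i p \<in> Sym i p else R i p = 0)" for i p
      using S_ip_eq_Sym[OF card2, of p i] by simp
    show ?thesis unfolding z s c is_components_def ..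
  qed
  then show ?thesis unfolding components_def
    using R is_components_unique by (intro the_equality) blast+
qed

theorem proposition9:
  fixes w1 w2 \<mu> \<delta> :: real
  assumes "CARD('n::{finite,linorder}) \<ge> 2"
    and "\<delta> = \<mu> - w1 - w2"
    and "resonant CARD('n) \<delta>"
    and "\<not> critical CARD('n) \<delta>"
  shows "(\<forall>i p. p \<le> i div 2 \<longrightarrow>
            (\<forall>P \<in> (S_ip i p :: 'n symbol set). \<exists>!T. is_eigen_lift w1 w2 \<mu> i p P
                T)) \<and>
         (\<forall>X \<in> sl_proj. \<forall>P \<in> (symbols :: 'n symbol set).
            Q_map w1 w2 \<mu> (lie_symbol \<delta> X P) = lie_op w1 w2 \<mu> X (Q_map w1 w2 \<mu> P))"
proof -
  note card2 = assms(1) and \<delta> = assms(2) and nc = assms(4)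
  note iff = is_eigen_lift_iff[OF card2 \<delta> nc]
  have unique: "\<exists>!T. is_eigen_lift w1 w2 \<mu> i p P T" if "p \<le> i div 2" "P
      \<in> Sym i p" for i p and P :: "'n symbol"
    using symbol_lift_exists[OF nc that] symbol_lift_unique[OF nc that(1)] unfolding iff[OF that] by metis
  have lift: "eigen_lift w1 w2 \<mu> i p P = bidiff A" if p: "p \<le> i div 2" and P: "P \<in> Sym i p"
    and A: "is_symbol_lift w1 w2 \<delta> i p P A" for i p A and P :: "'n symbol"
    unfolding eigen_lift_def
    by (rule the1_equality[OF unique[OF p P]]) (use A iff[OF p P] in blast)
  show ?thesis
  proof (intro conjI allI impI ballI)
    fix i p and P :: "'n symbol" assume "p \<le> i div 2" "P \<in> S_ip i p"
    then show "\<exists>!T. is_eigen_lift w1 w2 \<mu> i p P T" using unique S_ip_eq_Sym[OF card2] by blast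
  next
    fix X :: "'n vfield" and P :: "'n symbol" assume "X \<in> sl_proj" and P: "P \<in> symbols"
    then obtain u M v where X: "X = proj_field u M v" unfolding sl_proj_iff by blast
    let ?l = "lie_symbol \<delta> X" and ?L = "lie_form w1 w2 \<delta> u M v"
    note l = lin_on_symbolsD[OF lin_on_symbols_lie_symbol[of \<delta> u M v]]
    obtain R where R: "is_components P R" using components_exist[OF P] by blast
    note D = is_componentsD[OF R]
    \<comment> \<open>A component can be annihilated by the Lie derivative, so the index set \<open>?K\<close> of the
        components of \<open>L\<^sub>X P\<close> may be smaller than that of \<open>P\<close>. The fact \<open>e0\<close> shows that the
        lifts of the components lost in this way are annihilated as well.\<close>
    let ?J = "{(i, p). R i p \<noteq> 0}" and ?K = "{(i, p). ?l (R i p) \<noteq> 0}"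
    have KJ: "?K \<subseteq> ?J" using l(3) by (auto simp: X)
    have Rs: "R i p \<in> symbols" for i p
      using D(1,2) Sym_symbols symbols_zero by metis
    have "?l P = (\<Sum>ip\<in>?J. ?l (R (fst ip) (snd ip)))"
      unfolding X by (subst D(4)) (simp add: lin_on_symbols_sum[OF lin_on_symbols_lie_symbol] Rs
          case_prod_beta)
    also have "\<dots> = (\<Sum>ip\<in>?K. ?l (R (fst ip) (snd ip)))"
      by (rule sum.mono_neutral_right[OF D(3) KJ]) auto
    finally have lP: "?l P = (\<Sum>(i, p)\<in>?K. ?l (R i p))" by (simp add: case_prod_beta)
    have lR: "is_components (?l P) (\<lambda>i p. ?l (R i p))"
      unfolding is_components_def
    proof (intro conjI allI)
      show "if p \<le> i div 2 then ?l (R i p) \<in> Sym i p else ?l (R i p) = 0" for i p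
        using D(1,2)[of p i] l(3) by (simp add: X Sym_lie_symbol)
      show "finite ?K" using finite_subset[OF KJ D(3)] .
    qed (rule lP)
    note comp = components_eqI[OF card2 R] components_eqI[OF card2 lR]
    define A where "A i p = (SOME A. is_symbol_lift w1 w2 \<delta> i p (R i p) A)" for i p
    have A: "is_symbol_lift w1 w2 \<delta> i p (R i p) (A i p)" if "p \<le> i div 2" for i p
      unfolding A_def by (rule someI_ex[OF symbol_lift_exists[OF nc that D(1)[OF that]]])
    have As: "A i p \<in> symbols" if "(i, p) \<in> ?J" for i p
      using A[of p i] D(2)[of p i] that tilde_below_symbols unfolding is_symbol_lift_def by blast
    have LA: "is_symbol_lift w1 w2 \<delta> i p (?l (R i p)) (?L (A i p))" if "p \<le> i div 2" for i p
      unfolding X by (rule symbol_lift_lie_form[OF that A[OF that]])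
    have e1: "eigen_lift w1 w2 \<mu> i p (R i p) = bidiff (A i p)" if "(i, p) \<in> ?J" for i p
      using lift[OF _ D(1) A] D(2)[of p i] that by blast
    have e2: "eigen_lift w1 w2 \<mu> i p (?l (R i p)) = bidiff (?L (A i p))" if "(i, p) \<in> ?J" for i p
    proof -
      have p: "p \<le> i div 2" using D(2)[of p i] that by blast
      have "?l (R i p) \<in> Sym i p" unfolding X by (rule Sym_lie_symbol[OF D(1)[OF p]])
      from lift[OF p this LA[OF p]] show ?thesis .
    qed
    have z: "(\<lambda>a b x. 0) = (0 :: 'n symbol)" by (simp add: fun_eq_iff)
    have e0: "bidiff (?L (A i p)) = 0" if ip: "(i, p) \<in> ?J" and "?l (R i p) = 0" for i p
    proof -
      have p: "p \<le> i div 2" using D(2)[of p i] ip by blast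
      have "is_symbol_lift w1 w2 \<delta> i p 0 (0 :: 'n symbol)"
        unfolding is_symbol_lift_def linear_0[OF linear_hpart]
            lin_on_symbolsD(3)[OF lin_on_symbols_casimir_form]
        using subspace_0[OF subspace_tilde_below] by simp
      then have "?L (A i p) = 0" using symbol_lift_unique[OF nc p LA[OF p]] that(2) by simp
      then show ?thesis by (simp only: bidiff_zero)
    qed
    have "Q_map w1 w2 \<mu> P = (\<Sum>ip\<in>?J. bidiff (A (fst ip) (snd ip)))"
    proof -
      have "(\<Sum>ip\<in>?J. eigen_lift w1 w2 \<mu> (fst ip) (snd ip) (R (fst ip) (snd ip)))
          = (\<Sum>ip\<in>?J. bidiff (A (fst ip) (snd ip)))"
        by (rule sum.cong) (use e1 in auto)
      then show ?thesis unfolding Q_map_def comp z by (simp add: fun_eq_iff case_prod_beta)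
    qed
    also have "\<dots> = bidiff (\<Sum>ip\<in>?J. A (fst ip) (snd ip))"
      by (rule bidiff_sum[symmetric]) (use As in auto)
    finally have "lie_op w1 w2 \<mu> X (Q_map w1 w2 \<mu> P)
        = bidiff (?L (\<Sum>ip\<in>?J. A (fst ip) (snd ip)))"
      unfolding X \<delta> using lie_op_bidiff[OF symbols_sum, of ?J
          "\<lambda>ip. A (fst ip) (snd ip)"] As by auto
    also have "?L (\<Sum>ip\<in>?J. A (fst ip) (snd ip)) = (\<Sum>ip\<in>?J. ?L (A (fst ip) (snd ip)))"
      by (rule lin_on_symbols_sum[OF lin_on_symbols_lie_form]) (use As in auto)
    also have "bidiff \<dots> = (\<Sum>ip\<in>?J. bidiff (?L (A (fst ip) (snd ip))))"
      by (rule bidiff_sum) (use As in \<open>auto intro!: symbols_lie_form\<close>)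
    also have "\<dots> = (\<Sum>ip\<in>?K. bidiff (?L (A (fst ip) (snd ip))))"
      by (rule sum.mono_neutral_right[OF D(3) KJ]) (use e0 in auto)
    also have "\<dots> = (\<Sum>ip\<in>?K. eigen_lift w1 w2 \<mu> (fst ip) (snd ip)
        (?l (R (fst ip) (snd ip))))"
    proof (rule sum.cong[OF refl])
      fix ip assume "ip \<in> ?K"
      then have "(fst ip, snd ip) \<in> ?J" using KJ by auto
      from e2[OF this] show "bidiff (?L (A (fst ip) (snd ip)))
          = eigen_lift w1 w2 \<mu> (fst ip) (snd ip) (?l (R (fst ip) (snd ip)))" ..
    qed
    also have "\<dots> = Q_map w1 w2 \<mu> (?l P)"
      unfolding Q_map_def comp z by (simp add: fun_eq_iff case_prod_beta)
    finally show "Q_map w1 w2 \<mu> (lie_symbol \<delta> X P)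
        = lie_op w1 w2 \<mu> X (Q_map w1 w2 \<mu> P)" ..
  qed
qed

end
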